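(* Let $(M_1,F_1)$ and $(M_2,F_2)$ be Finsler manifolds, let $f$ be a product function, and let $(M,F)$, $M=M_1\times M_2$, $F=\sqrt{f(F_1^2,F_2^2)}$, be their Minkowskian product Finsler manifold with respect to $f$. Then $(M,F)$ is a Landsberg manifold if and only if $(M_1,F_1)$ and $(M_2,F_2)$ are both Landsberg manifolds.
   Context: A Finsler metric on a manifold $N$ is a function $F:TN\to[0,\infty)$ such that: $G=F^2$ is smooth on $TN\setminus\{0\}$; $F>0$ off the zero section; $F(x,\lambda y)=|\lambda|F(x,y)$ for all $\lambda\in\mathbb{R}$; and the Hessian $(G_{\alpha\beta})=\left(\frac{\partial^2G}{\partial y^\alpha\partial y^\beta}\right)$ (no factor $\frac12$) is positive definite off the zero section. $(G^{\alpha\beta})$ denotes the inverse matrix of $(G_{\alpha\beta})$. A product function is a continuous $f:[0,\infty)\times[0,\infty)\to[0,\infty)$ with: (a) $f(s,t)=0$ iff $(s,t)=(0,0)$; (b) $f(\lambda s,\lambda t)=\lambda f(s,t)$ for $\lambda\ge 0$; (c) $f$ is smooth on $(0,\infty)^2$; (d) $\frac{\partial f}{\partial s}\ne0$ and $\frac{\partial f}{\partial t}\neq0$ on $(0,\infty)^2$; (e) $\frac{\partial f}{\partial s}\frac{\partial f}{\partial t}-2f\frac{\partial^2f}{\partial s\partial t}\ne0$ on $(0,\infty)^2$. Given Finsler manifolds $(M_1,F_1)$, $(M_2,F_2)$ of dimensions $m$, $n$, put $K=F_1^2$, $H=F_2^2$. The Minkowskian product Finsler manifold with respect to $f$ is $M=M_1\times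 M_2$ with $F=\sqrt{f(K,H)}$ on $TM\cong TM_1\oplus TM_2$; write $G=F^2=f(K,H)$. Since $f$ is smooth only on the open quadrant, all geometric objects of $F$ are considered at points $(x,y)\in TM$ whose $TM_1$- and $TM_2$-components are both nonzero (i.e. $K\ne0$, $H\ne0$); $(G_{\alpha\beta})$ is invertible there. For a Finsler metric (or for the product $F$) with $G=F^2$, in induced local coordinates $(x^\alpha,y^\alpha)$ on the tangent bundle, set $\mathbb{G}^\alpha=\frac12G^{\alpha\beta}\left(\frac{\partial^2G}{\partial y^\beta\partial x^\gamma}y^\gamma-\frac{\partial G}{\partial x^\beta}\right)$ (summation convention). The Berwald curvature is $B^\alpha_{\beta\gamma\eta}=\frac{\partial^3\mathbb{G}^\alpha}{\partial y^\beta\partial y^\gamma\partial y^\eta}$ and the Landsberg curvature is $L_{\beta\gamma\eta}=-\frac14y^\nu G_{\nu\alpha}B^\alpha_{\beta\gamma\eta}$. The manifold is a Landsberg manifold if $L_{\beta\gamma\eta}\equiv0$. *)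

theory Defs
  imports "HOL-Analysis.Analysis"
begin

section \<open>Smooth functions on open sets\<close>

definition dderiv :: "'a::real_normed_vector \<Rightarrow> ('a \<Rightarrow> 'b::real_normed_vector) \<Rightarrow> 'a \<Rightarrow> 'b" where
  "dderiv v g z = frechet_derivative g (at z) v"

text \<open>Only used for open \<open>S\<close>; in finite dimension, continuity of all iterated directional
  derivatives of order at most \<open>k\<close> is the usual class \<open>C^k\<close>.\<close>

primrec Ck_on :: "nat \<Rightarrow> ('a::euclidean_space \<Rightarrow> 'b::euclidean_space) \<Rightarrow> 'a set \<Rightarrow> bool" where
  "Ck_on 0 g S = continuous_on S g"
| "Ck_on (Suc k) g S = ((\<forall>z\<in>S. g differentiable (at z)) \<and> (\<forall>v. Ck_on k (dderiv v g) S))"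

definition smooth_on :: "('a::euclidean_space \<Rightarrow> 'b::euclidean_space) \<Rightarrow> 'a set \<Rightarrow> bool" where
  "smooth_on g S \<longleftrightarrow> (\<forall>k. Ck_on k g S)"


section \<open>Smooth manifolds\<close>

text \<open>A chart is a pair of its domain \<open>U\<close> and its coordinate map, whose values outside \<open>U\<close> are
  irrelevant.\<close>

type_synonym ('a, 'n) chart = "'a set \<times> ('a \<Rightarrow> real ^ 'n)"

definition charts :: "'a topology \<Rightarrow> ('a, 'n::finite) chart set" where
  "charts X = {(U, \<phi>). openin X U \<and> open (\<phi> ` U) \<and>
     homeomorphic_map (subtopology X U) (top_of_set (\<phi> ` U)) \<phi>}"

definition chart_inv :: "('a, 'n::finite) chart \<Rightarrow> real ^ 'n \<Rightarrow> 'a" where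
  "chart_inv c = inv_into (fst c) (snd c)"

definition transition :: "('a, 'n::finite) chart \<Rightarrow> ('a, 'n) chart \<Rightarrow> real ^ 'n \<Rightarrow> real ^ 'n" where
  "transition c d = snd d \<circ> chart_inv c"

definition compatible :: "('a, 'n::finite) chart \<Rightarrow> ('a, 'n) chart \<Rightarrow> bool" where
  "compatible c d \<longleftrightarrow>
     smooth_on (transition c d) (snd c ` (fst c \<inter> fst d)) \<and>
     smooth_on (transition d c) (snd d ` (fst c \<inter> fst d))"

text \<open>A smooth structure is a maximal smooth atlas. Manifolds are nonempty, Hausdorff and second
  countable; their dimension \<open>CARD('n)\<close> is positive.\<close>

definition smooth_manifold :: "'a topology \<Rightarrow> ('a, 'n::finite) chart set \<Rightarrow> bool" where
  "smooth_manifold X A \<longleftrightarrow>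
     topspace X \<noteq> {} \<and> Hausdorff_space X \<and> second_countable X \<and>
     A \<subseteq> charts X \<and> (\<Union>c\<in>A. fst c) = topspace X \<and>
     (\<forall>c\<in>A. \<forall>d\<in>A. compatible c d) \<and>
     (\<forall>c\<in>charts X. (\<forall>d\<in>A. compatible c d) \<longrightarrow> c \<in> A)"


section \<open>Tangent bundle\<close>

text \<open>A tangent vector is its base point together with the set of all pairs \<open>(d, w)\<close>, where \<open>d\<close> is
  a chart at the base point and \<open>w\<close> the coordinate vector in that chart, i.e. an equivalence class
  under the transformation rule for components. \<open>tangent A c p v\<close> is the vector at \<open>p\<close> with
  components \<open>v\<close> in the chart \<open>c\<close>.\<close>

type_synonym ('a, 'n) tvec = "'a \<times> (('a, 'n) chart \<times> (real ^ 'n)) set"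

definition tangent ::
    "('a, 'n::finite) chart set \<Rightarrow> ('a, 'n) chart \<Rightarrow> 'a \<Rightarrow> real ^ 'n \<Rightarrow> ('a, 'n) tvec" where
  "tangent A c p v =
     (p, {(d, w). d \<in> A \<and> p \<in> fst d \<and> w = dderiv v (transition c d) (snd c p)})"

definition tangent_bundle :: "('a, 'n::finite) chart set \<Rightarrow> ('a, 'n) tvec set" where
  "tangent_bundle A = {tangent A c p v | c p v. c \<in> A \<and> p \<in> fst c}"

definition slit_tangent_bundle :: "('a, 'n::finite) chart set \<Rightarrow> ('a, 'n) tvec set" where
  "slit_tangent_bundle A = {tangent A c p v | c p v. c \<in> A \<and> p \<in> fst c \<and> v \<noteq> 0}"

text \<open>The differential of a smooth map \<open>h\<close> into a manifold with smooth structure \<open>B\<close>.\<close>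

definition differential ::
    "('b, 'k::finite) chart set \<Rightarrow> ('a \<Rightarrow> 'b) \<Rightarrow> ('a, 'n::finite) tvec \<Rightarrow> ('b, 'k) tvec" where
  "differential B h \<xi> =
     (h (fst \<xi>), {(d, w). d \<in> B \<and> h (fst \<xi>) \<in> fst d \<and>
        (\<exists>(c, v)\<in>snd \<xi>. w = dderiv v (snd d \<circ> h \<circ> chart_inv c) (snd c (fst \<xi>)))})"


section \<open>Finsler metrics\<close>

text \<open>The function \<open>G = F^2\<close> in the coordinates \<open>(x, y)\<close> induced by the chart \<open>c\<close> on the tangent
  bundle.\<close>

definition energy ::
    "('a, 'n::finite) chart set \<Rightarrow> (('a, 'n) tvec \<Rightarrow> real) \<Rightarrow> ('a, 'n) chart \<Rightarrow>
     (real ^ 'n) \<times> (real ^ 'n) \<Rightarrow> real" where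
  "energy A F c = (\<lambda>(x, y). (F (tangent A c (chart_inv c x) y))\<^sup>2)"

definition dx :: "'n::finite \<Rightarrow> ((real ^ 'n) \<times> (real ^ 'n) \<Rightarrow> real) \<Rightarrow>
    (real ^ 'n) \<times> (real ^ 'n) \<Rightarrow> real" where
  "dx \<alpha> = dderiv (axis \<alpha> 1, 0)"

definition dy :: "'n::finite \<Rightarrow> ((real ^ 'n) \<times> (real ^ 'n) \<Rightarrow> real) \<Rightarrow>
    (real ^ 'n) \<times> (real ^ 'n) \<Rightarrow> real" where
  "dy \<alpha> = dderiv (0, axis \<alpha> 1)"

definition hess :: "((real ^ 'n::finite) \<times> (real ^ 'n) \<Rightarrow> real) \<Rightarrow>
    (real ^ 'n) \<times> (real ^ 'n) \<Rightarrow> real ^ 'n ^ 'n" where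
  "hess G z = (\<chi> \<alpha> \<beta>. dy \<alpha> (dy \<beta> G) z)"

definition finsler_metric ::
    "('a, 'n::finite) chart set \<Rightarrow> (('a, 'n) tvec \<Rightarrow> real) \<Rightarrow> bool" where
  "finsler_metric A F \<longleftrightarrow>
     (\<forall>\<xi>\<in>tangent_bundle A. F \<xi> \<ge> 0) \<and>
     (\<forall>c\<in>A. smooth_on (energy A F c) ((snd c ` fst c) \<times> (UNIV - {0}))) \<and>
     (\<forall>\<xi>\<in>slit_tangent_bundle A. F \<xi> > 0) \<and>
     (\<forall>c\<in>A. \<forall>p\<in>fst c. \<forall>v. \<forall>l::real.
        F (tangent A c p (l *\<^sub>R v)) = \<bar>l\<bar> * F (tangent A c p v)) \<and>
     (\<forall>c\<in>A. \<forall>p\<in>fst c. \<forall>v. v \<noteq> 0 \<longrightarrow>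
        (\<forall>w. w \<noteq> 0 \<longrightarrow> w \<bullet> (hess (energy A F c) (snd c p, v) *v w) > 0))"

definition finsler_manifold ::
    "'a topology \<Rightarrow> ('a, 'n::finite) chart set \<Rightarrow> (('a, 'n) tvec \<Rightarrow> real) \<Rightarrow> bool" where
  "finsler_manifold X A F \<longleftrightarrow> smooth_manifold X A \<and> finsler_metric A F"


section \<open>Berwald and Landsberg curvature\<close>

definition spray :: "((real ^ 'n::finite) \<times> (real ^ 'n) \<Rightarrow> real) \<Rightarrow> 'n \<Rightarrow>
    (real ^ 'n) \<times> (real ^ 'n) \<Rightarrow> real" where
  "spray G \<alpha> z = (1/2) * (\<Sum>\<beta>\<in>UNIV. matrix_inv (hess G z) $ \<alpha> $ \<beta> *
     ((\<Sum>\<gamma>\<in>UNIV. dy \<beta> (dx \<gamma> G) z * snd z $ \<gamma>) - dx \<beta> G z))"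

definition berwald_curvature :: "((real ^ 'n::finite) \<times> (real ^ 'n) \<Rightarrow> real) \<Rightarrow>
    'n \<Rightarrow> 'n \<Rightarrow> 'n \<Rightarrow> 'n \<Rightarrow> (real ^ 'n) \<times> (real ^ 'n) \<Rightarrow> real" where
  "berwald_curvature G \<alpha> \<beta> \<gamma> \<eta> = dy \<beta> (dy \<gamma> (dy \<eta> (spray G \<alpha>)))"

definition landsberg_curvature :: "((real ^ 'n::finite) \<times> (real ^ 'n) \<Rightarrow> real) \<Rightarrow>
    'n \<Rightarrow> 'n \<Rightarrow> 'n \<Rightarrow> (real ^ 'n) \<times> (real ^ 'n) \<Rightarrow> real" where
  "landsberg_curvature G \<beta> \<gamma> \<eta> z =
     - (1/4) * (\<Sum>\<nu>\<in>UNIV. \<Sum>\<alpha>\<in>UNIV.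
        snd z $ \<nu> * hess G z $ \<nu> $ \<alpha> * berwald_curvature G \<alpha> \<beta> \<gamma> \<eta> z)"

text \<open>The Landsberg curvature vanishes at all vectors in \<open>S\<close>, in the coordinates induced by any
  chart of the smooth structure.\<close>

definition landsberg_on :: "('a, 'n::finite) chart set \<Rightarrow> ('a, 'n) tvec set \<Rightarrow>
    (('a, 'n) tvec \<Rightarrow> real) \<Rightarrow> bool" where
  "landsberg_on A S F \<longleftrightarrow>
     (\<forall>c\<in>A. \<forall>p\<in>fst c. \<forall>v. tangent A c p v \<in> S \<longrightarrow>
        (\<forall>\<beta> \<gamma> \<eta>. landsberg_curvature (energy A F c) \<beta> \<gamma> \<eta> (snd c p, v) = 0))"

definition landsberg_manifold ::
    "('a, 'n::finite) chart set \<Rightarrow> (('a, 'n) tvec \<Rightarrow> real) \<Rightarrow> bool" where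
  "landsberg_manifold A F \<longleftrightarrow> landsberg_on A (slit_tangent_bundle A) F"


section \<open>Minkowskian products\<close>

definition product_function :: "(real \<times> real \<Rightarrow> real) \<Rightarrow> bool" where
  "product_function f \<longleftrightarrow>
     continuous_on ({0..} \<times> {0..}) f \<and>
     (\<forall>s\<ge>0. \<forall>t\<ge>0. f (s, t) \<ge> 0) \<and>
     (\<forall>s\<ge>0. \<forall>t\<ge>0. f (s, t) = 0 \<longleftrightarrow> s = 0 \<and> t = 0) \<and>
     (\<forall>s\<ge>0. \<forall>t\<ge>0. \<forall>l\<ge>0. f (l * s, l * t) = l * f (s, t)) \<and>
     smooth_on f ({0<..} \<times> {0<..}) \<and>
     (\<forall>s>0. \<forall>t>0. dderiv (1, 0) f (s, t) \<noteq> 0 \<and> dderiv (0, 1) f (s, t) \<noteq> 0) \<and>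
     (\<forall>s>0. \<forall>t>0. dderiv (1, 0) f (s, t) * dderiv (0, 1) f (s, t)
        - 2 * f (s, t) * dderiv (1, 0) (dderiv (0, 1) f) (s, t) \<noteq> 0)"

definition product_chart :: "('a, 'm::finite) chart \<Rightarrow> ('b, 'n::finite) chart \<Rightarrow>
    ('a \<times> 'b, 'm + 'n) chart" where
  "product_chart c d = (fst c \<times> fst d,
     \<lambda>(p, q). (\<chi> k. case k of Inl i \<Rightarrow> snd c p $ i | Inr j \<Rightarrow> snd d q $ j))"

text \<open>The maximal atlas on the product space determined by the product charts.\<close>

definition product_structure ::
    "'a topology \<Rightarrow> ('a, 'm::finite) chart set \<Rightarrow> 'b topology \<Rightarrow> ('b, 'n::finite) chart set \<Rightarrow>
     ('a \<times> 'b, 'm + 'n) chart set" where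
  "product_structure X A Y B =
     {c \<in> charts (prod_topology X Y). \<forall>a\<in>A. \<forall>b\<in>B. compatible c (product_chart a b)}"

text \<open>The identification of the tangent bundle of the product with the direct sum of the tangent
  bundles of the factors sends \<open>\<xi>\<close> to its images under the differentials of the two projections.\<close>

definition minkowskian_product ::
    "('a, 'm::finite) chart set \<Rightarrow> (('a, 'm) tvec \<Rightarrow> real) \<Rightarrow>
     ('b, 'n::finite) chart set \<Rightarrow> (('b, 'n) tvec \<Rightarrow> real) \<Rightarrow>
     (real \<times> real \<Rightarrow> real) \<Rightarrow> ('a \<times> 'b, 'm + 'n) tvec \<Rightarrow> real" where
  "minkowskian_product A F\<^sub>1 B F\<^sub>2 f \<xi> =
     sqrt (f ((F\<^sub>1 (differential A fst \<xi>))\<^sup>2, (F\<^sub>2 (differential B snd \<xi>))\<^sup>2))"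

text \<open>As \<open>f\<close> is smooth only on the open quadrant, the geometric objects of the product metric are
  considered only at vectors both of whose components are nonzero.\<close>

definition product_regular_vectors ::
    "'a topology \<Rightarrow> ('a, 'm::finite) chart set \<Rightarrow> 'b topology \<Rightarrow> ('b, 'n::finite) chart set \<Rightarrow>
     ('a \<times> 'b, 'm + 'n) tvec set" where
  "product_regular_vectors X A Y B =
     {\<xi> \<in> tangent_bundle (product_structure X A Y B).
        differential A fst \<xi> \<in> slit_tangent_bundle A \<and>
        differential B snd \<xi> \<in> slit_tangent_bundle B}"

definition landsberg_product ::
    "'a topology \<Rightarrow> ('a, 'm::finite) chart set \<Rightarrow> (('a, 'm) tvec \<Rightarrow> real) \<Rightarrow>
     'b topology \<Rightarrow> ('b, 'n::finite) chart set \<Rightarrow> (('b, 'n) tvec \<Rightarrow> real) \<Rightarrow>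
     (real \<times> real \<Rightarrow> real) \<Rightarrow> bool" where
  "landsberg_product X A F\<^sub>1 Y B F\<^sub>2 f \<longleftrightarrow>
     landsberg_on (product_structure X A Y B) (product_regular_vectors X A Y B)
       (minkowskian_product A F\<^sub>1 B F\<^sub>2 f)"

end

theory Submission
  imports Defs
begin

text \<open>
  Write \<open>K\<close> and \<open>H\<close> for the squared metrics of the factors and \<open>G = f(K, H)\<close>. The idea is that the
  geodesic spray of \<open>G\<close> does not depend on \<open>f\<close>. For a Lagrangian \<open>G\<close> with spray coefficients \<open>g\<close>, the
  vector field \<open>S = (y, -2 g)\<close> on the tangent bundle is determined by \<open>S(G_w) = \<partial>G/\<partial>(w, 0)\<close> for all
  \<open>w\<close>, where \<open>G_w\<close> is the derivative of \<open>G\<close> in the vertical direction \<open>(0, w)\<close>; moreover \<open>S\<close>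
  annihilates \<open>G\<close> if \<open>G\<close> is 2-homogeneous. Let \<open>S\<close> be the vector field on the product that projects
  to the sprays of \<open>K\<close> and of \<open>H\<close>. Then \<open>S K = S H = 0\<close>, so the partial derivatives \<open>f\<^sub>1\<close>, \<open>f\<^sub>2\<close> of
  \<open>f\<close> at \<open>(K, H)\<close> are constant along \<open>S\<close>, and therefore
  \<open>S(G_w) = f\<^sub>1 S(K_w) + f\<^sub>2 S(H_w) = \<partial>G/\<partial>(w, 0)\<close>. So \<open>S\<close> is the spray of \<open>G\<close>, once the vertical
  Hessian of \<open>G\<close> is known to be nondegenerate. A vector in the kernel of that Hessian has components
  \<open>\<alpha> y\<^sub>1\<close> and \<open>\<delta> y\<^sub>2\<close>, and \<open>(\<alpha>, \<delta>)\<close> solves a homogeneous linear system of determinant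
  \<open>f\<^sub>1 f\<^sub>2 - 2 f f\<^sub>1\<^sub>2\<close>, which is nonzero for a product function.

  By Euler's identity \<open>y\<^sup>\<nu> G\<^sub>\<nu>\<^sub>\<alpha> = G\<^sub>\<alpha>\<close>, the Landsberg curvature at \<open>(x, y)\<close> is, up to the factor
  \<open>-1/4\<close>, the third derivative at \<open>y' = y\<close> of the function sending \<open>y'\<close> to the value of the fixed
  covector \<open>G\<^sub>\<alpha>(x, y)\<close> at \<open>g(x, y')\<close> (\<open>landsberg_curvature_eq\<close>). For the product this function is
  \<open>f\<^sub>1 \<phi>\<^sub>1 + f\<^sub>2 \<phi>\<^sub>2\<close>, where \<open>\<phi>\<^sub>1\<close> and \<open>\<phi>\<^sub>2\<close> are the corresponding functions of the factors, each
  depending on one component of \<open>y'\<close> only. As \<open>f\<^sub>1\<close> and \<open>f\<^sub>2\<close> are nonzero, its third derivatives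
  vanish if and only if those of \<open>\<phi>\<^sub>1\<close> and of \<open>\<phi>\<^sub>2\<close> do.

  The Landsberg condition on the product concerns every chart of the maximal atlas and not only the
  product charts. Both the change of coordinates and the product structure are covered by one
  computation: in any chart, \<open>G\<close> is \<open>f\<close> applied to the pullbacks of \<open>K\<close> and \<open>H\<close> along the tangent maps
  of two maps \<open>\<sigma>\<^sub>1\<close>, \<open>\<sigma>\<^sub>2\<close>, the coordinates of the two factors, whose differentials together form a
  bijection (locale \<open>minkowskian_pullback\<close>). The spray coefficients then acquire terms
  \<open>1/2 D\<^sup>2\<sigma>\<^sub>i(y, y)\<close>, which are quadratic in \<open>y\<close> and so do not contribute to third derivatives. The
  resulting equivalence at a single vector is \<open>landsberg_product_iff\<close>. One implication of the theorem
  uses it in all charts, the other only in product charts.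
\<close>

section \<open>Calculus of smooth functions\<close>

lemma dderiv_has_derivative:
  "g differentiable (at z) \<Longrightarrow> (g has_derivative (\<lambda>v. dderiv v g z)) (at z)"
  by (simp add: dderiv_def frechet_derivative_works)

lemma dderiv_eq: "(g has_derivative g') (at z) \<Longrightarrow> dderiv v g z = g' v"
  using frechet_derivative_at[of g g' z] by (simp add: dderiv_def)

lemma linear_dderiv: "g differentiable (at z) \<Longrightarrow> linear (\<lambda>v. dderiv v g z)"
  using dderiv_has_derivative has_derivative_linear by blast

lemma dderiv_add_dir:
  "g differentiable (at z) \<Longrightarrow> dderiv (u + v) g z = dderiv u g z + dderiv v g z"
  using linear_add[OF linear_dderiv] by fast

lemma dderiv_scaleR_dir:
  "g differentiable (at z) \<Longrightarrow> dderiv (c *\<^sub>R v) g z = c *\<^sub>R dderiv v g z"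
  using linear_cmul[OF linear_dderiv] by fast

lemma dderiv_zero_dir: "g differentiable (at z) \<Longrightarrow> dderiv 0 g z = 0"
  using linear_0[OF linear_dderiv] by fast

lemma dderiv_sum_dir:
  assumes "g differentiable (at z)"
  shows "dderiv (\<Sum>i\<in>I. c i *\<^sub>R v i) g z = (\<Sum>i\<in>I. c i *\<^sub>R dderiv (v i) g z)"
proof -
  have "dderiv (\<Sum>i\<in>I. c i *\<^sub>R v i) g z = (\<Sum>i\<in>I. dderiv (c i *\<^sub>R v i) g z)"
    using linear_sum[OF linear_dderiv[OF assms], of "\<lambda>i. c i *\<^sub>R v i" I] by simp
  then show ?thesis
    by (simp add: dderiv_scaleR_dir[OF assms])
qed

lemma dderiv_expand:
  fixes g :: "'a::euclidean_space \<Rightarrow> 'b::real_normed_vector"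
  assumes "g differentiable (at z)"
  shows "dderiv v g z = (\<Sum>b\<in>Basis. (v \<bullet> b) *\<^sub>R dderiv b g z)"
  using dderiv_sum_dir[OF assms, of "\<lambda>b. v \<bullet> b" "\<lambda>b. b" Basis]
  by (simp add: euclidean_representation)

lemma has_derivative_cong_open:
  assumes "open S" "z \<in> S" "\<And>x. x \<in> S \<Longrightarrow> f x = g x"
  shows "(f has_derivative D) (at z) \<longleftrightarrow> (g has_derivative D) (at z)"
  using has_derivative_transform_within_open[OF _ assms(1,2), of f D UNIV g]
    has_derivative_transform_within_open[OF _ assms(1,2), of g D UNIV f] assms(3)
  by auto

lemma differentiable_cong_open:
  assumes "open S" "z \<in> S" "\<And>x. x \<in> S \<Longrightarrow> f x = g x"
  shows "f differentiable (at z) \<longleftrightarrow> g differentiable (at z)"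
  using has_derivative_cong_open[where f = f and g = g, OF assms] by (simp add: differentiable_def)

lemma dderiv_cong_open:
  assumes "open S" "z \<in> S" "\<And>x. x \<in> S \<Longrightarrow> f x = g x"
  shows "dderiv v f z = dderiv v g z"
  using has_derivative_cong_open[where f = f and g = g, OF assms]
  by (simp add: dderiv_def frechet_derivative_def)

lemma dderiv_compose:
  assumes "g differentiable (at z)" "f differentiable (at (g z))"
  shows "dderiv v (\<lambda>x. f (g x)) z = dderiv (dderiv v g z) f (g z)"
proof -
  have "((\<lambda>x. f (g x)) has_derivative (\<lambda>v. dderiv (dderiv v g z) f (g z))) (at z)"
    using has_derivative_compose[OF dderiv_has_derivative[OF assms(1)] dderiv_has_derivative[OF assms(2)]] .
  from dderiv_eq[OF this] show ?thesis .
qed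

lemma differentiable_compose_at:
  assumes "g differentiable (at z)" "f differentiable (at (g z))"
  shows "(\<lambda>x. f (g x)) differentiable (at z)"
  using has_derivative_compose[OF dderiv_has_derivative[OF assms(1)] dderiv_has_derivative[OF assms(2)]]
  by (auto simp: differentiable_def)

lemma dderiv_bounded_linear:
  assumes "bounded_linear L" shows "dderiv v L z = L v"
  using dderiv_eq[OF bounded_linear_imp_has_derivative[OF assms]] .

lemma dderiv_linear_comp:
  assumes "bounded_linear L" "g differentiable (at z)"
  shows "dderiv v (\<lambda>x. L (g x)) z = L (dderiv v g z)"
  using dderiv_eq[OF bounded_linear.has_derivative[OF assms(1) dderiv_has_derivative[OF assms(2)]]] .

lemma dderiv_const [simp]: "dderiv v (\<lambda>x. c) z = 0"
  by (rule dderiv_eq) (rule has_derivative_const)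

lemma dderiv_add:
  assumes "f differentiable (at z)" "g differentiable (at z)"
  shows "dderiv v (\<lambda>x. f x + g x) z = dderiv v f z + dderiv v g z"
  using dderiv_eq[OF has_derivative_add[OF dderiv_has_derivative[OF assms(1)] dderiv_has_derivative[OF assms(2)]]] .

lemma dderiv_bilinear:
  assumes "bounded_bilinear p" "f differentiable (at z)" "g differentiable (at z)"
  shows "dderiv v (\<lambda>x. p (f x) (g x)) z = p (f z) (dderiv v g z) + p (dderiv v f z) (g z)"
  using dderiv_eq[OF bounded_bilinear.FDERIV[OF assms(1) dderiv_has_derivative[OF assms(2)] dderiv_has_derivative[OF assms(3)]]] .

lemma dderiv_Pair:
  assumes "f differentiable (at z)" "g differentiable (at z)"
  shows "dderiv v (\<lambda>x. (f x, g x)) z = (dderiv v f z, dderiv v g z)"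
  using dderiv_eq[OF has_derivative_Pair[OF dderiv_has_derivative[OF assms(1)] dderiv_has_derivative[OF assms(2)]]] .

lemma Ck_on_cong:
  assumes "open S" "\<And>x. x \<in> S \<Longrightarrow> f x = g x"
  shows "Ck_on k f S \<longleftrightarrow> Ck_on k g S"
  using assms(2)
proof (induction k arbitrary: f g)
  case 0
  then show ?case by (simp cong: continuous_on_cong)
next
  case (Suc k)
  have "Ck_on k (dderiv v f) S \<longleftrightarrow> Ck_on k (dderiv v g) S" for v
    by (rule Suc.IH) (rule dderiv_cong_open[OF assms(1)], use Suc.prems in auto)
  moreover have "f differentiable (at z) \<longleftrightarrow> g differentiable (at z)" if "z \<in> S" for z
    by (rule differentiable_cong_open[OF assms(1) that Suc.prems])
  ultimately show ?case by auto
qed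

lemma Ck_on_subset: "Ck_on k g S \<Longrightarrow> T \<subseteq> S \<Longrightarrow> Ck_on k g T"
  by (induction k arbitrary: g) (auto intro: continuous_on_subset)

lemma Ck_on_Suc_imp: "Ck_on (Suc k) g S \<Longrightarrow> Ck_on k g S"
proof (induction k arbitrary: g)
  case 0
  then show ?case
    by (auto intro!: continuous_at_imp_continuous_on differentiable_imp_continuous_within)
next
  case (Suc k)
  have "Ck_on k (dderiv v g) S" for v
    by (rule Suc.IH) (use Suc.prems in simp)
  moreover have "\<forall>z\<in>S. g differentiable (at z)" using Suc.prems by simp
  ultimately show ?case by simp
qed

lemma Ck_on_SucI:
  assumes "\<And>z. z \<in> S \<Longrightarrow> g differentiable (at z)" "\<And>v. Ck_on k (dderiv v g) S"
  shows "Ck_on (Suc k) g S"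
  using assms by simp

lemma Ck_on_const: "Ck_on k (\<lambda>x. c) S"
proof (induction k arbitrary: c)
  case (Suc k)
  have "dderiv v (\<lambda>x::'a. c) = (\<lambda>x. 0)" for v by auto
  with Suc show ?case by simp
qed simp

lemma Ck_on_linear:
  fixes L :: "'a::euclidean_space \<Rightarrow> 'b::euclidean_space"
  assumes "bounded_linear L" shows "Ck_on k L S"
proof (cases k)
  case 0
  then show ?thesis using assms by (simp add: linear_continuous_on)
next
  case (Suc k')
  have "dderiv v L = (\<lambda>x. L v)" for v
    using dderiv_bounded_linear[OF assms] by auto
  then show ?thesis
    using Suc assms bounded_linear_imp_differentiable Ck_on_const by auto
qed

lemma Ck_on_linear_comp:
  fixes L :: "'b::euclidean_space \<Rightarrow> 'c::euclidean_space"
  assumes "bounded_linear L" "open S" "Ck_on k g S"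
  shows "Ck_on k (\<lambda>x. L (g x)) S"
  using assms(3)
proof (induction k arbitrary: g)
  case 0
  then show ?case using bounded_linear.continuous_on[OF assms(1)] by simp
next
  case (Suc k)
  have d: "g differentiable (at z)" if "z \<in> S" for z using Suc.prems that by simp
  show ?case
  proof (rule Ck_on_SucI)
    fix z assume "z \<in> S"
    then show "(\<lambda>x. L (g x)) differentiable (at z)"
      using d bounded_linear_imp_differentiable[OF assms(1)] differentiable_compose_at by blast
  next
    fix v
    have "Ck_on k (\<lambda>x. L (dderiv v g x)) S" by (rule Suc.IH) (use Suc.prems in simp)
    then show "Ck_on k (dderiv v (\<lambda>x. L (g x))) S"
      by (rule Ck_on_cong[OF assms(2), THEN iffD2, rotated]) (rule dderiv_linear_comp[OF assms(1) d])
  qed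
qed

lemma Ck_on_add:
  assumes "open S" "Ck_on k f S" "Ck_on k g S"
  shows "Ck_on k (\<lambda>x. f x + g x) S"
  using assms(2,3)
proof (induction k arbitrary: f g)
  case 0
  then show ?case by (simp add: continuous_on_add)
next
  case (Suc k)
  show ?case
  proof (rule Ck_on_SucI)
    fix z assume "z \<in> S"
    then show "(\<lambda>x. f x + g x) differentiable (at z)"
      using Suc.prems by simp
  next
    fix v
    have "Ck_on k (\<lambda>x. dderiv v f x + dderiv v g x) S" using Suc by simp
    then show "Ck_on k (dderiv v (\<lambda>x. f x + g x)) S"
      by (rule Ck_on_cong[OF assms(1), THEN iffD2, rotated]) (use Suc.prems in \<open>simp add: dderiv_add\<close>)
  qed
qed

lemma Ck_on_bilinear:
  fixes p :: "'b::euclidean_space \<Rightarrow> 'c::euclidean_space \<Rightarrow> 'd::euclidean_space"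
  assumes "bounded_bilinear p" "open S" "Ck_on k f S" "Ck_on k g S"
  shows "Ck_on k (\<lambda>x. p (f x) (g x)) S"
  using assms(3,4)
proof (induction k arbitrary: f g)
  case 0
  then show ?case using bounded_bilinear.continuous_on[OF assms(1)] by simp
next
  case (Suc k)
  show ?case
  proof (rule Ck_on_SucI)
    fix z assume "z \<in> S"
    then have "f differentiable (at z)" "g differentiable (at z)" using Suc.prems by auto
    then show "(\<lambda>x. p (f x) (g x)) differentiable (at z)"
      using bounded_bilinear.FDERIV[OF assms(1)] unfolding differentiable_def by blast
  next
    fix v
    have "Ck_on k f S" "Ck_on k g S" using Suc.prems Ck_on_Suc_imp by blast+
    moreover have "Ck_on k (dderiv v f) S" "Ck_on k (dderiv v g) S" using Suc.prems by simp_all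
    ultimately have "Ck_on k (\<lambda>x. p (f x) (dderiv v g x) + p (dderiv v f x) (g x)) S"
      by (intro Ck_on_add[OF assms(2)] Suc.IH)
    then show "Ck_on k (dderiv v (\<lambda>x. p (f x) (g x))) S"
      by (rule Ck_on_cong[OF assms(2), THEN iffD2, rotated])
         (use Suc.prems in \<open>simp add: dderiv_bilinear[OF assms(1)]\<close>)
  qed
qed

lemma Ck_on_sum:
  assumes "open S" "finite I" "\<And>i. i \<in> I \<Longrightarrow> Ck_on k (f i) S"
  shows "Ck_on k (\<lambda>x. \<Sum>i\<in>I. f i x) S"
  using assms(2,3)
  by (induction I rule: finite_induct) (auto intro: Ck_on_add[OF assms(1)] simp: Ck_on_const)

text \<open>By the chain rule, a directional derivative of the composite is a sum of products of components of
  the derivative of \<open>g\<close> with partial derivatives of \<open>f\<close> evaluated along \<open>g\<close>, which are again composites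
  with the same \<open>g\<close>; hence the induction has to vary \<open>f\<close>.\<close>

lemma Ck_on_compose:
  fixes g :: "'a::euclidean_space \<Rightarrow> 'b::euclidean_space" and f :: "'b \<Rightarrow> 'c::euclidean_space"
  assumes "open S" "g ` S \<subseteq> T" "Ck_on k g S" "Ck_on k f T"
  shows "Ck_on k (\<lambda>x. f (g x)) S"
  using assms(3,4)
proof (induction k arbitrary: f)
  case 0
  then show ?case using continuous_on_compose2[OF _ _ assms(2)] by simp
next
  case (Suc k)
  have gk: "Ck_on k g S" using Suc.prems Ck_on_Suc_imp by blast
  have dg: "g differentiable (at z)" and df: "f differentiable (at (g z))" if "z \<in> S" for z
    using Suc.prems that assms(2) by auto
  show ?case
  proof (rule Ck_on_SucI)
    fix z assume "z \<in> S"
    then show "(\<lambda>x. f (g x)) differentiable (at z)"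
      using dg df differentiable_compose_at by blast
  next
    fix v
    have f': "Ck_on k (\<lambda>x. dderiv b f (g x)) S" for b
      by (rule Suc.IH[OF gk]) (use Suc.prems(2) in simp)
    have g': "Ck_on k (dderiv v g) S" using Suc.prems(1) by simp
    have "Ck_on k (\<lambda>x. \<Sum>b\<in>Basis. (dderiv v g x \<bullet> b) *\<^sub>R dderiv b f (g x)) S"
      by (intro Ck_on_sum Ck_on_bilinear[OF bounded_bilinear_scaleR] assms(1) finite_Basis
          Ck_on_linear_comp[OF bounded_linear_inner_left] f' g')
    then show "Ck_on k (dderiv v (\<lambda>x. f (g x))) S"
    proof (rule Ck_on_cong[OF assms(1), THEN iffD2, rotated])
      fix x assume "x \<in> S"
      then show "dderiv v (\<lambda>x. f (g x)) x = (\<Sum>b\<in>Basis. (dderiv v g x \<bullet> b) *\<^sub>R dderiv b f (g x))"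
        using dderiv_compose[OF dg df, of x v] dderiv_expand[OF df, of x "dderiv v g x"] by simp
    qed
  qed
qed

lemma Ck_on_inverse:
  fixes f :: "'a::euclidean_space \<Rightarrow> real"
  assumes "open S" "Ck_on k f S" "\<And>x. x \<in> S \<Longrightarrow> f x \<noteq> 0"
  shows "Ck_on k (\<lambda>x. inverse (f x)) S"
  using assms(2)
proof (induction k)
  case 0
  then show ?case using assms(3) by (simp add: continuous_on_inverse)
next
  case (Suc k)
  have k: "Ck_on k (\<lambda>x. inverse (f x)) S" by (rule Suc.IH[OF Ck_on_Suc_imp[OF Suc.prems]])
  have D: "((\<lambda>x. inverse (f x)) has_derivative
        (\<lambda>v. - (inverse (f z) * dderiv v f z * inverse (f z)))) (at z)" if "z \<in> S" for z
    using Suc.prems assms(3) that by (intro Deriv.has_derivative_inverse dderiv_has_derivative) auto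
  show ?case
  proof (rule Ck_on_SucI)
    fix z assume "z \<in> S"
    then show "(\<lambda>x. inverse (f x)) differentiable (at z)"
      using D differentiable_def by blast
  next
    fix v
    have "Ck_on k (\<lambda>z. - (inverse (f z) * dderiv v f z * inverse (f z))) S"
      using Suc k
      by (intro Ck_on_linear_comp[OF bounded_linear_minus[OF bounded_linear_ident]]
           Ck_on_bilinear[OF bounded_bilinear_mult] assms(1)) simp_all
    then show "Ck_on k (dderiv v (\<lambda>x. inverse (f x))) S"
      by (rule Ck_on_cong[OF assms(1), THEN iffD2, rotated]) (use dderiv_eq[OF D] in simp)
  qed
qed

lemma smooth_on_cong:
  "open S \<Longrightarrow> (\<And>x. x \<in> S \<Longrightarrow> f x = g x) \<Longrightarrow> smooth_on f S \<longleftrightarrow> smooth_on g S"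
  unfolding smooth_on_def using Ck_on_cong by blast

lemma smooth_on_subset: "smooth_on g S \<Longrightarrow> T \<subseteq> S \<Longrightarrow> smooth_on g T"
  unfolding smooth_on_def using Ck_on_subset by blast

lemma smooth_on_dderiv: "smooth_on g S \<Longrightarrow> smooth_on (dderiv v g) S"
  unfolding smooth_on_def by (metis Ck_on.simps(2))

lemma smooth_on_imp_differentiable: "smooth_on g S \<Longrightarrow> z \<in> S \<Longrightarrow> g differentiable (at z)"
  unfolding smooth_on_def by (metis Ck_on.simps(2))

lemma smooth_on_imp_continuous: "smooth_on g S \<Longrightarrow> continuous_on S g"
  unfolding smooth_on_def by (metis Ck_on.simps(1))

lemma smooth_on_const: "smooth_on (\<lambda>x. c) S"
  unfolding smooth_on_def by (simp add: Ck_on_const)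

lemma smooth_on_linear:
  fixes L :: "'a::euclidean_space \<Rightarrow> 'b::euclidean_space"
  shows "bounded_linear L \<Longrightarrow> smooth_on L S"
  unfolding smooth_on_def by (simp add: Ck_on_linear)

lemma smooth_on_linear_comp:
  fixes L :: "'b::euclidean_space \<Rightarrow> 'c::euclidean_space"
  shows "bounded_linear L \<Longrightarrow> open S \<Longrightarrow> smooth_on g S \<Longrightarrow> smooth_on (\<lambda>x. L (g x)) S"
  unfolding smooth_on_def by (simp add: Ck_on_linear_comp)

lemma smooth_on_add:
  "open S \<Longrightarrow> smooth_on f S \<Longrightarrow> smooth_on g S \<Longrightarrow> smooth_on (\<lambda>x. f x + g x) S"
  unfolding smooth_on_def by (simp add: Ck_on_add)

lemma smooth_on_bilinear:
  fixes p :: "'b::euclidean_space \<Rightarrow> 'c::euclidean_space \<Rightarrow> 'd::euclidean_space"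
  shows "bounded_bilinear p \<Longrightarrow> open S \<Longrightarrow> smooth_on f S \<Longrightarrow> smooth_on g S \<Longrightarrow>
    smooth_on (\<lambda>x. p (f x) (g x)) S"
  unfolding smooth_on_def by (simp add: Ck_on_bilinear)

lemma smooth_on_scaleR:
  "open S \<Longrightarrow> smooth_on c S \<Longrightarrow> smooth_on f S \<Longrightarrow> smooth_on (\<lambda>x. c x *\<^sub>R f x) S"
  using smooth_on_bilinear[OF bounded_bilinear_scaleR] .

lemma smooth_on_mult:
  fixes f g :: "'a::euclidean_space \<Rightarrow> real"
  shows "open S \<Longrightarrow> smooth_on f S \<Longrightarrow> smooth_on g S \<Longrightarrow> smooth_on (\<lambda>x. f x * g x) S"
  using smooth_on_bilinear[OF bounded_bilinear_mult] .

lemma smooth_on_sum: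
  "open S \<Longrightarrow> finite I \<Longrightarrow> (\<And>i. i \<in> I \<Longrightarrow> smooth_on (f i) S) \<Longrightarrow>
    smooth_on (\<lambda>x. \<Sum>i\<in>I. f i x) S"
  unfolding smooth_on_def by (simp add: Ck_on_sum)

lemma smooth_on_prod:
  fixes f :: "'i \<Rightarrow> 'a::euclidean_space \<Rightarrow> real"
  assumes "open S" "finite I" "\<And>i. i \<in> I \<Longrightarrow> smooth_on (f i) S"
  shows "smooth_on (\<lambda>x. \<Prod>i\<in>I. f i x) S"
  using assms(2,3)
  by (induction I rule: finite_induct) (auto intro: smooth_on_mult[OF assms(1)] simp: smooth_on_const)

lemma smooth_on_divide:
  fixes f g :: "'a::euclidean_space \<Rightarrow> real"
  assumes "open S" "smooth_on f S" "smooth_on g S" "\<And>x. x \<in> S \<Longrightarrow> g x \<noteq> 0"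
  shows "smooth_on (\<lambda>x. f x / g x) S"
  unfolding divide_inverse
  by (rule smooth_on_mult) (use assms in \<open>auto simp: smooth_on_def Ck_on_inverse\<close>)

lemma smooth_on_diff:
  fixes f g :: "'a::euclidean_space \<Rightarrow> 'b::euclidean_space"
  assumes "open S" "smooth_on f S" "smooth_on g S"
  shows "smooth_on (\<lambda>x. f x - g x) S"
  using smooth_on_add[OF assms(1,2) smooth_on_linear_comp[OF bounded_linear_minus[OF bounded_linear_ident] assms(1,3)]]
  by simp

lemma smooth_on_compose:
  fixes g :: "'a::euclidean_space \<Rightarrow> 'b::euclidean_space" and f :: "'b \<Rightarrow> 'c::euclidean_space"
  shows "open S \<Longrightarrow> g ` S \<subseteq> T \<Longrightarrow> smooth_on g S \<Longrightarrow> smooth_on f T \<Longrightarrow> smooth_on (\<lambda>x. f (g x)) S"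
  unfolding smooth_on_def using Ck_on_compose by blast

lemma smooth_on_Pair:
  fixes f :: "'a::euclidean_space \<Rightarrow> 'b::euclidean_space" and g :: "'a \<Rightarrow> 'c::euclidean_space"
  assumes "open S" "smooth_on f S" "smooth_on g S"
  shows "smooth_on (\<lambda>x. (f x, g x)) S"
proof -
  have "bounded_linear (\<lambda>a::'b. (a, 0::'c))" "bounded_linear (\<lambda>a::'c. (0::'b, a))"
    by (simp_all add: bounded_linear_Pair bounded_linear_ident bounded_linear_zero)
  then have "smooth_on (\<lambda>x. (f x, 0) + (0, g x)) S"
    by (intro smooth_on_add smooth_on_linear_comp[where L = "\<lambda>a::'b. (a, 0::'c)"]
        smooth_on_linear_comp[where L = "\<lambda>a::'c. (0::'b, a)"] assms)
  then show ?thesis by simp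
qed

lemma smooth_on_det:
  fixes M :: "'a::euclidean_space \<Rightarrow> real ^ 'n ^ 'n"
  assumes "open S" "\<And>i j. smooth_on (\<lambda>z. M z $ i $ j) S"
  shows "smooth_on (\<lambda>z. det (M z)) S"
  unfolding det_def
  by (intro smooth_on_sum smooth_on_mult smooth_on_prod smooth_on_const assms finite_permutations finite_class.finite_UNIV)

lemma smooth_on_vec:
  fixes g :: "'a::euclidean_space \<Rightarrow> real ^ 'n"
  assumes "open S" "\<And>i. smooth_on (\<lambda>z. g z $ i) S"
  shows "smooth_on g S"
proof -
  have "smooth_on (\<lambda>z. \<Sum>i\<in>UNIV. g z $ i *\<^sub>R (axis i 1 :: real ^ 'n)) S"
    by (intro smooth_on_sum smooth_on_scaleR smooth_on_const assms) simp
  moreover have "(\<lambda>z. \<Sum>i\<in>UNIV. g z $ i *\<^sub>R axis i 1) = g"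
    by (simp add: fun_eq_iff vec_eq_iff axis_def if_distrib if_distribR cong: if_cong)
  ultimately show ?thesis by simp
qed

section \<open>Symmetry of second derivatives and moving directions\<close>

lemma dderiv_along_curve:
  assumes "g differentiable (at (a + t *\<^sub>R u))"
  shows "((\<lambda>t. g (a + t *\<^sub>R u)) has_real_derivative dderiv u g (a + t *\<^sub>R u)) (at t)"
proof -
  have "((\<lambda>t. g (a + t *\<^sub>R u)) has_derivative (\<lambda>s. dderiv (s *\<^sub>R u) g (a + t *\<^sub>R u))) (at t)"
    by (rule has_derivative_compose[where f = "\<lambda>t. a + t *\<^sub>R u" and g = g, OF _ dderiv_has_derivative[OF assms]])
       (auto intro!: derivative_eq_intros)
  then show ?thesis
    using dderiv_scaleR_dir[OF assms] by (simp add: has_field_derivative_def mult.commute[of _ "dderiv u g _"])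
qed

text \<open>The mean value theorem applied twice: along \<open>u\<close> to the difference of \<open>g\<close> and its translate by
  \<open>h v\<close>, and then along \<open>v\<close> to the derivative so obtained.\<close>

lemma second_difference:
  fixes g :: "'a::euclidean_space \<Rightarrow> real"
  assumes d1: "\<And>s t. 0 \<le> s \<Longrightarrow> s \<le> h \<Longrightarrow> 0 \<le> t \<Longrightarrow> t \<le> h \<Longrightarrow> g differentiable (at (z + s *\<^sub>R u + t *\<^sub>R v))"
    and d2: "\<And>s t. 0 \<le> s \<Longrightarrow> s \<le> h \<Longrightarrow> 0 \<le> t \<Longrightarrow> t \<le> h \<Longrightarrow> dderiv u g differentiable (at (z + s *\<^sub>R u + t *\<^sub>R v))"
    and "h > 0"
  obtains s t where "0 \<le> s" "s \<le> h" "0 \<le> t" "t \<le> h"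
    "g (z + h *\<^sub>R u + h *\<^sub>R v) - g (z + h *\<^sub>R u) - g (z + h *\<^sub>R v) + g z
       = h * (h * dderiv v (dderiv u g) (z + s *\<^sub>R u + t *\<^sub>R v))"
proof -
  let ?\<phi> = "\<lambda>s. g ((z + h *\<^sub>R v) + s *\<^sub>R u) - g (z + s *\<^sub>R u)"
  have "(?\<phi> has_real_derivative (dderiv u g ((z + h *\<^sub>R v) + s *\<^sub>R u) - dderiv u g (z + s *\<^sub>R u))) (at s)"
    if "0 \<le> s" "s \<le> h" for s
    using d1[OF that, of h] d1[OF that, of 0] \<open>h > 0\<close>
    by (intro DERIV_diff dderiv_along_curve) (simp_all add: algebra_simps)
  from MVT2[OF \<open>h > 0\<close> this] obtain s where s: "0 < s" "s < h" and
    1: "?\<phi> h - ?\<phi> 0 = h * (dderiv u g ((z + h *\<^sub>R v) + s *\<^sub>R u) - dderiv u g (z + s *\<^sub>R u))"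
    by force
  have "((\<lambda>t. dderiv u g ((z + s *\<^sub>R u) + t *\<^sub>R v)) has_real_derivative
      dderiv v (dderiv u g) ((z + s *\<^sub>R u) + t *\<^sub>R v)) (at t)" if "0 \<le> t" "t \<le> h" for t
    using d2[of s t] s that by (intro dderiv_along_curve) simp
  from MVT2[OF \<open>h > 0\<close> this] obtain t where t: "0 < t" "t < h" and
    2: "dderiv u g ((z + s *\<^sub>R u) + h *\<^sub>R v) - dderiv u g ((z + s *\<^sub>R u) + 0 *\<^sub>R v)
       = h * dderiv v (dderiv u g) ((z + s *\<^sub>R u) + t *\<^sub>R v)"
    by force
  show thesis
    by (rule that[of s t]) (use s t 1 2 in \<open>simp_all add: algebra_simps\<close>)
qed

text \<open>Schwarz's theorem. The second difference is symmetric in \<open>u\<close> and \<open>v\<close>, so \<open>second_difference\<close>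
  makes the two mixed derivatives agree at points arbitrarily close to \<open>z\<close>, and they are continuous.\<close>

lemma dderiv_commute_real:
  fixes g :: "'a::euclidean_space \<Rightarrow> real"
  assumes "open S" "smooth_on g S" "z \<in> S"
  shows "dderiv u (dderiv v g) z = dderiv v (dderiv u g) z"
proof (rule ccontr)
  assume ne: "dderiv u (dderiv v g) z \<noteq> dderiv v (dderiv u g) z"
  define e where "e = \<bar>dderiv u (dderiv v g) z - dderiv v (dderiv u g) z\<bar> / 2"
  have e: "e > 0" using ne by (simp add: e_def)
  have c: "continuous_on S (dderiv u (dderiv v g))" "continuous_on S (dderiv v (dderiv u g))"
    using assms(2) smooth_on_dderiv smooth_on_imp_continuous by blast+
  have near: "\<forall>\<^sub>F x in at z within S. dist (h x) (h z) < e"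
    if "continuous_on S h" for h :: "'a \<Rightarrow> real"
    using that e \<open>z \<in> S\<close> by (simp add: continuous_on_def tendsto_iff)
  have "\<forall>\<^sub>F x in at z. dist (dderiv u (dderiv v g) x) (dderiv u (dderiv v g) z) < e \<and>
      dist (dderiv v (dderiv u g) x) (dderiv v (dderiv u g) z) < e \<and> x \<in> S"
    using near[OF c(1)] near[OF c(2)] eventually_at_in_open'[OF assms(1,3)]
    unfolding at_within_open[OF assms(3,1)] by (intro eventually_conj)
  then obtain r where r: "r > 0" and R0: "\<forall>x\<in>UNIV. x \<noteq> z \<and> dist x z < r \<longrightarrow>
      dist (dderiv u (dderiv v g) x) (dderiv u (dderiv v g) z) < e \<and>
      dist (dderiv v (dderiv u g) x) (dderiv v (dderiv u g) z) < e \<and> x \<in> S"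
    unfolding eventually_at by blast
  have R: "dist (dderiv u (dderiv v g) x) (dderiv u (dderiv v g) z) < e \<and>
      dist (dderiv v (dderiv u g) x) (dderiv v (dderiv u g) z) < e \<and> x \<in> S"
    if "dist x z < r" for x
    using bspec[OF R0 UNIV_I, of x] that e assms(3) by (cases "x = z") auto
  \<comment> \<open>With this \<open>h\<close>, the parallelogram at \<open>z\<close> spanned by \<open>h u\<close> and \<open>h v\<close> stays within distance \<open>r\<close> of \<open>z\<close>.\<close>
  define h where "h = r / (2 * (norm u + norm v + 1))"
  have pos: "norm u + norm v + 1 > 0" by (simp add: add_nonneg_pos)
  have h: "h > 0" using r pos by (simp add: h_def)
  have hr: "h * (norm u + norm v) < r"
  proof -
    have "h * (norm u + norm v) \<le> h * (norm u + norm v + 1)" using h by simp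
    also have "\<dots> = r / 2" using pos by (simp add: h_def field_simps)
    finally show ?thesis using r by simp
  qed
  have box: "dist (z + s *\<^sub>R u + t *\<^sub>R v) z < r" if "0 \<le> s" "s \<le> h" "0 \<le> t" "t \<le> h" for s t
  proof -
    have "dist (z + s *\<^sub>R u + t *\<^sub>R v) z = norm (s *\<^sub>R u + t *\<^sub>R v)" by (simp add: dist_norm)
    also have "\<dots> \<le> s * norm u + t * norm v"
      using norm_triangle_ineq[of "s *\<^sub>R u" "t *\<^sub>R v"] that by simp
    also have "\<dots> \<le> h * norm u + h * norm v"
      using that by (intro add_mono mult_right_mono) auto
    finally show ?thesis using hr by (simp add: algebra_simps)
  qed
  have dg: "g differentiable (at x)" "dderiv w g differentiable (at x)" if "dist x z < r" for x w
    using R[OF that] assms(2) smooth_on_imp_differentiable smooth_on_dderiv by blast+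
  obtain s t where st: "0 \<le> s" "s \<le> h" "0 \<le> t" "t \<le> h"
    "g (z + h *\<^sub>R u + h *\<^sub>R v) - g (z + h *\<^sub>R u) - g (z + h *\<^sub>R v) + g z
       = h * (h * dderiv v (dderiv u g) (z + s *\<^sub>R u + t *\<^sub>R v))"
    by (rule second_difference[where g = g and z = z and u = u and v = v and h = h])
       (use dg box h in simp_all)
  have box': "dist (z + t *\<^sub>R v + s *\<^sub>R u) z < r" if "0 \<le> s" "s \<le> h" "0 \<le> t" "t \<le> h" for s t
    using box[OF that] by (simp add: algebra_simps)
  obtain t' s' where st': "0 \<le> s'" "s' \<le> h" "0 \<le> t'" "t' \<le> h"
    "g (z + h *\<^sub>R v + h *\<^sub>R u) - g (z + h *\<^sub>R v) - g (z + h *\<^sub>R u) + g z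
       = h * (h * dderiv u (dderiv v g) (z + t' *\<^sub>R v + s' *\<^sub>R u))"
    by (rule second_difference[where g = g and z = z and u = v and v = u and h = h])
       (use dg box' h in simp_all)
  have "h * (h * dderiv v (dderiv u g) (z + s *\<^sub>R u + t *\<^sub>R v))
      = h * (h * dderiv u (dderiv v g) (z + t' *\<^sub>R v + s' *\<^sub>R u))"
    using st(5) st'(5) by (simp add: algebra_simps)
  then have "dderiv v (dderiv u g) (z + s *\<^sub>R u + t *\<^sub>R v) = dderiv u (dderiv v g) (z + t' *\<^sub>R v + s' *\<^sub>R u)"
    using h by simp
  moreover have "\<bar>dderiv v (dderiv u g) (z + s *\<^sub>R u + t *\<^sub>R v) - dderiv v (dderiv u g) z\<bar> < e"
    using R[OF box[OF st(1-4)]] by (simp add: dist_real_def)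
  moreover have "\<bar>dderiv u (dderiv v g) (z + t' *\<^sub>R v + s' *\<^sub>R u) - dderiv u (dderiv v g) z\<bar> < e"
    using R[OF box'[OF st'(1-4)]] by (simp add: dist_real_def)
  ultimately have "\<bar>dderiv u (dderiv v g) z - dderiv v (dderiv u g) z\<bar> < 2 * e" by linarith
  then show False by (simp add: e_def)
qed

lemma dderiv_commute:
  fixes g :: "'a::euclidean_space \<Rightarrow> 'b::euclidean_space"
  assumes "open S" "smooth_on g S" "z \<in> S"
  shows "dderiv u (dderiv v g) z = dderiv v (dderiv u g) z"
proof (rule euclidean_eqI)
  fix b :: 'b
  have d: "g differentiable (at x)" "dderiv v g differentiable (at x)" if "x \<in> S" for x v
    using that assms(2) smooth_on_imp_differentiable smooth_on_dderiv by blast+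
  have *: "dderiv u (dderiv v g) z \<bullet> b = dderiv u (dderiv v (\<lambda>x. g x \<bullet> b)) z" for u v
  proof -
    have "dderiv u (dderiv v g) z \<bullet> b = dderiv u (\<lambda>x. dderiv v g x \<bullet> b) z"
      by (rule dderiv_linear_comp[OF bounded_linear_inner_left d(2)[OF assms(3)], symmetric])
    also have "\<dots> = dderiv u (dderiv v (\<lambda>x. g x \<bullet> b)) z"
      by (rule dderiv_cong_open[OF assms(1,3)])
         (rule dderiv_linear_comp[OF bounded_linear_inner_left d(1), symmetric])
    finally show ?thesis .
  qed
  show "dderiv u (dderiv v g) z \<bullet> b = dderiv v (dderiv u g) z \<bullet> b"
    unfolding * by (rule dderiv_commute_real[OF assms(1) _ assms(3)])
      (intro smooth_on_linear_comp[OF bounded_linear_inner_left] assms)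
qed

text \<open>The product rule for a directional derivative of \<open>K\<close> whose direction \<open>v\<close> and base point \<open>T\<close> both vary.
  It produces all second derivatives of composite functions below, and Euler's identities for second
  derivatives, where the direction is the position vector.\<close>

lemma dderiv_moving_differentiable:
  fixes K :: "'b::euclidean_space \<Rightarrow> 'c::euclidean_space"
  assumes "open S" "smooth_on K S" "open U" "T ` U \<subseteq> S" "z \<in> U" "\<And>x. x \<in> U \<Longrightarrow> T differentiable (at x)"
    and "v differentiable (at z)"
  shows "((\<lambda>x. dderiv (v x) K (T x)) has_derivative
     (\<lambda>s. dderiv (dderiv s v z) K (T z) + dderiv (dderiv s T z) (dderiv (v z) K) (T z))) (at z)"
proof -
  have Tz: "T z \<in> S" using assms by auto
  have dT: "T differentiable (at z)" using assms by auto
  have dK: "K differentiable (at y)" "dderiv b K differentiable (at y)" if "y \<in> S" for b y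
    using that assms(2) smooth_on_imp_differentiable smooth_on_dderiv by blast+
  have exp: "dderiv b K y = (\<Sum>i\<in>Basis. (b \<bullet> i) *\<^sub>R dderiv i K y)" if "y \<in> S" for y b
    using dderiv_expand[OF dK(1)[OF that]] .
  have "((\<lambda>x. \<Sum>i\<in>Basis. (v x \<bullet> i) *\<^sub>R dderiv i K (T x)) has_derivative
     (\<lambda>s. \<Sum>i\<in>Basis. (v z \<bullet> i) *\<^sub>R dderiv (dderiv s T z) (dderiv i K) (T z) +
         (dderiv s v z \<bullet> i) *\<^sub>R dderiv i K (T z))) (at z)"
    by (intro has_derivative_sum has_derivative_scaleR bounded_linear.has_derivative[OF bounded_linear_inner_left]
          has_derivative_compose[OF dderiv_has_derivative[OF dT]] dderiv_has_derivative assms dK Tz)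
  moreover have "dderiv s (dderiv (v z) K) (T z) = (\<Sum>i\<in>Basis. (v z \<bullet> i) *\<^sub>R dderiv s (dderiv i K) (T z))" for s
  proof -
    have "dderiv s (dderiv (v z) K) (T z) = dderiv s (\<lambda>y. \<Sum>i\<in>Basis. (v z \<bullet> i) *\<^sub>R dderiv i K y) (T z)"
      by (rule dderiv_cong_open[OF assms(1) Tz]) (rule exp)
    also have "\<dots> = (\<Sum>i\<in>Basis. (v z \<bullet> i) *\<^sub>R dderiv s (dderiv i K) (T z))"
      by (rule dderiv_eq) (intro has_derivative_sum bounded_linear.has_derivative[OF bounded_linear_scaleR_right]
          dderiv_has_derivative dK Tz)
    finally show ?thesis .
  qed
  ultimately have "((\<lambda>x. \<Sum>i\<in>Basis. (v x \<bullet> i) *\<^sub>R dderiv i K (T x)) has_derivative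
     (\<lambda>s. dderiv (dderiv s v z) K (T z) + dderiv (dderiv s T z) (dderiv (v z) K) (T z))) (at z)"
    unfolding exp[OF Tz, of "dderiv _ v z"] by (simp add: sum.distrib add.commute)
  then show ?thesis
    by (rule has_derivative_transform_within_open[OF _ assms(3,5)]) (rule exp[symmetric], use assms(4) in blast)
qed

lemma dderiv_moving:
  fixes K :: "'b::euclidean_space \<Rightarrow> 'c::euclidean_space"
  assumes "open S" "smooth_on K S" "open U" "T ` U \<subseteq> S" "z \<in> U" "\<And>x. x \<in> U \<Longrightarrow> T differentiable (at x)"
    and "v differentiable (at z)"
  shows "dderiv s (\<lambda>x. dderiv (v x) K (T x)) z =
     dderiv (dderiv s v z) K (T z) + dderiv (dderiv s T z) (dderiv (v z) K) (T z)"
  using dderiv_eq[OF dderiv_moving_differentiable[OF assms]] .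

section \<open>Third directional derivatives\<close>

definition dderiv3 :: "'a::real_normed_vector \<Rightarrow> 'a \<Rightarrow> 'a \<Rightarrow> ('a \<Rightarrow> 'b::real_normed_vector) \<Rightarrow> 'a \<Rightarrow> 'b"
  where "dderiv3 u v w g z = dderiv u (dderiv v (dderiv w g)) z"

lemma dderiv3_cong_open:
  assumes "open S" "z \<in> S" "\<And>x. x \<in> S \<Longrightarrow> f x = g x"
  shows "dderiv3 u v w f z = dderiv3 u v w g z"
  unfolding dderiv3_def
  by (intro dderiv_cong_open[OF assms(1)] assms)

text \<open>Together with linearity in the first direction this yields linearity in all three directions.\<close>

lemma dderiv3_rotate:
  fixes g :: "'a::euclidean_space \<Rightarrow> 'b::euclidean_space"
  assumes "open S" "smooth_on g S" "z \<in> S"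
  shows "dderiv3 u v w g z = dderiv3 v w u g z"
proof -
  have "dderiv3 u v w g z = dderiv v (dderiv u (dderiv w g)) z"
    unfolding dderiv3_def by (rule dderiv_commute[OF assms(1) smooth_on_dderiv[OF assms(2)] assms(3)])
  also have "\<dots> = dderiv v (dderiv w (dderiv u g)) z"
    by (rule dderiv_cong_open[OF assms(1,3)]) (rule dderiv_commute[OF assms(1,2)])
  finally show ?thesis unfolding dderiv3_def .
qed

lemma dderiv3_sum_dir:
  fixes g :: "'a::euclidean_space \<Rightarrow> 'b::euclidean_space"
  assumes "open S" "smooth_on g S" "z \<in> S"
  shows "dderiv3 (\<Sum>i\<in>I. c i *\<^sub>R d i) v w g z = (\<Sum>i\<in>I. c i *\<^sub>R dderiv3 (d i) v w g z)"
  unfolding dderiv3_def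
  by (rule dderiv_sum_dir) (use assms smooth_on_dderiv smooth_on_imp_differentiable in blast)

lemma dderiv3_zero_dir:
  fixes g :: "'a::euclidean_space \<Rightarrow> 'b::euclidean_space"
  assumes "open S" "smooth_on g S" "z \<in> S"
  shows "dderiv3 0 v w g z = 0"
  using dderiv3_sum_dir[OF assms, of "\<lambda>_. 0" "\<lambda>_. 0" "{}::nat set" v w] by simp

lemma vec_expand: "w = (\<Sum>\<beta>\<in>UNIV. w $ \<beta> *\<^sub>R axis \<beta> (1::real))"
  by (simp add: vec_eq_iff axis_def if_distrib if_distribR cong: if_cong)

lemma dderiv3_eq_0_if_axes:
  fixes g :: "real ^ 'n \<Rightarrow> 'b::euclidean_space"
  assumes S: "open S" "smooth_on g S" "z \<in> S"
    and 0: "\<And>\<beta> \<gamma> \<eta>. dderiv3 (axis \<beta> 1) (axis \<gamma> 1) (axis \<eta> 1) g z = 0"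
  shows "dderiv3 u v w g z = 0"
proof -
  have lin: "dderiv3 a b c g z = 0" if "\<And>\<beta>. dderiv3 (axis \<beta> 1) b c g z = 0" for a b c
    by (subst vec_expand[of a]) (simp only: dderiv3_sum_dir[OF S] that scaleR_zero_right sum.neutral_const)
  have 1: "dderiv3 a (axis \<gamma> 1) (axis \<eta> 1) g z = 0" for a \<gamma> \<eta>
    by (rule lin) (rule 0)
  have 2: "dderiv3 a (axis \<eta> 1) b g z = 0" for a b \<eta>
    by (rule lin) (use 1 dderiv3_rotate[OF S] in metis)
  show ?thesis
    by (rule lin) (use 2 dderiv3_rotate[OF S] in metis)
qed

lemma dderiv3_add:
  assumes S: "open S" "smooth_on f S" "smooth_on g S" "z \<in> S"
  shows "dderiv3 u v w (\<lambda>x. f x + g x) z = dderiv3 u v w f z + dderiv3 u v w g z"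
proof -
  have *: "dderiv w (\<lambda>x. f x + g x) x = dderiv w f x + dderiv w g x"
    if "x \<in> S" "smooth_on f S" "smooth_on g S" for w x f g
    by (rule dderiv_add) (use that smooth_on_imp_differentiable in blast)+
  have "dderiv3 u v w (\<lambda>x. f x + g x) z = dderiv u (dderiv v (\<lambda>x. dderiv w f x + dderiv w g x)) z"
    unfolding dderiv3_def by (intro dderiv_cong_open[OF S(1)] S(4) * S)
  also have "\<dots> = dderiv u (\<lambda>x. dderiv v (dderiv w f) x + dderiv v (dderiv w g) x) z"
    by (intro dderiv_cong_open[OF S(1)] S * smooth_on_dderiv)
  also have "\<dots> = dderiv3 u v w f z + dderiv3 u v w g z"
    unfolding dderiv3_def by (intro S * smooth_on_dderiv)
  finally show ?thesis .
qed

lemma dderiv3_cmult: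
  fixes f :: "'a::euclidean_space \<Rightarrow> real"
  assumes S: "open S" "smooth_on f S" "z \<in> S"
  shows "dderiv3 u v w (\<lambda>x. c * f x) z = c * dderiv3 u v w f z"
proof -
  have *: "dderiv w (\<lambda>x. c * f x) x = c * dderiv w f x"
    if "x \<in> S" "smooth_on f S" for w x and f :: "'a \<Rightarrow> real"
    by (rule dderiv_linear_comp[OF bounded_linear_mult_right])
       (use that smooth_on_imp_differentiable in blast)
  have "dderiv3 u v w (\<lambda>x. c * f x) z = dderiv u (dderiv v (\<lambda>x. c * dderiv w f x)) z"
    unfolding dderiv3_def by (intro dderiv_cong_open[OF S(1)] S(3) * S)
  also have "\<dots> = dderiv u (\<lambda>x. c * dderiv v (dderiv w f) x) z"
    by (intro dderiv_cong_open[OF S(1)] S * smooth_on_dderiv)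
  also have "\<dots> = c * dderiv3 u v w f z"
    unfolding dderiv3_def by (intro S * smooth_on_dderiv)
  finally show ?thesis .
qed

lemma dderiv3_lincomb:
  fixes f :: "'i \<Rightarrow> 'a::euclidean_space \<Rightarrow> real"
  assumes S: "open S" "z \<in> S" and f: "\<And>i. i \<in> I \<Longrightarrow> smooth_on (f i) S" and "finite I"
  shows "dderiv3 u v w (\<lambda>x. \<Sum>i\<in>I. c i * f i x) z = (\<Sum>i\<in>I. c i * dderiv3 u v w (f i) z)"
  using \<open>finite I\<close> f
proof (induction I rule: finite_induct)
  case empty
  have "dderiv w (\<lambda>x. 0::real) = (\<lambda>x. 0)" for w :: 'a by auto
  then show ?case by (simp add: dderiv3_def)
next
  case (insert i I)
  have "dderiv3 u v w (\<lambda>x. c i * f i x + (\<Sum>i\<in>I. c i * f i x)) z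
      = dderiv3 u v w (\<lambda>x. c i * f i x) z + dderiv3 u v w (\<lambda>x. \<Sum>i\<in>I. c i * f i x) z"
    using insert by (intro dderiv3_add[OF S(1) _ _ S(2)] smooth_on_sum smooth_on_mult smooth_on_const S) auto
  then show ?case
    using insert dderiv3_cmult[OF S(1) _ S(2), of "f i"] by simp
qed

lemma dderiv3_compose_linear:
  fixes g :: "'b::euclidean_space \<Rightarrow> 'c::euclidean_space" and A :: "'a::euclidean_space \<Rightarrow> 'b"
  assumes A: "linear A" and S: "open S" "smooth_on g S" and T: "open T" "A ` T \<subseteq> S" "z \<in> T"
  shows "dderiv3 u v w (\<lambda>x. g (A x)) z = dderiv3 (A u) (A v) (A w) g (A z)"
proof -
  have bA: "bounded_linear A" using A by (simp add: linear_conv_bounded_linear)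
  have *: "dderiv w (\<lambda>x. g (A x)) x = dderiv (A w) g (A x)" if "x \<in> T" "smooth_on g S" for x w g
    using dderiv_compose[of A x g w] that T(2) smooth_on_imp_differentiable[OF that(2), of "A x"]
      bounded_linear_imp_differentiable[OF bA] dderiv_bounded_linear[OF bA]
    by auto
  have "dderiv3 u v w (\<lambda>x. g (A x)) z = dderiv u (dderiv v (\<lambda>x. dderiv (A w) g (A x))) z"
    unfolding dderiv3_def by (intro dderiv_cong_open[OF T(1)] T * S)
  also have "\<dots> = dderiv u (\<lambda>x. dderiv (A v) (dderiv (A w) g) (A x)) z"
    by (intro dderiv_cong_open[OF T(1)] T * smooth_on_dderiv S)
  also have "\<dots> = dderiv3 (A u) (A v) (A w) g (A z)"
    unfolding dderiv3_def by (intro T * smooth_on_dderiv S)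
  finally show ?thesis .
qed

lemma dderiv3_quadratic:
  assumes p: "bounded_bilinear p"
  shows "dderiv3 u v w (\<lambda>x. p x x) z = 0"
proof -
  have "dderiv w (\<lambda>x. p x x) = (\<lambda>x. p x w + p w x)"
    using dderiv_bilinear[OF p differentiable_ident differentiable_ident]
    by (simp add: fun_eq_iff dderiv_bounded_linear[OF bounded_linear_ident])
  moreover have "dderiv v (\<lambda>x. p x w + p w x) = (\<lambda>x. p v w + p w v)"
    by (rule ext, rule dderiv_bounded_linear)
       (intro bounded_linear_add bounded_bilinear.bounded_linear_left[OF p]
         bounded_bilinear.bounded_linear_right[OF p])
  ultimately show ?thesis by (simp add: dderiv3_def)
qed

lemma dderiv_slice:
  assumes "g differentiable (at (x, y))"
  shows "dderiv (0, w) g (x, y) = dderiv w (\<lambda>y'. g (x, y')) y"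
proof -
  have "((\<lambda>y'. (x, y')) has_derivative (\<lambda>w. (0, w))) (at y)"
    by (auto intro!: derivative_eq_intros)
  from has_derivative_compose[OF this dderiv_has_derivative[OF assms]]
  show ?thesis using dderiv_eq by metis
qed

lemma open_slice: "open W \<Longrightarrow> open {y. (x, y) \<in> W}"
  using open_vimage[of W "\<lambda>y. (x, y)"] by (simp add: vimage_def continuous_intros)

text \<open>Derivatives in fibre directions can be computed with the base point frozen; after this reduction a
  change of coordinates acts on the fibre variable as a constant linear map.\<close>

lemma dderiv3_slice:
  fixes g :: "'a::euclidean_space \<times> 'b::euclidean_space \<Rightarrow> 'c::euclidean_space"
  assumes W: "open W" "smooth_on g W" "(x, y) \<in> W"
  shows "dderiv3 (0, u) (0, v) (0, w) g (x, y) = dderiv3 u v w (\<lambda>y'. g (x, y')) y"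
proof -
  let ?S = "{y. (x, y) \<in> W}"
  have S: "open ?S" "y \<in> ?S" using W open_slice by auto
  have *: "dderiv (0, w) g (x, y) = dderiv w (\<lambda>y'. g (x, y')) y"
    if "y \<in> ?S" "smooth_on g W" for w y g
    by (rule dderiv_slice) (use that smooth_on_imp_differentiable in blast)
  have "dderiv3 u v w (\<lambda>y'. g (x, y')) y = dderiv u (dderiv v (\<lambda>y. dderiv (0, w) g (x, y))) y"
    unfolding dderiv3_def by (intro dderiv_cong_open[OF S(1)] S *[symmetric] W)
  also have "\<dots> = dderiv u (\<lambda>y. dderiv (0, v) (dderiv (0, w) g) (x, y)) y"
    by (intro dderiv_cong_open[OF S(1)] S *[symmetric] smooth_on_dderiv W)
  also have "\<dots> = dderiv3 (0, u) (0, v) (0, w) g (x, y)"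
    unfolding dderiv3_def by (intro S *[symmetric] smooth_on_dderiv W)
  finally show ?thesis ..
qed

section \<open>The spray of a regular Lagrangian\<close>

lemma vertical_expand: "(0, w) = (\<Sum>\<beta>\<in>UNIV. w $ \<beta> *\<^sub>R (0, axis \<beta> (1::real)))"
  by (subst vec_expand[of w]) (simp add: sum_prod scaleR_prod_def flip: scaleR_Pair)

lemma horizontal_expand: "(w, 0) = (\<Sum>\<beta>\<in>UNIV. w $ \<beta> *\<^sub>R (axis \<beta> (1::real), 0))"
  by (subst vec_expand[of w]) (simp add: sum_prod)

lemma dderiv_vertical_expand:
  assumes "g differentiable (at z)"
  shows "dderiv (0, w) g z = (\<Sum>\<beta>\<in>UNIV. w $ \<beta> * dy \<beta> g z)"
  using dderiv_sum_dir[OF assms, of "\<lambda>\<beta>. w $ \<beta>" "\<lambda>\<beta>. (0, axis \<beta> 1)" UNIV]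
  unfolding vertical_expand[symmetric] by (simp add: dy_def)

lemma dderiv_horizontal_expand:
  assumes "g differentiable (at z)"
  shows "dderiv (w, 0) g z = (\<Sum>\<beta>\<in>UNIV. w $ \<beta> * dx \<beta> g z)"
  using dderiv_sum_dir[OF assms, of "\<lambda>\<beta>. w $ \<beta>" "\<lambda>\<beta>. (axis \<beta> 1, 0)" UNIV]
  unfolding horizontal_expand[symmetric] by (simp add: dx_def)

definition spray_vec :: "((real ^ 'n::finite) \<times> (real ^ 'n) \<Rightarrow> real) \<Rightarrow>
    (real ^ 'n) \<times> (real ^ 'n) \<Rightarrow> real ^ 'n"
  where "spray_vec G z = (\<chi> \<alpha>. spray G \<alpha> z)"

text \<open>
  The coordinate formula for the vertical Hessian is kept apart from nondegeneracy because, for a Finsler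
  metric, nondegeneracy is deduced with its help from positive definiteness.\<close>

locale smooth_lagrangian =
  fixes G :: "(real ^ 'n::finite) \<times> (real ^ 'n) \<Rightarrow> real" and W :: "((real ^ 'n) \<times> (real ^ 'n)) set"
  assumes open_W: "open W"
    and smooth: "smooth_on G W"
begin

lemma differentiable: "z \<in> W \<Longrightarrow> G differentiable (at z)"
  using smooth smooth_on_imp_differentiable by blast

lemma differentiable2: "z \<in> W \<Longrightarrow> dderiv v G differentiable (at z)"
  using smooth smooth_on_imp_differentiable smooth_on_dderiv by blast

lemma commute: "z \<in> W \<Longrightarrow> dderiv u (dderiv v G) z = dderiv v (dderiv u G) z"
  by (rule dderiv_commute[OF open_W smooth])

lemma vertical_linear:
  assumes "z \<in> W"
  shows "linear (\<lambda>w. dderiv (0, w) G z)"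
proof -
  have "linear (\<lambda>w::real ^ 'n. (0 :: real ^ 'n, w))" by (auto intro!: linearI)
  from linear_compose[OF this linear_dderiv[OF differentiable[OF assms]]] show ?thesis by (simp add: o_def)
qed

lemma vertical_hess_linear:
  assumes "z \<in> W"
  shows "linear (\<lambda>w. dderiv (0, u) (dderiv (0, w) G) z)"
proof -
  have "linear (\<lambda>w::real ^ 'n. (0 :: real ^ 'n, w))" by (auto intro!: linearI)
  from linear_compose[OF this linear_dderiv[OF differentiable2[OF assms]]]
  show ?thesis by (simp add: o_def commute[OF assms, of "(0, u)"])
qed

lemma hess_mult:
  assumes "z \<in> W"
  shows "(hess G z *v w) $ \<alpha> = dderiv (0, axis \<alpha> 1) (dderiv (0, w) G) z"
proof -
  have "(hess G z *v w) $ \<alpha> = (\<Sum>\<beta>\<in>UNIV. w $ \<beta> * dy \<beta> (dy \<alpha> G) z)"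
    using commute[OF assms] by (simp add: matrix_vector_mult_def hess_def dy_def mult.commute)
  also have "\<dots> = dderiv (0, w) (dy \<alpha> G) z"
    by (rule dderiv_vertical_expand[symmetric]) (simp add: dy_def differentiable2 assms)
  finally show ?thesis using commute[OF assms] by (simp add: dy_def)
qed

end

text \<open>The local form of a squared Finsler metric, in the generality that a Minkowskian product requires: its
  domain is only a cone in the fibres, as both components of the vector have to be nonzero, and its
  vertical Hessian need not be definite.\<close>

locale regular_lagrangian = smooth_lagrangian +
  assumes conic: "(x, y) \<in> W \<Longrightarrow> l > 0 \<Longrightarrow> (x, l *\<^sub>R y) \<in> W"
    and homogeneous: "(x, y) \<in> W \<Longrightarrow> l > 0 \<Longrightarrow> G (x, l *\<^sub>R y) = l\<^sup>2 * G (x, y)"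
    and nondegenerate: "z \<in> W \<Longrightarrow> (\<And>u. dderiv (0, u) (dderiv (0, w) G) z = 0) \<Longrightarrow> w = 0"
begin

lemma invertible_hess:
  assumes "z \<in> W" shows "invertible (hess G z)"
proof -
  have "w = 0" if "hess G z *v w = 0" for w
  proof (rule nondegenerate[OF assms])
    fix u
    have "dy \<alpha> (dderiv (0, w) G) z = 0" for \<alpha>
      using hess_mult[OF assms, of w \<alpha>] that by (simp add: dy_def)
    then show "dderiv (0, u) (dderiv (0, w) G) z = 0"
      using dderiv_vertical_expand[OF differentiable2[OF assms], of u "(0, w)"] by simp
  qed
  then show ?thesis
    unfolding invertible_left_inverse matrix_left_invertible_ker by blast
qed

lemma spray_rhs:
  assumes "z \<in> W"
  shows "(\<Sum>\<gamma>\<in>UNIV. dy \<beta> (dx \<gamma> G) z * snd z $ \<gamma>) = dderiv (0, axis \<beta> 1) (dderiv (snd z, 0) G) z"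
proof -
  have "(\<Sum>\<gamma>\<in>UNIV. dy \<beta> (dx \<gamma> G) z * snd z $ \<gamma>) = (\<Sum>\<gamma>\<in>UNIV. snd z $ \<gamma> * dx \<gamma> (dy \<beta> G) z)"
    using commute[OF assms] by (simp add: dy_def dx_def mult.commute)
  also have "\<dots> = dderiv (snd z, 0) (dy \<beta> G) z"
    by (rule dderiv_horizontal_expand[symmetric]) (simp add: dy_def differentiable2 assms)
  finally show ?thesis using commute[OF assms] by (simp add: dy_def)
qed

lemma hess_spray_vec:
  assumes "z \<in> W"
  shows "hess G z *v (2 *\<^sub>R spray_vec G z) =
    (\<chi> \<beta>. dderiv (0, axis \<beta> 1) (dderiv (snd z, 0) G) z - dx \<beta> G z)" (is "_ = ?r")
proof -
  have "2 *\<^sub>R spray_vec G z = matrix_inv (hess G z) *v ?r"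
    by (simp add: vec_eq_iff spray_vec_def spray_def spray_rhs[OF assms] matrix_vector_mult_def)
  moreover have "hess G z ** matrix_inv (hess G z) = mat 1"
    using someI_ex[OF invertible_hess[OF assms, unfolded invertible_def]]
    unfolding matrix_inv_def by blast
  ultimately show ?thesis by (simp add: matrix_vector_mul_assoc)
qed

text \<open>The defining linear system of the spray as a statement about the vector field \<open>S = (y, -2 g)\<close>: the
  derivative of \<open>G\<^sub>w\<close> along \<open>S\<close> is \<open>\<partial>G/\<partial>(w, 0)\<close>. No coordinates and no inverse matrix occur in this form,
  so it can be pulled back along maps.\<close>

lemma spray_equation:
  assumes "z \<in> W"
  shows "dderiv (snd z, - 2 *\<^sub>R spray_vec G z) (dderiv (0, w) G) z = dderiv (w, 0) G z"
proof -
  have "dy \<beta> (dderiv (0, 2 *\<^sub>R spray_vec G z) G) z = dy \<beta> (dderiv (snd z, 0) G) z - dx \<beta> G z" for \<beta>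
    using hess_mult[OF assms, of "2 *\<^sub>R spray_vec G z" \<beta>] hess_spray_vec[OF assms] by (simp add: dy_def)
  then have "dderiv (0, w) (dderiv (0, 2 *\<^sub>R spray_vec G z) G) z =
      dderiv (0, w) (dderiv (snd z, 0) G) z - dderiv (w, 0) G z"
    by (simp add: dderiv_vertical_expand[OF differentiable2[OF assms]]
        dderiv_horizontal_expand[OF differentiable[OF assms]] right_diff_distrib sum_subtractf)
  moreover have "(snd z, - 2 *\<^sub>R spray_vec G z) = (snd z, 0) + (- 1) *\<^sub>R (0, 2 *\<^sub>R spray_vec G z)"
    by simp
  ultimately show ?thesis
    using dderiv_add_dir[OF differentiable2[OF assms], of "(snd z, 0)" "(- 1) *\<^sub>R (0, 2 *\<^sub>R spray_vec G z)" "(0, w)"]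
      dderiv_scaleR_dir[OF differentiable2[OF assms], of "- 1" "(0, 2 *\<^sub>R spray_vec G z)" "(0, w)"]
      commute[OF assms, of "(0, w)"]
    by simp
qed

lemma spray_unique:
  assumes "z \<in> W" and g: "\<And>w. dderiv (snd z, - 2 *\<^sub>R g) (dderiv (0, w) G) z = dderiv (w, 0) G z"
  shows "spray_vec G z = g"
proof -
  let ?d = "2 *\<^sub>R (spray_vec G z - g)"
  have "dderiv (0, u) (dderiv (0, ?d) G) z = 0" for u
  proof -
    have "(snd z, - 2 *\<^sub>R g) = (snd z, - 2 *\<^sub>R spray_vec G z) + (0, ?d)" by (simp add: algebra_simps)
    then have "dderiv (0, ?d) (dderiv (0, u) G) z = 0"
      using dderiv_add_dir[OF differentiable2[OF assms(1)], of "(snd z, - 2 *\<^sub>R spray_vec G z)" "(0, ?d)" "(0, u)"]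
        g[of u] spray_equation[OF assms(1), of u]
      by simp
    then show ?thesis using commute[OF assms(1)] by metis
  qed
  from nondegenerate[OF assms(1) this] show ?thesis by simp
qed

text \<open>Cramer's rule writes the spray coefficients as quotients of determinants whose entries are
  derivatives of \<open>G\<close>.\<close>

lemma smooth_spray_vec: "smooth_on (spray_vec G) W"
proof (rule smooth_on_vec[OF open_W])
  fix k
  let ?r = "\<lambda>z. \<chi> \<beta>. (\<Sum>\<gamma>\<in>UNIV. dy \<beta> (dx \<gamma> G) z * snd z $ \<gamma>) - dx \<beta> G z"
  let ?M = "\<lambda>z. (\<chi> i j. if j = k then ?r z $ i else hess G z $ i $ j)"
  have h: "smooth_on (\<lambda>z. hess G z $ i $ j) W" for i j
    by (simp add: hess_def dy_def smooth_on_dderiv smooth)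
  have "bounded_linear (\<lambda>z::(real ^ 'n) \<times> (real ^ 'n). snd z $ \<gamma>)" for \<gamma>
    by (rule bounded_linear_compose[OF bounded_linear_vec_nth bounded_linear_snd])
  then have r: "smooth_on (\<lambda>z. ?r z $ i) W" for i
    by (simp add: dy_def dx_def)
       (intro smooth_on_diff smooth_on_sum smooth_on_mult open_W smooth_on_dderiv smooth finite_class.finite_UNIV
         smooth_on_linear)
  have "smooth_on (\<lambda>z. ?M z $ i $ j) W" for i j
    by (cases "j = k") (use h r in simp_all)
  then have "smooth_on (\<lambda>z. det (?M z) / det (hess G z)) W"
    by (intro smooth_on_divide smooth_on_det open_W h)
       (use invertible_hess invertible_det_nz in blast)+
  then have "smooth_on (\<lambda>z. (1/2) * (det (?M z) / det (hess G z))) W"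
    by (intro smooth_on_mult smooth_on_const open_W)
  then show "smooth_on (\<lambda>z. spray_vec G z $ k) W"
  proof (rule smooth_on_cong[OF open_W, THEN iffD2, rotated])
    fix z assume z: "z \<in> W"
    have "hess G z *v (2 *\<^sub>R spray_vec G z) = ?r z"
      using hess_spray_vec[OF z] by (simp add: spray_rhs[OF z])
    then have "2 *\<^sub>R spray_vec G z = (\<chi> k. det (\<chi> i j. if j = k then ?r z $ i else hess G z $ i $ j) / det (hess G z))"
      using cramer invertible_det_nz invertible_hess[OF z] by blast
    then have "(2 *\<^sub>R spray_vec G z) $ k = det (?M z) / det (hess G z)" by simp
    then show "spray_vec G z $ k = (1/2) * (det (?M z) / det (hess G z))" by simp
  qed
qed

lemma euler:
  assumes "(x, y) \<in> W" shows "dderiv (0, y) G (x, y) = 2 * G (x, y)"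
proof -
  have "((\<lambda>t. G ((x, y) + t *\<^sub>R (0, y))) has_real_derivative dderiv (0, y) G ((x, y) + 0 *\<^sub>R (0, y))) (at 0)"
    by (rule dderiv_along_curve) (use differentiable[OF assms] in simp)
  moreover have "((\<lambda>t. (1 + t)\<^sup>2 * G (x, y)) has_real_derivative 2 * G (x, y)) (at 0)"
    by (auto intro!: derivative_eq_intros)
  moreover have "G ((x, y) + t *\<^sub>R (0, y)) = (1 + t)\<^sup>2 * G (x, y)" if "t \<in> {-1<..<1}" for t
    using homogeneous[OF assms, of "1 + t"] that by (simp add: algebra_simps)
  ultimately have "((\<lambda>t. G ((x, y) + t *\<^sub>R (0, y))) has_real_derivative 2 * G (x, y)) (at 0)"
    using has_field_derivative_transform_within_open[of "\<lambda>t. (1 + t)\<^sup>2 * G (x, y)" "2 * G (x, y)" 0 "{-1<..<1}"]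
    by fastforce
  then show ?thesis
    using DERIV_unique \<open>(_ has_real_derivative dderiv _ _ _) _\<close> by fastforce
qed

text \<open>The derivative of Euler's identity in an arbitrary direction. Vertical directions give
  \<open>y\<^sup>\<nu> G\<^sub>\<nu>\<^sub>\<alpha> = G\<^sub>\<alpha>\<close>, and the direction of the spray gives the conservation of energy.\<close>

lemma euler_derivative:
  assumes "z \<in> W"
  shows "dderiv s (dderiv (0, snd z) G) z + dderiv (0, snd s) G z = 2 * dderiv s G z"
proof -
  have sn: "bounded_linear (\<lambda>x::(real ^ 'n) \<times> (real ^ 'n). (0::real ^ 'n, snd x))"
    by (intro bounded_linear_Pair bounded_linear_zero bounded_linear_snd)
  have "dderiv s (\<lambda>x. dderiv (0, snd x) G x) z =
      dderiv (dderiv s (\<lambda>x. (0, snd x)) z) G z + dderiv (dderiv s (\<lambda>x. x) z) (dderiv (0, snd z) G) z"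
    by (rule dderiv_moving[where T = "\<lambda>x. x", OF open_W smooth open_W])
       (use assms bounded_linear_imp_differentiable[OF sn] in auto)
  moreover have "dderiv s (\<lambda>x. dderiv (0, snd x) G x) z = dderiv s (\<lambda>x. 2 * G x) z"
    by (rule dderiv_cong_open[OF open_W assms]) (use euler in force)
  moreover have "dderiv s (\<lambda>x. 2 * G x) z = 2 * dderiv s G z"
    by (rule dderiv_linear_comp[OF bounded_linear_mult_right differentiable[OF assms]])
  ultimately show ?thesis
    by (simp add: dderiv_bounded_linear[OF sn] dderiv_bounded_linear[OF bounded_linear_ident])
qed

lemma vertical_hess_position:
  assumes "z \<in> W"
  shows "dderiv (0, b) (dderiv (0, snd z) G) z = dderiv (0, b) G z"
  using euler_derivative[OF assms, of "(0, b)"] by simp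

text \<open>For \<open>w = y\<close> the spray equation says \<open>S(G\<^sub>y) = \<partial>G/\<partial>(y, 0)\<close>; inserted into the derivative of Euler's
  identity along \<open>S\<close>, it leaves \<open>S G = 2 S G\<close>.\<close>

lemma spray_preserves_energy:
  assumes "z \<in> W"
  shows "dderiv (snd z, - 2 *\<^sub>R spray_vec G z) G z = 0"
proof -
  let ?s = "(snd z, - 2 *\<^sub>R spray_vec G z)"
  have "dderiv ?s G z = dderiv (snd z, 0) G z + dderiv (0, snd ?s) G z"
    using dderiv_add_dir[OF differentiable[OF assms], of "(snd z, 0)" "(0, snd ?s)"] by simp
  then show ?thesis
    using euler_derivative[OF assms, of ?s] spray_equation[OF assms, of "snd z"] by simp
qed

lemma smooth_spray_slice:
  assumes "(x, y) \<in> W"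
  shows "smooth_on (\<lambda>y'. dderiv (0, spray_vec G (x, y')) G (x, y)) {y'. (x, y') \<in> W}"
proof -
  have S: "open {y'. (x, y') \<in> W}" by (rule open_slice[OF open_W])
  have "smooth_on (\<lambda>y'. (x, y')) {y'. (x, y') \<in> W}"
    by (intro smooth_on_Pair S smooth_on_const smooth_on_linear bounded_linear_ident)
  then have 1: "smooth_on (\<lambda>y'. spray_vec G (x, y')) {y'. (x, y') \<in> W}"
    by (rule smooth_on_compose[where g = "Pair x" and T = W, OF S, rotated]) (auto simp: smooth_spray_vec)
  have "bounded_linear (\<lambda>w. dderiv (0, w) G (x, y))"
    using vertical_linear[OF assms] by (simp add: linear_conv_bounded_linear)
  from smooth_on_linear_comp[OF this S 1] show ?thesis .
qed

text \<open>Lowering the index of the Berwald curvature with \<open>y\<^sup>\<nu> G\<^sub>\<nu>\<^sub>\<alpha> = G\<^sub>\<alpha>\<close> leaves a covector that is not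
  differentiated, so it may be moved inside the three derivatives as a constant.\<close>

lemma landsberg_curvature_eq:
  assumes "(x, y) \<in> W"
  shows "landsberg_curvature G \<beta> \<gamma> \<eta> (x, y) = - (1/4) *
    dderiv3 (axis \<beta> 1) (axis \<gamma> 1) (axis \<eta> 1) (\<lambda>y'. dderiv (0, spray_vec G (x, y')) G (x, y)) y"
proof -
  let ?z = "(x, y)" and ?S = "{y'. (x, y') \<in> W}"
  let ?D = "dderiv3 (axis \<beta> 1) (axis \<gamma> 1) (axis \<eta> 1)"
  have S: "open ?S" "y \<in> ?S" using open_slice[OF open_W] assms by auto
  have lower: "(\<Sum>\<nu>\<in>UNIV. y $ \<nu> * hess G ?z $ \<nu> $ \<alpha>) = dy \<alpha> G ?z" for \<alpha>
  proof -
    have "(\<Sum>\<nu>\<in>UNIV. y $ \<nu> * hess G ?z $ \<nu> $ \<alpha>) = (\<Sum>\<nu>\<in>UNIV. y $ \<nu> * dy \<nu> (dy \<alpha> G) ?z)"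
      by (simp add: hess_def)
    also have "\<dots> = dderiv (0, y) (dy \<alpha> G) ?z"
      by (rule dderiv_vertical_expand[symmetric]) (simp add: dy_def differentiable2 assms)
    also have "\<dots> = dy \<alpha> G ?z"
      using vertical_hess_position[OF assms, of "axis \<alpha> 1"] commute[OF assms] by (simp add: dy_def)
    finally show ?thesis .
  qed
  have sm: "smooth_on (spray G \<alpha>) W" for \<alpha>
    using smooth_on_linear_comp[OF bounded_linear_vec_nth[of \<alpha>] open_W smooth_spray_vec]
    by (simp add: spray_vec_def)
  have sm': "smooth_on (\<lambda>y'. spray G \<alpha> (x, y')) ?S" for \<alpha>
  proof -
    have "smooth_on (\<lambda>y'. (x, y')) ?S"
      by (intro smooth_on_Pair S smooth_on_const smooth_on_linear bounded_linear_ident)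
    then show ?thesis
      by (rule smooth_on_compose[where g = "Pair x" and T = W, OF S(1), rotated]) (auto simp: sm)
  qed
  have B: "berwald_curvature G \<alpha> \<beta> \<gamma> \<eta> ?z = ?D (\<lambda>y'. spray G \<alpha> (x, y')) y" for \<alpha>
    unfolding dderiv3_slice[OF open_W sm assms, symmetric]
    by (simp add: berwald_curvature_def dy_def dderiv3_def)
  have "(\<Sum>\<nu>\<in>UNIV. \<Sum>\<alpha>\<in>UNIV. y $ \<nu> * hess G ?z $ \<nu> $ \<alpha> * berwald_curvature G \<alpha> \<beta> \<gamma> \<eta> ?z)
      = (\<Sum>\<alpha>\<in>UNIV. dy \<alpha> G ?z * berwald_curvature G \<alpha> \<beta> \<gamma> \<eta> ?z)"
    by (subst sum.swap) (simp add: sum_distrib_right[symmetric] lower)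
  also have "\<dots> = ?D (\<lambda>y'. \<Sum>\<alpha>\<in>UNIV. dy \<alpha> G ?z * spray G \<alpha> (x, y')) y"
    unfolding B by (rule dderiv3_lincomb[symmetric, OF S]) (simp_all add: sm')
  also have "\<dots> = ?D (\<lambda>y'. dderiv (0, spray_vec G (x, y')) G (x, y)) y"
    unfolding dderiv_vertical_expand[OF differentiable[OF assms]] by (simp add: spray_vec_def mult.commute)
  finally show ?thesis by (simp add: landsberg_curvature_def)
qed

lemma landsberg_curvature_zero_iff:
  assumes "(x, y) \<in> W"
  shows "(\<forall>\<beta> \<gamma> \<eta>. landsberg_curvature G \<beta> \<gamma> \<eta> (x, y) = 0) \<longleftrightarrow>
    (\<forall>u v w. dderiv3 u v w (\<lambda>y'. dderiv (0, spray_vec G (x, y')) G (x, y)) y = 0)"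
  using dderiv3_eq_0_if_axes[OF open_slice[OF open_W] smooth_spray_slice[OF assms]] assms
  unfolding landsberg_curvature_eq[OF assms] by auto

end

section \<open>Product functions\<close>

lemma open_quadrant: "open ({0<..} \<times> {0<..} :: (real \<times> real) set)"
  by (intro open_Times open_greaterThan)

lemma dderiv_quadrant:
  fixes f :: "real \<times> real \<Rightarrow> real"
  assumes "f differentiable (at p)"
  shows "dderiv (a, b) f p = a * dderiv (1, 0) f p + b * dderiv (0, 1) f p"
  using dderiv_add_dir[OF assms, of "a *\<^sub>R (1, 0)" "b *\<^sub>R (0, 1)"]
    dderiv_scaleR_dir[OF assms, of a "(1, 0)"] dderiv_scaleR_dir[OF assms, of b "(0, 1)"]
  by simp

lemma dderiv2_quadrant:
  fixes f :: "real \<times> real \<Rightarrow> real"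
  assumes "open S" "smooth_on f S" "p \<in> S"
  shows "dderiv (a, b) (dderiv (c, d) f) p =
    a * c * dderiv (1, 0) (dderiv (1, 0) f) p + (a * d + b * c) * dderiv (1, 0) (dderiv (0, 1) f) p
    + b * d * dderiv (0, 1) (dderiv (0, 1) f) p"
proof -
  have d: "dderiv v f differentiable (at p)" for v
    using assms smooth_on_dderiv smooth_on_imp_differentiable by blast
  have "dderiv v (dderiv (c, d) f) p = c * dderiv v (dderiv (1, 0) f) p + d * dderiv v (dderiv (0, 1) f) p" for v
    using dderiv_quadrant[OF d, of c d v] dderiv_commute[OF assms] by simp
  then show ?thesis
    using dderiv_quadrant[OF d, of a b "(c, d)"] dderiv_commute[OF assms, of "(0, 1)" "(1, 0)"]
    by (simp add: algebra_simps)
qed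

context
  fixes f :: "real \<times> real \<Rightarrow> real"
  assumes pf: "product_function f"
begin

lemma product_function_smooth: "smooth_on f ({0<..} \<times> {0<..})"
  using pf by (simp add: product_function_def)

text \<open>Euler's identity for a function that is homogeneous of degree one.\<close>

lemma product_function_euler:
  assumes "s > 0" "t > 0"
  shows "dderiv (s, t) f (s, t) = f (s, t)"
proof -
  have d: "f differentiable (at (s, t))"
    using smooth_on_imp_differentiable[OF product_function_smooth] assms by simp
  have 1: "((\<lambda>l. f ((s, t) + l *\<^sub>R (s, t))) has_real_derivative dderiv (s, t) f ((s, t) + 0 *\<^sub>R (s, t))) (at 0)"
    by (rule dderiv_along_curve) (use d in simp)
  have 2: "((\<lambda>l. (1 + l) * f (s, t)) has_real_derivative f (s, t)) (at 0)"
    by (auto intro!: derivative_eq_intros)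
  have "(1 + l) * f (s, t) = f ((s, t) + l *\<^sub>R (s, t))" if "l \<in> {-1<..<1}" for l
  proof -
    have "f ((1 + l) * s, (1 + l) * t) = (1 + l) * f (s, t)"
      using pf that assms by (simp add: product_function_def)
    then show ?thesis by (simp add: algebra_simps)
  qed
  then have "((\<lambda>l. f ((s, t) + l *\<^sub>R (s, t))) has_real_derivative f (s, t)) (at 0)"
    by (intro has_field_derivative_transform_within_open[OF 2, of "{-1<..<1}"]) auto
  from DERIV_unique[OF 1 this] show ?thesis by simp
qed

lemma product_function_euler_second:
  assumes "s > 0" "t > 0"
  shows "s * dderiv (1, 0) (dderiv (1, 0) f) (s, t) + t * dderiv (1, 0) (dderiv (0, 1) f) (s, t) = 0"
    and "s * dderiv (1, 0) (dderiv (0, 1) f) (s, t) + t * dderiv (0, 1) (dderiv (0, 1) f) (s, t) = 0"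
proof -
  let ?Q = "{0<..} \<times> {0<..} :: (real \<times> real) set"
  have Q: "(s, t) \<in> ?Q" using assms by simp
  note sm = product_function_smooth
  have d: "f differentiable (at (s, t))" using smooth_on_imp_differentiable[OF sm Q] .
  have 0: "dderiv w (dderiv (s, t) f) (s, t) = 0" for w
  proof -
    have "dderiv w (\<lambda>p. dderiv p f p) (s, t) = dderiv (dderiv w (\<lambda>p. p) (s, t)) f (s, t) +
        dderiv (dderiv w (\<lambda>p. p) (s, t)) (dderiv (s, t) f) (s, t)"
      by (rule dderiv_moving[where T = "\<lambda>p. p" and v = "\<lambda>p. p", OF open_quadrant sm open_quadrant])
         (use Q in auto)
    moreover have "dderiv w (\<lambda>p. dderiv p f p) (s, t) = dderiv w f (s, t)"
      by (rule dderiv_cong_open[OF open_quadrant Q]) (use product_function_euler in auto)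
    ultimately show ?thesis by (simp add: dderiv_bounded_linear[OF bounded_linear_ident])
  qed
  show "s * dderiv (1, 0) (dderiv (1, 0) f) (s, t) + t * dderiv (1, 0) (dderiv (0, 1) f) (s, t) = 0"
    using 0[of "(1, 0)"] unfolding dderiv2_quadrant[OF open_quadrant sm Q, of 1 0 s t] by simp
  show "s * dderiv (1, 0) (dderiv (0, 1) f) (s, t) + t * dderiv (0, 1) (dderiv (0, 1) f) (s, t) = 0"
    using 0[of "(0, 1)"] unfolding dderiv2_quadrant[OF open_quadrant sm Q, of 0 1 s t] by simp
qed

end

section \<open>Pulling back a regular Lagrangian\<close>

definition tangent_map :: "('a::real_normed_vector \<Rightarrow> 'b::real_normed_vector) \<Rightarrow> 'a \<times> 'a \<Rightarrow> 'b \<times> 'b"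
  where "tangent_map \<sigma> z = (\<sigma> (fst z), dderiv (snd z) \<sigma> (fst z))"

locale lagrangian_pullback = regular_lagrangian K W
  for K :: "(real ^ 'm::finite) \<times> (real ^ 'm) \<Rightarrow> real" and W +
  fixes V :: "(real ^ 'k::finite) set" and \<sigma> :: "real ^ 'k \<Rightarrow> real ^ 'm"
  assumes open_V: "open V" and smooth_map: "smooth_on \<sigma> V"
begin

abbreviation T where "T \<equiv> tangent_map \<sigma>"
abbreviation "pullback \<equiv> \<lambda>z. K (T z)"
definition "dom_pullback = {z. fst z \<in> V \<and> T z \<in> W}"

lemma map_differentiable: "x \<in> V \<Longrightarrow> \<sigma> differentiable (at x)"
  and map_differentiable2: "x \<in> V \<Longrightarrow> dderiv w \<sigma> differentiable (at x)"
  using smooth_map smooth_on_imp_differentiable smooth_on_dderiv by blast+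

lemma smooth_tangent_map: "smooth_on T (V \<times> UNIV)"
proof -
  let ?S = "V \<times> UNIV :: ((real ^ 'k) \<times> (real ^ 'k)) set"
  have o: "open ?S" using open_V by (simp add: open_Times)
  have 1: "smooth_on (\<lambda>z. h (fst z)) ?S" if "smooth_on h V" for h :: "real ^ 'k \<Rightarrow> real ^ 'm"
    by (rule smooth_on_compose[where g = fst and f = h, OF o _ smooth_on_linear[OF bounded_linear_fst] that]) auto
  have "smooth_on (\<lambda>z. (\<sigma> (fst z), \<Sum>b\<in>Basis. (snd z \<bullet> b) *\<^sub>R dderiv b \<sigma> (fst z))) ?S"
    by (intro smooth_on_Pair smooth_on_sum smooth_on_scaleR o 1 smooth_on_dderiv smooth_map finite_Basis
        smooth_on_linear_comp[OF bounded_linear_inner_left] smooth_on_linear bounded_linear_snd)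
  then show ?thesis
    by (rule smooth_on_cong[OF o, THEN iffD2, rotated])
       (auto simp: tangent_map_def intro: dderiv_expand[OF map_differentiable])
qed

lemma tangent_map_differentiable: "fst z \<in> V \<Longrightarrow> T differentiable (at z)"
  using smooth_on_imp_differentiable[OF smooth_tangent_map, of z] by (cases z) simp

lemma dderiv_base:
  fixes y :: "real ^ 'k"
  assumes "x \<in> V"
  shows "dderiv s (\<lambda>z. dderiv w \<sigma> (fst z)) (x, y) = dderiv (fst s) (dderiv w \<sigma>) x"
    and "(\<lambda>z. dderiv w \<sigma> (fst z)) differentiable (at (x, y))"
proof -
  have fst_d: "fst differentiable (at (x, y))" for y :: "real ^ 'k"
    by (rule bounded_linear_imp_differentiable[OF bounded_linear_fst])
  have d: "dderiv w \<sigma> differentiable (at (fst (x, y)))" for y :: "real ^ 'k"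
    using map_differentiable2[OF assms] by simp
  show "dderiv s (\<lambda>z. dderiv w \<sigma> (fst z)) (x, y) = dderiv (fst s) (dderiv w \<sigma>) x"
    using dderiv_compose[OF fst_d d, of s] by (simp add: dderiv_bounded_linear[OF bounded_linear_fst])
  show "(\<lambda>z. dderiv w \<sigma> (fst z)) differentiable (at (x, y))"
    using differentiable_compose_at[OF fst_d d] .
qed

text \<open>The second component contains the second derivative of \<open>\<sigma>\<close>, because the fibre component of the
  tangent map depends on the base point. This is the source of the quadratic term in the
  transformation law of sprays.\<close>

lemma dderiv_tangent_map:
  assumes "x \<in> V"
  shows "dderiv (a, b) T (x, y) = (dderiv a \<sigma> x, dderiv b \<sigma> x + dderiv a (dderiv y \<sigma>) x)"
proof -
  let ?S = "V \<times> UNIV :: ((real ^ 'k) \<times> (real ^ 'k)) set"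
  have o: "open ?S" using open_V by (simp add: open_Times)
  have sn: "snd differentiable (at (x, y))" and fs: "\<And>z. fst differentiable (at z)"
    by (rule bounded_linear_imp_differentiable, rule bounded_linear_snd bounded_linear_fst)+
  note m = open_V smooth_map o _ _ fs sn
  have 2: "dderiv (a, b) (\<lambda>z. dderiv (snd z) \<sigma> (fst z)) (x, y) =
      dderiv b \<sigma> x + dderiv a (dderiv y \<sigma>) x"
    using dderiv_moving[OF m, of "(a, b)"] assms
    by (auto simp: dderiv_bounded_linear[OF bounded_linear_snd] dderiv_bounded_linear[OF bounded_linear_fst])
  have d2: "(\<lambda>z. dderiv (snd z) \<sigma> (fst z)) differentiable (at (x, y))"
    using dderiv_moving_differentiable[OF m] assms unfolding differentiable_def by auto
  have d1: "\<sigma> differentiable (at (fst (x, y)))" using map_differentiable assms by simp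
  have "dderiv (a, b) (\<lambda>z. \<sigma> (fst z)) (x, y) = dderiv a \<sigma> x"
    using dderiv_compose[OF fs d1, of "(a, b)"] by (simp add: dderiv_bounded_linear[OF bounded_linear_fst])
  then show ?thesis
    using dderiv_Pair[OF differentiable_compose_at[OF fs d1] d2, of "(a, b)"] 2
    by (simp add: tangent_map_def[abs_def])
qed

lemma open_dom: "open dom_pullback"
proof -
  have o: "open (V \<times> UNIV :: ((real ^ 'k) \<times> (real ^ 'k)) set)" using open_V by (simp add: open_Times)
  have "dom_pullback = (V \<times> UNIV) \<inter> T -` W" by (auto simp: dom_pullback_def)
  then show ?thesis
    using continuous_open_preimage[OF smooth_on_imp_continuous[OF smooth_tangent_map] o open_W] by simp
qed

lemma smooth_pullback: "smooth_on pullback dom_pullback"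
  by (rule smooth_on_compose[OF open_dom _ smooth_on_subset[OF smooth_tangent_map] smooth])
     (auto simp: dom_pullback_def)

lemma dderiv_zero: "x \<in> V \<Longrightarrow> dderiv 0 \<sigma> x = 0"
  by (rule dderiv_zero_dir[OF map_differentiable])

lemma dderiv_pullback:
  assumes "(x, y) \<in> dom_pullback"
  shows "dderiv (a, b) pullback (x, y) =
    dderiv (dderiv a \<sigma> x, dderiv b \<sigma> x + dderiv a (dderiv y \<sigma>) x) K (T (x, y))"
proof -
  have "x \<in> V" "T (x, y) \<in> W" using assms by (auto simp: dom_pullback_def)
  then show ?thesis
    using dderiv_compose[OF tangent_map_differentiable differentiable, of "(x, y)" "(a, b)"]
    by (simp add: dderiv_tangent_map)
qed

lemma dderiv_vertical_pullback:
  assumes "(x, y) \<in> dom_pullback"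
  shows "dderiv (0, w) pullback (x, y) = dderiv (0, dderiv w \<sigma> x) K (T (x, y))"
proof -
  have "x \<in> V" using assms by (simp add: dom_pullback_def)
  then have "dderiv 0 \<sigma> x = 0" "dderiv 0 (dderiv y \<sigma>) x = 0"
    using dderiv_zero_dir map_differentiable map_differentiable2 by blast+
  then show ?thesis using dderiv_pullback[OF assms, of 0 w] by simp
qed

text \<open>A vertical derivative of the pullback is a derivative of \<open>K\<close> in the direction \<open>(0, D\<sigma>(w))\<close>, which moves
  with the base point; the first summand comes from this motion.\<close>

lemma dderiv2_pullback:
  assumes z: "(x, y) \<in> dom_pullback"
  shows "dderiv (a, b) (dderiv (0, w) pullback) (x, y) =
    dderiv (0, dderiv a (dderiv w \<sigma>) x) K (T (x, y)) +
    dderiv (dderiv a \<sigma> x, dderiv b \<sigma> x + dderiv a (dderiv y \<sigma>) x) (dderiv (0, dderiv w \<sigma> x) K) (T (x, y))"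
proof -
  let ?v = "\<lambda>z. (0 :: real ^ 'm, dderiv w \<sigma> (fst z))"
  have x: "x \<in> V" using z by (simp add: dom_pullback_def)
  have dv: "?v differentiable (at (x, y))"
    using has_derivative_Pair[OF has_derivative_const dderiv_has_derivative[OF dderiv_base(2)[OF x]]]
    by (auto simp: differentiable_def)
  have Dv: "dderiv (a, b) ?v (x, y) = (0, dderiv a (dderiv w \<sigma>) x)"
    by (subst dderiv_Pair[OF differentiable_const dderiv_base(2)[OF x]]) (simp add: dderiv_base(1)[OF x])
  have "dderiv (a, b) (dderiv (0, w) pullback) (x, y) = dderiv (a, b) (\<lambda>z. dderiv (?v z) K (T z)) (x, y)"
    by (rule dderiv_cong_open[OF open_dom z]) (use dderiv_vertical_pullback in auto)
  also have "\<dots> = dderiv (dderiv (a, b) ?v (x, y)) K (T (x, y)) +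
      dderiv (dderiv (a, b) T (x, y)) (dderiv (?v (x, y)) K) (T (x, y))"
    by (rule dderiv_moving[OF open_W smooth open_dom _ z _ dv])
       (auto simp: dom_pullback_def tangent_map_differentiable)
  finally show ?thesis by (simp add: Dv dderiv_tangent_map[OF x])
qed

lemma dderiv2_vertical_pullback:
  assumes z: "(x, y) \<in> dom_pullback"
  shows "dderiv (0, u) (dderiv (0, w) pullback) (x, y) =
    dderiv (0, dderiv u \<sigma> x) (dderiv (0, dderiv w \<sigma> x) K) (T (x, y))"
proof -
  have x: "x \<in> V" "T (x, y) \<in> W" using z by (simp_all add: dom_pullback_def)
  then have "dderiv 0 \<sigma> x = 0" "dderiv 0 (dderiv w \<sigma>) x = 0" for w
    using dderiv_zero_dir map_differentiable map_differentiable2 by blast+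
  moreover have "dderiv (0, 0) K (T (x, y)) = 0"
    using dderiv_zero_dir[OF differentiable[OF x(2)]] by (simp add: zero_prod_def)
  ultimately show ?thesis using dderiv2_pullback[OF z, of 0 u w] by simp
qed

text \<open>If \<open>g\<close> obeys the transformation law of sprays, then \<open>(y, -2 g)\<close> projects under the tangent map to the
  spray of \<open>K\<close>. Conservation of energy and the spray equation therefore pass from \<open>K\<close> to its pullback,
  the two terms with second derivatives of \<open>\<sigma>\<close> being equal by symmetry. The pullback is usually degenerate and
  has no spray of its own, so a vector \<open>g\<close> takes the place of its spray.\<close>

lemma spray_related:
  assumes z: "(x, y) \<in> dom_pullback"
    and g: "dderiv g \<sigma> x = spray_vec K (T (x, y)) + (1/2) *\<^sub>R dderiv y (dderiv y \<sigma>) x"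
  shows "dderiv (y, - 2 *\<^sub>R g) pullback (x, y) = 0"
    and "dderiv (y, - 2 *\<^sub>R g) (dderiv (0, w) pullback) (x, y) = dderiv (w, 0) pullback (x, y)"
proof -
  have x: "x \<in> V" and Tz: "T (x, y) \<in> W" using z by (simp_all add: dom_pullback_def)
  have "dderiv (- 2 *\<^sub>R g) \<sigma> x = - 2 *\<^sub>R dderiv g \<sigma> x"
    by (rule dderiv_scaleR_dir[OF map_differentiable[OF x]])
  then have 1: "(dderiv y \<sigma> x, dderiv (- 2 *\<^sub>R g) \<sigma> x + dderiv y (dderiv y \<sigma>) x) =
      (snd (T (x, y)), - 2 *\<^sub>R spray_vec K (T (x, y)))"
    by (simp only: g) (simp add: tangent_map_def scaleR_add_right)
  show "dderiv (y, - 2 *\<^sub>R g) pullback (x, y) = 0"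
    unfolding dderiv_pullback[OF z] 1 by (rule spray_preserves_energy[OF Tz])
  have "dderiv (y, - 2 *\<^sub>R g) (dderiv (0, w) pullback) (x, y) =
      dderiv (0, dderiv y (dderiv w \<sigma>) x) K (T (x, y)) + dderiv (dderiv w \<sigma> x, 0) K (T (x, y))"
    unfolding dderiv2_pullback[OF z] 1 spray_equation[OF Tz] ..
  also have "\<dots> = dderiv (dderiv w \<sigma> x, dderiv w (dderiv y \<sigma>) x) K (T (x, y))"
    using dderiv_add_dir[OF differentiable[OF Tz], of "(0, dderiv y (dderiv w \<sigma>) x)" "(dderiv w \<sigma> x, 0)"]
      dderiv_commute[OF open_V smooth_map x, of w y] by simp
  also have "\<dots> = dderiv (w, 0) pullback (x, y)"
    unfolding dderiv_pullback[OF z] by (simp add: dderiv_zero[OF x])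
  finally show "dderiv (y, - 2 *\<^sub>R g) (dderiv (0, w) pullback) (x, y) = dderiv (w, 0) pullback (x, y)" .
qed

lemma bounded_bilinear_second_derivative:
  assumes "(x, y) \<in> dom_pullback"
  shows "bounded_bilinear (\<lambda>a b. dderiv (0, (1/2) *\<^sub>R dderiv a (dderiv b \<sigma>) x) K (T (x, y)))"
proof -
  have x: "x \<in> V" and Tz: "T (x, y) \<in> W" using assms by (simp_all add: dom_pullback_def)
  have l: "linear (\<lambda>c. dderiv (0, (1/2) *\<^sub>R c) K (T (x, y)))"
    using linear_compose[OF linear_scaleR vertical_linear[OF Tz]] by (simp add: o_def)
  have 1: "linear (\<lambda>a. dderiv a (dderiv b \<sigma>) x)" for b
    by (rule linear_dderiv[OF map_differentiable2[OF x]])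
  then have 2: "linear (\<lambda>b. dderiv a (dderiv b \<sigma>) x)" for a
    by (simp add: dderiv_commute[OF open_V smooth_map x, of a])
  show ?thesis
    unfolding bilinear_conv_bounded_bilinear[symmetric] bilinear_def
    using linear_compose[OF 1 l] linear_compose[OF 2 l] by (simp add: o_def)
qed

text \<open>One factor's share in the function whose third derivatives are the Landsberg curvature of the product.
  The transformation law splits it into the corresponding function of \<open>K\<close>, composed with the linear map
  \<open>D\<sigma>\<close>, and a quadratic form, which has no third derivatives.\<close>

lemma spray_term:
  assumes z: "(x, y) \<in> dom_pullback"
    and g: "\<And>y'. y' \<in> S \<Longrightarrow> dderiv (g y') \<sigma> x = spray_vec K (T (x, y')) + (1/2) *\<^sub>R dderiv y' (dderiv y' \<sigma>) x"
    and S: "open S" "y \<in> S" "\<And>y'. y' \<in> S \<Longrightarrow> (x, y') \<in> dom_pullback"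
  shows "dderiv3 u v w (\<lambda>y'. dderiv (0, dderiv (g y') \<sigma> x) K (T (x, y))) y =
     dderiv3 (dderiv u \<sigma> x) (dderiv v \<sigma> x) (dderiv w \<sigma> x)
       (\<lambda>y'. dderiv (0, spray_vec K (\<sigma> x, y')) K (\<sigma> x, dderiv y \<sigma> x)) (dderiv y \<sigma> x)"
    and "smooth_on (\<lambda>y'. dderiv (0, dderiv (g y') \<sigma> x) K (T (x, y))) S"
proof -
  let ?R = "{y'. (\<sigma> x, y') \<in> W}"
  let ?A = "\<lambda>w. dderiv w \<sigma> x"
  let ?\<phi> = "\<lambda>y'. dderiv (0, spray_vec K (\<sigma> x, y')) K (\<sigma> x, ?A y)"
  let ?p = "\<lambda>a b. dderiv (0, (1/2) *\<^sub>R dderiv a (dderiv b \<sigma>) x) K (T (x, y))"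
  have x: "x \<in> V" and Tz: "T (x, y) \<in> W" using z by (simp_all add: dom_pullback_def)
  have T: "T (x, y') = (\<sigma> x, ?A y')" for y' by (simp add: tangent_map_def)
  have A: "linear ?A" by (rule linear_dderiv[OF map_differentiable[OF x]])
  have R: "open ?R" by (rule open_slice[OF open_W])
  have AS: "?A ` S \<subseteq> ?R" using S(3) by (auto simp: dom_pullback_def T)
  have \<phi>: "smooth_on ?\<phi> ?R" using smooth_spray_slice Tz T by metis
  have \<phi>A: "smooth_on (\<lambda>y'. ?\<phi> (?A y')) S"
    by (rule smooth_on_compose[OF S(1) AS smooth_on_linear \<phi>]) (use A in \<open>simp add: linear_conv_bounded_linear\<close>)
  have p: "bounded_bilinear ?p" by (rule bounded_bilinear_second_derivative[OF z])
  have ps: "smooth_on (\<lambda>y'. ?p y' y') S"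
    by (rule smooth_on_bilinear[OF p S(1)]; rule smooth_on_linear[OF bounded_linear_ident])
  have eq: "dderiv (0, dderiv (g y') \<sigma> x) K (T (x, y)) = ?\<phi> (?A y') + ?p y' y'" if "y' \<in> S" for y'
    using linear_add[OF vertical_linear[OF Tz]] g[OF that] by (simp add: T)
  have "dderiv3 u v w (\<lambda>y'. dderiv (0, dderiv (g y') \<sigma> x) K (T (x, y))) y =
      dderiv3 u v w (\<lambda>y'. ?\<phi> (?A y') + ?p y' y') y"
    by (rule dderiv3_cong_open[OF S(1,2) eq])
  also have "\<dots> = dderiv3 u v w (\<lambda>y'. ?\<phi> (?A y')) y + dderiv3 u v w (\<lambda>y'. ?p y' y') y"
    by (rule dderiv3_add[OF S(1) \<phi>A ps S(2)])
  also have "dderiv3 u v w (\<lambda>y'. ?p y' y') y = 0" by (rule dderiv3_quadratic[OF p])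
  also have "dderiv3 u v w (\<lambda>y'. ?\<phi> (?A y')) y = dderiv3 (?A u) (?A v) (?A w) ?\<phi> (?A y)"
    by (rule dderiv3_compose_linear[OF A R \<phi> S(1) AS S(2)])
  finally show "dderiv3 u v w (\<lambda>y'. dderiv (0, dderiv (g y') \<sigma> x) K (T (x, y))) y =
      dderiv3 (?A u) (?A v) (?A w) ?\<phi> (?A y)" by simp
  show "smooth_on (\<lambda>y'. dderiv (0, dderiv (g y') \<sigma> x) K (T (x, y))) S"
    by (rule smooth_on_cong[OF S(1), THEN iffD2, rotated, OF smooth_on_add[OF S(1) \<phi>A ps]]) (rule eq)
qed

end

section \<open>The spray and the Landsberg tensor of a Minkowskian product\<close>

lemma scaleR_solve:
  fixes a b :: "'a::real_vector"
  assumes "r \<noteq> 0" "r *\<^sub>R a + c *\<^sub>R b = 0"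
  shows "a = (- c / r) *\<^sub>R b"
proof -
  have "a = (1 / r) *\<^sub>R (r *\<^sub>R a)" using assms(1) by simp
  also have "r *\<^sub>R a = (- c) *\<^sub>R b" using assms(2) by (simp add: add_eq_0_iff2)
  finally show ?thesis by simp
qed

text \<open>A Minkowskian product in arbitrary coordinates: \<open>\<sigma>\<^sub>1\<close> and \<open>\<sigma>\<^sub>2\<close> send the coordinates of a point of the
  product to the coordinates of its two components. The assumptions \<open>onto\<close> and \<open>inj\<close> say
  that the tangent space is the direct sum of those of the factors.\<close>

locale minkowskian_pullback =
  K: lagrangian_pullback K W\<^sub>1 V \<sigma>\<^sub>1 + H: lagrangian_pullback H W\<^sub>2 V \<sigma>\<^sub>2
  for K :: "(real ^ 'm::finite) \<times> (real ^ 'm) \<Rightarrow> real" and W\<^sub>1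
    and H :: "(real ^ 'n::finite) \<times> (real ^ 'n) \<Rightarrow> real" and W\<^sub>2
    and V :: "(real ^ 'k::finite) set" and \<sigma>\<^sub>1 \<sigma>\<^sub>2 +
  fixes f :: "real \<times> real \<Rightarrow> real" and G :: "(real ^ 'k) \<times> (real ^ 'k) \<Rightarrow> real"
  assumes pf: "product_function f"
    and K_pos: "z\<^sub>1 \<in> W\<^sub>1 \<Longrightarrow> K z\<^sub>1 > 0" and H_pos: "z\<^sub>2 \<in> W\<^sub>2 \<Longrightarrow> H z\<^sub>2 > 0"
    and onto: "x \<in> V \<Longrightarrow> \<exists>y. dderiv y \<sigma>\<^sub>1 x = a \<and> dderiv y \<sigma>\<^sub>2 x = b"
    and inj: "x \<in> V \<Longrightarrow> dderiv y \<sigma>\<^sub>1 x = 0 \<Longrightarrow> dderiv y \<sigma>\<^sub>2 x = 0 \<Longrightarrow> y = 0"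
    and G_eq: "z \<in> K.dom_pullback \<Longrightarrow> z \<in> H.dom_pullback \<Longrightarrow>
      G z = f (K (tangent_map \<sigma>\<^sub>1 z), H (tangent_map \<sigma>\<^sub>2 z))"
begin

abbreviation "W \<equiv> K.dom_pullback \<inter> H.dom_pullback"
abbreviation "P \<equiv> \<lambda>z. (K.pullback z, H.pullback z)"
abbreviation "Q \<equiv> {0<..} \<times> {0<..} :: (real \<times> real) set"

lemma open_dom: "open W"
  using K.open_dom H.open_dom by blast

lemma smooth_KH: "smooth_on K.pullback W" "smooth_on H.pullback W"
  using smooth_on_subset K.smooth_pullback H.smooth_pullback by blast+

lemma smooth_P: "smooth_on P W"
  by (intro smooth_on_Pair open_dom smooth_KH)

lemma P_in_Q: "z \<in> W \<Longrightarrow> P z \<in> Q"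
  using K_pos H_pos by (auto simp: K.dom_pullback_def H.dom_pullback_def)

lemma smooth_f: "smooth_on f Q"
  by (rule product_function_smooth[OF pf])

lemma differentiable_f: "z \<in> W \<Longrightarrow> f differentiable (at (P z))"
  using smooth_on_imp_differentiable[OF smooth_f P_in_Q] .

lemma smooth_G: "smooth_on G W"
proof -
  have "smooth_on (\<lambda>z. f (P z)) W"
    by (rule smooth_on_compose[OF open_dom _ smooth_P smooth_f]) (use P_in_Q in blast)
  then show ?thesis
    by (rule smooth_on_cong[OF open_dom, THEN iffD2, rotated]) (use G_eq in auto)
qed

lemma dderiv_P:
  assumes "z \<in> W"
  shows "dderiv s P z = (dderiv s K.pullback z, dderiv s H.pullback z)"
  by (rule dderiv_Pair) (use smooth_KH assms smooth_on_imp_differentiable in blast)+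

lemma dderiv_G:
  assumes "z \<in> W"
  shows "dderiv s G z = dderiv (dderiv s K.pullback z, dderiv s H.pullback z) f (P z)"
proof -
  have "dderiv s G z = dderiv s (\<lambda>z. f (P z)) z"
    by (rule dderiv_cong_open[OF open_dom assms]) (use G_eq in auto)
  also have "\<dots> = dderiv (dderiv s P z) f (P z)"
    by (rule dderiv_compose[OF smooth_on_imp_differentiable[OF smooth_P assms] differentiable_f[OF assms]])
  finally show ?thesis unfolding dderiv_P[OF assms] .
qed

lemma dderiv2_G:
  assumes "z \<in> W"
  shows "dderiv s (dderiv r G) z =
    dderiv (dderiv s (dderiv r K.pullback) z, dderiv s (dderiv r H.pullback) z) f (P z) +
    dderiv (dderiv s K.pullback z, dderiv s H.pullback z)
      (dderiv (dderiv r K.pullback z, dderiv r H.pullback z) f) (P z)"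
proof -
  let ?v = "\<lambda>z. (dderiv r K.pullback z, dderiv r H.pullback z)"
  have d: "dderiv r K.pullback differentiable (at z)" "dderiv r H.pullback differentiable (at z)"
    using smooth_KH assms smooth_on_imp_differentiable smooth_on_dderiv by blast+
  have dv: "?v differentiable (at z)"
    using has_derivative_Pair[OF dderiv_has_derivative[OF d(1)] dderiv_has_derivative[OF d(2)]]
    by (auto simp: differentiable_def)
  have "dderiv s (dderiv r G) z = dderiv s (\<lambda>z. dderiv (?v z) f (P z)) z"
    by (rule dderiv_cong_open[OF open_dom assms]) (rule dderiv_G)
  also have "\<dots> = dderiv (dderiv s ?v z) f (P z) + dderiv (dderiv s P z) (dderiv (?v z) f) (P z)"
    by (rule dderiv_moving[OF open_quadrant smooth_f open_dom _ assms _ dv])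
       (use P_in_Q smooth_on_imp_differentiable[OF smooth_P] in blast)+
  finally show ?thesis unfolding dderiv_P[OF assms] dderiv_Pair[OF d] .
qed

text \<open>Testing the Hessian of \<open>G\<close> on vectors \<open>u\<close> with vanishing second component shows that the first
  component of a kernel vector \<open>w\<close> is a multiple \<open>\<alpha> y\<^sub>1\<close> of the position vector, because
  \<open>K\<^sub>u = u\<^sup>\<nu> K\<^sub>\<nu>\<^sub>\<mu> y\<^sub>1\<^sup>\<mu>\<close> and the Hessian of \<open>K\<close> is nondegenerate; likewise the second component is \<open>\<delta> y\<^sub>2\<close>.
  Euler's identities for \<open>K\<close>, \<open>H\<close> and \<open>f\<close> turn the remaining conditions into a two by two system for
  \<open>(\<alpha>, \<delta>)\<close> with determinant \<open>f\<^sub>1 f\<^sub>2 - 2 f f\<^sub>1\<^sub>2\<close>.\<close>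

lemma nondegenerate_product:
  assumes z: "(x, y) \<in> W"
    and w: "\<And>u. dderiv (0, u) (dderiv (0, w) G) (x, y) = 0"
  shows "w = 0"
proof -
  let ?z = "(x, y)"
  let ?p = "P ?z"
  define k where "k = K.pullback ?z"
  define h where "h = H.pullback ?z"
  define f1 where "f1 = dderiv (1, 0) f ?p"
  define f2 where "f2 = dderiv (0, 1) f ?p"
  define f11 where "f11 = dderiv (1, 0) (dderiv (1, 0) f) ?p"
  define f12 where "f12 = dderiv (1, 0) (dderiv (0, 1) f) ?p"
  define f22 where "f22 = dderiv (0, 1) (dderiv (0, 1) f) ?p"
  define k1 where "k1 = dderiv (0, w) K.pullback ?z"
  define h1 where "h1 = dderiv (0, w) H.pullback ?z"
  define c where "c = k1 * f11 + h1 * f12"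
  define d where "d = k1 * f12 + h1 * f22"
  have zK: "?z \<in> K.dom_pullback" and zH: "?z \<in> H.dom_pullback" using z by auto
  then have x: "x \<in> V" and TK: "K.T ?z \<in> W\<^sub>1" and TH: "H.T ?z \<in> W\<^sub>2"
    by (auto simp: K.dom_pullback_def H.dom_pullback_def)
  let ?A = "\<lambda>w. dderiv w \<sigma>\<^sub>1 x" and ?B = "\<lambda>w. dderiv w \<sigma>\<^sub>2 x"
  have pos: "k > 0" "h > 0" using P_in_Q[OF z] by (auto simp: k_def h_def)
  have p: "?p = (k, h)" by (simp add: k_def h_def)
  have nz: "f1 \<noteq> 0" "f2 \<noteq> 0" "f1 * f2 - 2 * f ?p * f12 \<noteq> 0"
    using pf pos unfolding product_function_def f1_def f2_def f12_def p by blast+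
  have e1: "k * f1 + h * f2 = f ?p"
    using product_function_euler[OF pf pos] dderiv_quadrant[OF differentiable_f[OF z], of k h]
    unfolding p f1_def f2_def by simp
  have e2: "k * f11 + h * f12 = 0" "k * f12 + h * f22 = 0"
    using product_function_euler_second[OF pf pos] by (simp_all add: p f11_def f12_def f22_def)
  have q: "dderiv (a, b) f ?p = a * f1 + b * f2" for a b
    unfolding f1_def f2_def by (rule dderiv_quadrant[OF differentiable_f[OF z]])
  have q2: "dderiv (a, b) (dderiv (c, d) f) ?p = a * c * f11 + (a * d + b * c) * f12 + b * d * f22" for a b c d
    unfolding f11_def f12_def f22_def by (rule dderiv2_quadrant[OF open_quadrant smooth_f P_in_Q[OF z]])
  have expand: "f1 * dderiv (0, ?A u) (dderiv (0, ?A w) K) (K.T ?z) +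
      f2 * dderiv (0, ?B u) (dderiv (0, ?B w) H) (H.T ?z) +
      c * dderiv (0, ?A u) K (K.T ?z) + d * dderiv (0, ?B u) H (H.T ?z) = 0" for u
    using w[of u]
    unfolding dderiv2_G[OF z] q q2
      K.dderiv2_vertical_pullback[OF zK] H.dderiv2_vertical_pullback[OF zH]
      K.dderiv_vertical_pullback[OF zK, of u] H.dderiv_vertical_pullback[OF zH, of u]
      k1_def[symmetric] h1_def[symmetric]
    by (simp add: c_def d_def algebra_simps)
  have "f1 *\<^sub>R ?A w + c *\<^sub>R ?A y = 0"
  proof (rule K.nondegenerate[OF TK])
    fix u\<^sub>1
    obtain u where u: "?A u = u\<^sub>1" "?B u = 0" using onto[OF x] by blast
    have "dderiv (0, 0) H' z = 0" if "H' differentiable (at z)" for H' :: "(real ^ 'n) \<times> (real ^ 'n) \<Rightarrow> real" and z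
      using dderiv_zero_dir[OF that] by (simp add: zero_prod_def)
    then have "f1 * dderiv (0, u\<^sub>1) (dderiv (0, ?A w) K) (K.T ?z) + c * dderiv (0, u\<^sub>1) K (K.T ?z) = 0"
      using expand[of u] H.differentiable[OF TH] H.differentiable2[OF TH] by (simp add: u)
    moreover have "dderiv (0, u\<^sub>1) (dderiv (0, ?A y) K) (K.T ?z) = dderiv (0, u\<^sub>1) K (K.T ?z)"
      using K.vertical_hess_position[OF TK] by (simp add: tangent_map_def)
    ultimately show "dderiv (0, u\<^sub>1) (dderiv (0, f1 *\<^sub>R ?A w + c *\<^sub>R ?A y) K) (K.T ?z) = 0"
      using linear_add[OF K.vertical_hess_linear[OF TK]] linear_cmul[OF K.vertical_hess_linear[OF TK]]
      by simp
  qed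
  then have A: "?A w = (- c / f1) *\<^sub>R ?A y"
    by (rule scaleR_solve[OF nz(1)])
  have "f2 *\<^sub>R ?B w + d *\<^sub>R ?B y = 0"
  proof (rule H.nondegenerate[OF TH])
    fix u\<^sub>2
    obtain u where u: "?A u = 0" "?B u = u\<^sub>2" using onto[OF x] by blast
    have "dderiv (0, 0) H' z = 0" if "H' differentiable (at z)" for H' :: "(real ^ 'm) \<times> (real ^ 'm) \<Rightarrow> real" and z
      using dderiv_zero_dir[OF that] by (simp add: zero_prod_def)
    then have "f2 * dderiv (0, u\<^sub>2) (dderiv (0, ?B w) H) (H.T ?z) + d * dderiv (0, u\<^sub>2) H (H.T ?z) = 0"
      using expand[of u] K.differentiable[OF TK] K.differentiable2[OF TK] by (simp add: u)
    moreover have "dderiv (0, u\<^sub>2) (dderiv (0, ?B y) H) (H.T ?z) = dderiv (0, u\<^sub>2) H (H.T ?z)"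
      using H.vertical_hess_position[OF TH] by (simp add: tangent_map_def)
    ultimately show "dderiv (0, u\<^sub>2) (dderiv (0, f2 *\<^sub>R ?B w + d *\<^sub>R ?B y) H) (H.T ?z) = 0"
      using linear_add[OF H.vertical_hess_linear[OF TH]] linear_cmul[OF H.vertical_hess_linear[OF TH]]
      by simp
  qed
  then have B: "?B w = (- d / f2) *\<^sub>R ?B y"
    by (rule scaleR_solve[OF nz(2)])
  define \<alpha> where "\<alpha> = - c / f1"
  define \<delta> where "\<delta> = - d / f2"
  have "k1 = dderiv (0, \<alpha> *\<^sub>R ?A y) K (K.T ?z)"
    unfolding k1_def K.dderiv_vertical_pullback[OF zK] A \<alpha>_def ..
  also have "\<dots> = \<alpha> * (2 * k)"
    using linear_cmul[OF K.vertical_linear[OF TK], of \<alpha> "?A y"] K.euler[of "\<sigma>\<^sub>1 x" "?A y"] TK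
    by (simp add: k_def tangent_map_def)
  finally have "k1 = \<alpha> * (2 * k)" .
  moreover have "h1 = \<delta> * (2 * h)"
  proof -
    have "h1 = dderiv (0, \<delta> *\<^sub>R ?B y) H (H.T ?z)"
      unfolding h1_def H.dderiv_vertical_pullback[OF zH] B \<delta>_def ..
    also have "\<dots> = \<delta> * (2 * h)"
      using linear_cmul[OF H.vertical_linear[OF TH], of \<delta> "?B y"] H.euler[of "\<sigma>\<^sub>2 x" "?B y"] TH
      by (simp add: h_def tangent_map_def)
    finally show ?thesis .
  qed
  moreover have "f1 * \<alpha> = - c" "f2 * \<delta> = - d" using nz by (simp_all add: \<alpha>_def \<delta>_def)
  ultimately have E: "f1 * \<alpha> + 2 * \<alpha> * (k * f11) + 2 * \<delta> * (h * f12) = 0"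
      "f2 * \<delta> + 2 * \<alpha> * (k * f12) + 2 * \<delta> * (h * f22) = 0"
    by (simp_all add: c_def d_def algebra_simps)
  have kf: "k * f11 = - (h * f12)" "h * f22 = - (k * f12)"
    using e2 by (simp_all add: eq_neg_iff_add_eq_0 add.commute)
  have "f1 * \<alpha> + 2 * \<alpha> * - (h * f12) + 2 * \<delta> * (h * f12) = 0"
      "f2 * \<delta> + 2 * \<alpha> * (k * f12) + 2 * \<delta> * - (k * f12) = 0"
    using E unfolding kf .
  then have s: "\<alpha> * (f1 - 2 * (h * f12)) + \<delta> * (2 * (h * f12)) = 0"
      "\<alpha> * (2 * (k * f12)) + \<delta> * (f2 - 2 * (k * f12)) = 0"
    by (simp_all add: algebra_simps)
  \<comment> \<open>Since \<open>k f\<^sub>1 + h f\<^sub>2 = f\<close>, this determinant equals \<open>f\<^sub>1 f\<^sub>2 - 2 f f\<^sub>1\<^sub>2\<close>.\<close>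
  define D where "D = (f1 - 2 * (h * f12)) * (f2 - 2 * (k * f12)) - 2 * (h * f12) * (2 * (k * f12))"
  have det: "D \<noteq> 0"
    using nz(3) unfolding D_def e1[symmetric] by (simp add: algebra_simps)
  have "\<alpha> * D =
      (\<alpha> * (f1 - 2 * (h * f12)) + \<delta> * (2 * (h * f12))) * (f2 - 2 * (k * f12)) -
      (\<alpha> * (2 * (k * f12)) + \<delta> * (f2 - 2 * (k * f12))) * (2 * (h * f12))"
    unfolding D_def by algebra
  then have "\<alpha> * D = 0" by (simp only: s mult_zero_left diff_self)
  then have \<alpha>: "\<alpha> = 0" using det by simp
  have "\<delta> * D =
      (\<alpha> * (2 * (k * f12)) + \<delta> * (f2 - 2 * (k * f12))) * (f1 - 2 * (h * f12)) -
      (\<alpha> * (f1 - 2 * (h * f12)) + \<delta> * (2 * (h * f12))) * (2 * (k * f12))"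
    unfolding D_def by algebra
  then have "\<delta> * D = 0" by (simp only: s mult_zero_left diff_self)
  then have \<delta>: "\<delta> = 0" using det by simp
  show "w = 0"
    by (rule inj[OF x]) (use A B \<alpha> \<delta> in \<open>simp_all add: \<alpha>_def \<delta>_def\<close>)
qed

sublocale G: regular_lagrangian G W
proof
  show "open W" by (rule open_dom)
  show "smooth_on G W" by (rule smooth_G)
  show "w = 0" if "z \<in> W" "\<And>u. dderiv (0, u) (dderiv (0, w) G) z = 0" for z w
    using that nondegenerate_product by (cases z) auto
next
  fix x y :: "real ^ 'k" and l :: real
  assume z: "(x, y) \<in> W" and l: "l > 0"
  have x: "x \<in> V" using z by (simp add: K.dom_pullback_def)
  have TK: "K.T (x, l *\<^sub>R y) = (\<sigma>\<^sub>1 x, l *\<^sub>R dderiv y \<sigma>\<^sub>1 x)"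
    and TH: "H.T (x, l *\<^sub>R y) = (\<sigma>\<^sub>2 x, l *\<^sub>R dderiv y \<sigma>\<^sub>2 x)"
    by (simp_all add: tangent_map_def dderiv_scaleR_dir[OF K.map_differentiable[OF x]]
        dderiv_scaleR_dir[OF H.map_differentiable[OF x]])
  have zK: "(\<sigma>\<^sub>1 x, dderiv y \<sigma>\<^sub>1 x) \<in> W\<^sub>1" and zH: "(\<sigma>\<^sub>2 x, dderiv y \<sigma>\<^sub>2 x) \<in> W\<^sub>2"
    using z by (simp_all add: K.dom_pullback_def H.dom_pullback_def tangent_map_def)
  show lz: "(x, l *\<^sub>R y) \<in> W"
    using x K.conic[OF zK l] H.conic[OF zH l]
    unfolding K.dom_pullback_def H.dom_pullback_def by (simp add: TK TH)
  have "f (l\<^sup>2 * s, l\<^sup>2 * t) = l\<^sup>2 * f (s, t)" if "s > 0" "t > 0" for s t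
    using pf that by (simp add: product_function_def)
  then have f: "f (l\<^sup>2 * K.pullback (x, y), l\<^sup>2 * H.pullback (x, y)) = l\<^sup>2 * f (P (x, y))"
    using P_in_Q[OF z] by simp
  have T: "K.T (x, y) = (\<sigma>\<^sub>1 x, dderiv y \<sigma>\<^sub>1 x)" "H.T (x, y) = (\<sigma>\<^sub>2 x, dderiv y \<sigma>\<^sub>2 x)"
    by (simp_all add: tangent_map_def)
  have "G (x, l *\<^sub>R y) = f (P (x, l *\<^sub>R y))" by (rule G_eq) (use lz in simp_all)
  also have "\<dots> = f (l\<^sup>2 * K.pullback (x, y), l\<^sup>2 * H.pullback (x, y))"
    unfolding TK TH T K.homogeneous[OF zK l] H.homogeneous[OF zH l] ..
  also have "\<dots> = l\<^sup>2 * G (x, y)"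
    unfolding f using G_eq[of "(x, y)"] z by simp
  finally show "G (x, l *\<^sub>R y) = l\<^sup>2 * G (x, y)" .
qed

text \<open>Up to the transformation law, the spray of the product is the pair of the sprays of the factors,
  whatever \<open>f\<close> is: the vector \<open>g\<close> with these components satisfies the spray equation of \<open>G\<close>, because both
  \<open>K\<close> and \<open>H\<close>, and with them the first derivatives of \<open>f\<close>, are constant along \<open>(y, -2 g)\<close>.\<close>

lemma spray_vec_product:
  assumes z: "(x, y) \<in> W"
  shows "dderiv (spray_vec G (x, y)) \<sigma>\<^sub>1 x = spray_vec K (K.T (x, y)) + (1/2) *\<^sub>R dderiv y (dderiv y \<sigma>\<^sub>1) x"
    and "dderiv (spray_vec G (x, y)) \<sigma>\<^sub>2 x = spray_vec H (H.T (x, y)) + (1/2) *\<^sub>R dderiv y (dderiv y \<sigma>\<^sub>2) x"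
proof -
  have zK: "(x, y) \<in> K.dom_pullback" and zH: "(x, y) \<in> H.dom_pullback" using z by auto
  then have x: "x \<in> V" by (simp add: K.dom_pullback_def)
  obtain g where
    g1: "dderiv g \<sigma>\<^sub>1 x = spray_vec K (K.T (x, y)) + (1/2) *\<^sub>R dderiv y (dderiv y \<sigma>\<^sub>1) x" and
    g2: "dderiv g \<sigma>\<^sub>2 x = spray_vec H (H.T (x, y)) + (1/2) *\<^sub>R dderiv y (dderiv y \<sigma>\<^sub>2) x"
    using onto[OF x] by blast
  have f0: "dderiv (0, 0) f' (P (x, y)) = 0" if "f' differentiable (at (P (x, y)))" for f' :: "real \<times> real \<Rightarrow> real"
    using dderiv_zero_dir[OF that] by (simp add: zero_prod_def)
  have "dderiv v f differentiable (at (P (x, y)))" for v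
    using smooth_on_imp_differentiable[OF smooth_on_dderiv[OF smooth_f] P_in_Q[OF z]] .
  then have "dderiv (y, - 2 *\<^sub>R g) (dderiv (0, w) G) (x, y) = dderiv (w, 0) G (x, y)" for w
    unfolding dderiv2_G[OF z] dderiv_G[OF z]
      K.spray_related[OF zK g1] H.spray_related[OF zH g2] by (simp add: f0)
  then have "spray_vec G (x, y) = g"
    by (intro G.spray_unique[OF z]) simp
  then show "dderiv (spray_vec G (x, y)) \<sigma>\<^sub>1 x = spray_vec K (K.T (x, y)) + (1/2) *\<^sub>R dderiv y (dderiv y \<sigma>\<^sub>1) x"
    and "dderiv (spray_vec G (x, y)) \<sigma>\<^sub>2 x = spray_vec H (H.T (x, y)) + (1/2) *\<^sub>R dderiv y (dderiv y \<sigma>\<^sub>2) x"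
    using g1 g2 by simp_all
qed

text \<open>The function to be differentiated three times is \<open>f\<^sub>1 \<phi>\<^sub>1 \<circ> D\<sigma>\<^sub>1 + f\<^sub>2 \<phi>\<^sub>2 \<circ> D\<sigma>\<^sub>2\<close> up to a quadratic form. To
  isolate the summand of one factor, choose the first direction in the kernel of the other
  differential and divide by \<open>f\<^sub>1\<close> or \<open>f\<^sub>2\<close>.\<close>

lemma landsberg_product_iff:
  assumes z: "(x, y) \<in> W"
  shows "(\<forall>\<beta> \<gamma> \<eta>. landsberg_curvature G \<beta> \<gamma> \<eta> (x, y) = 0) \<longleftrightarrow>
    (\<forall>\<beta> \<gamma> \<eta>. landsberg_curvature K \<beta> \<gamma> \<eta> (tangent_map \<sigma>\<^sub>1 (x, y)) = 0) \<and>
    (\<forall>\<beta> \<gamma> \<eta>. landsberg_curvature H \<beta> \<gamma> \<eta> (tangent_map \<sigma>\<^sub>2 (x, y)) = 0)"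
proof -
  let ?z = "(x, y)" and ?S = "{y'. (x, y') \<in> W}"
  let ?A = "\<lambda>w. dderiv w \<sigma>\<^sub>1 x" and ?B = "\<lambda>w. dderiv w \<sigma>\<^sub>2 x"
  let ?f1 = "dderiv (1, 0) f (P ?z)" and ?f2 = "dderiv (0, 1) f (P ?z)"
  let ?g = "\<lambda>y'. spray_vec G (x, y')"
  let ?k = "\<lambda>y'. dderiv (0, spray_vec K (\<sigma>\<^sub>1 x, y')) K (\<sigma>\<^sub>1 x, ?A y)"
  let ?h = "\<lambda>y'. dderiv (0, spray_vec H (\<sigma>\<^sub>2 x, y')) H (\<sigma>\<^sub>2 x, ?B y)"
  have zK: "?z \<in> K.dom_pullback" and zH: "?z \<in> H.dom_pullback" using z by auto
  then have x: "x \<in> V" and TK: "(\<sigma>\<^sub>1 x, ?A y) \<in> W\<^sub>1" and TH: "(\<sigma>\<^sub>2 x, ?B y) \<in> W\<^sub>2"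
    by (auto simp: K.dom_pullback_def H.dom_pullback_def tangent_map_def)
  have S: "open ?S" "y \<in> ?S" using open_slice[OF open_dom] z by auto
  have nz: "?f1 \<noteq> 0" "?f2 \<noteq> 0"
  proof -
    have "K.pullback ?z > 0" "H.pullback ?z > 0" using P_in_Q[OF z] by auto
    then show "?f1 \<noteq> 0" "?f2 \<noteq> 0" using pf unfolding product_function_def by blast+
  qed
  have gK: "dderiv (?g y') \<sigma>\<^sub>1 x = spray_vec K (K.T (x, y')) + (1/2) *\<^sub>R dderiv y' (dderiv y' \<sigma>\<^sub>1) x"
    and gH: "dderiv (?g y') \<sigma>\<^sub>2 x = spray_vec H (H.T (x, y')) + (1/2) *\<^sub>R dderiv y' (dderiv y' \<sigma>\<^sub>2) x"
    and domK: "(x, y') \<in> K.dom_pullback" and domH: "(x, y') \<in> H.dom_pullback"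
    if "y' \<in> ?S" for y'
  proof -
    have "(x, y') \<in> W" using that by blast
    then show "dderiv (?g y') \<sigma>\<^sub>1 x = spray_vec K (K.T (x, y')) + (1/2) *\<^sub>R dderiv y' (dderiv y' \<sigma>\<^sub>1) x"
      "dderiv (?g y') \<sigma>\<^sub>2 x = spray_vec H (H.T (x, y')) + (1/2) *\<^sub>R dderiv y' (dderiv y' \<sigma>\<^sub>2) x"
      "(x, y') \<in> K.dom_pullback" "(x, y') \<in> H.dom_pullback"
      by (rule spray_vec_product(1), rule spray_vec_product(2), rule IntD1, rule IntD2)
  qed
  note K = K.spray_term[where S = ?S and g = ?g and x = x and y = y, OF zK gK S domK]
  note H = H.spray_term[where S = ?S and g = ?g and x = x and y = y, OF zH gH S domH]
  let ?kA = "\<lambda>y'. dderiv (0, ?A (?g y')) K (K.T ?z)"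
  let ?hB = "\<lambda>y'. dderiv (0, ?B (?g y')) H (H.T ?z)"
  have q: "dderiv (a, b) f (P ?z) = ?f1 * a + ?f2 * b" for a b
    by (subst dderiv_quadrant[OF differentiable_f[OF z], of a b]) (simp only: mult.commute)
  have \<phi>: "dderiv (0, ?g y') G ?z = ?f1 * ?kA y' + ?f2 * ?hB y'" for y'
    unfolding dderiv_G[OF z] K.dderiv_vertical_pullback[OF zK] H.dderiv_vertical_pullback[OF zH]
    by (rule q)
  have D: "dderiv3 u v w (\<lambda>y'. dderiv (0, ?g y') G ?z) y =
      ?f1 * dderiv3 (?A u) (?A v) (?A w) ?k (?A y) + ?f2 * dderiv3 (?B u) (?B v) (?B w) ?h (?B y)" for u v w
  proof -
    have "dderiv3 u v w (\<lambda>y'. dderiv (0, ?g y') G ?z) y =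
        dderiv3 u v w (\<lambda>y'. ?f1 * ?kA y') y + dderiv3 u v w (\<lambda>y'. ?f2 * ?hB y') y"
      unfolding \<phi> by (rule dderiv3_add[where S = ?S]; intro S smooth_on_mult smooth_on_const K(2) H(2))
    also have "dderiv3 u v w (\<lambda>y'. ?f1 * ?kA y') y = ?f1 * dderiv3 u v w ?kA y"
      by (rule dderiv3_cmult[OF S(1) K(2) S(2)])
    also have "dderiv3 u v w (\<lambda>y'. ?f2 * ?hB y') y = ?f2 * dderiv3 u v w ?hB y"
      by (rule dderiv3_cmult[OF S(1) H(2) S(2)])
    also have "dderiv3 u v w ?kA y = dderiv3 (?A u) (?A v) (?A w) ?k (?A y)" by (rule K(1))
    also have "dderiv3 u v w ?hB y = dderiv3 (?B u) (?B v) (?B w) ?h (?B y)" by (rule H(1))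
    finally show ?thesis .
  qed
  have k0: "dderiv3 0 v w ?k (?A y) = 0" for v w
    by (rule dderiv3_zero_dir[OF open_slice[OF K.open_W] K.smooth_spray_slice[OF TK]]) (use TK in simp)
  have h0: "dderiv3 0 v w ?h (?B y) = 0" for v w
    by (rule dderiv3_zero_dir[OF open_slice[OF H.open_W] H.smooth_spray_slice[OF TH]]) (use TH in simp)
  have "(\<forall>u v w. dderiv3 u v w (\<lambda>y'. dderiv (0, ?g y') G ?z) y = 0) \<longleftrightarrow>
    (\<forall>u v w. dderiv3 u v w ?k (?A y) = 0) \<and> (\<forall>u v w. dderiv3 u v w ?h (?B y) = 0)"
  proof (intro iffI conjI allI)
    assume 0: "\<forall>u v w. dderiv3 u v w (\<lambda>y'. dderiv (0, ?g y') G ?z) y = 0"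
    show "dderiv3 u v w ?k (?A y) = 0" for u v w
    proof -
      obtain u' v' w' where u': "?A u' = u" "?B u' = 0" and v': "?A v' = v" and w': "?A w' = w"
        using onto[OF x] by metis
      show ?thesis using 0[rule_format, of u' v' w'] nz unfolding D u' v' w' h0 by simp
    qed
    show "dderiv3 u v w ?h (?B y) = 0" for u v w
    proof -
      obtain u' v' w' where u': "?B u' = u" "?A u' = 0" and v': "?B v' = v" and w': "?B w' = w"
        using onto[OF x] by metis
      show ?thesis using 0[rule_format, of u' v' w'] nz unfolding D u' v' w' k0 by simp
    qed
  qed (simp add: D)
  then show ?thesis
    unfolding G.landsberg_curvature_zero_iff[OF z] tangent_map_def fst_conv snd_conv
      K.landsberg_curvature_zero_iff[OF TK] H.landsberg_curvature_zero_iff[OF TH] .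
qed

end

section \<open>Charts and tangent vectors\<close>

lemma charts_openin: "c \<in> charts X \<Longrightarrow> openin X (fst c)"
  and charts_open_image: "c \<in> charts X \<Longrightarrow> open (snd c ` fst c)"
  and charts_homeomorphic:
    "c \<in> charts X \<Longrightarrow> homeomorphic_map (subtopology X (fst c)) (top_of_set (snd c ` fst c)) (snd c)"
  by (auto simp: charts_def)

lemma charts_inj:
  assumes "c \<in> charts X" shows "inj_on (snd c) (fst c)"
proof -
  have "topspace (subtopology X (fst c)) = fst c"
    using openin_subset[OF charts_openin[OF assms]] by auto
  then show ?thesis
    using homeomorphic_imp_injective_map[OF charts_homeomorphic[OF assms]] by simp
qed

lemma chart_inv_chart: "c \<in> charts X \<Longrightarrow> p \<in> fst c \<Longrightarrow> chart_inv c (snd c p) = p"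
  unfolding chart_inv_def by (rule inv_into_f_f[OF charts_inj])

lemma charts_open_image_Int:
  assumes c: "c \<in> charts X" and U: "openin X U"
  shows "open (snd c ` (fst c \<inter> U))"
proof -
  have "openin (subtopology X (fst c)) (fst c \<inter> U)"
    using U by (auto simp: openin_subtopology Int_commute)
  then have "openin (top_of_set (snd c ` fst c)) (snd c ` (fst c \<inter> U))"
    using homeomorphic_imp_open_map[OF charts_homeomorphic[OF c]] by (simp add: open_map_def)
  then show ?thesis
    using charts_open_image[OF c] openin_open_trans by blast
qed

lemma transition_chart: "c \<in> charts X \<Longrightarrow> p \<in> fst c \<Longrightarrow> transition c d (snd c p) = snd d p"
  by (simp add: transition_def chart_inv_chart)

lemma compatible_sym: "compatible c d \<Longrightarrow> compatible d c"
  by (auto simp: compatible_def Int_commute)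

lemma compatible_differentiable:
  assumes "compatible c d" "p \<in> fst c" "p \<in> fst d"
  shows "transition c d differentiable (at (snd c p))"
  using assms smooth_on_imp_differentiable[of "transition c d" "snd c ` (fst c \<inter> fst d)" "snd c p"]
  by (auto simp: compatible_def)

text \<open>The chain rule at a point of a chart, for maps whose composition is known only near that point.\<close>

lemma dderiv_chart_change:
  assumes c: "c \<in> charts X" "p \<in> fst c" and U: "openin X U" "p \<in> U"
    and k: "k differentiable (at (snd c p))" and l: "l differentiable (at (k (snd c p)))"
    and eq: "\<And>q. q \<in> fst c \<Longrightarrow> q \<in> U \<Longrightarrow> l (k (snd c q)) = j (snd c q)"
  shows "dderiv (dderiv v k (snd c p)) l (k (snd c p)) = dderiv v j (snd c p)"
    and "j differentiable (at (snd c p))"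
proof -
  let ?S = "snd c ` (fst c \<inter> U)"
  have S: "open ?S" "snd c p \<in> ?S" using charts_open_image_Int[OF c(1) U(1)] c U by auto
  have e: "l (k x) = j x" if "x \<in> ?S" for x using that eq by auto
  have "dderiv (dderiv v k (snd c p)) l (k (snd c p)) = dderiv v (\<lambda>x. l (k x)) (snd c p)"
    by (rule dderiv_compose[OF k l, symmetric])
  also have "\<dots> = dderiv v j (snd c p)"
    by (rule dderiv_cong_open[OF S e])
  finally show "dderiv (dderiv v k (snd c p)) l (k (snd c p)) = dderiv v j (snd c p)" .
  show "j differentiable (at (snd c p))"
    using differentiable_compose_at[OF k l] differentiable_cong_open[where f = "\<lambda>x. l (k x)" and g = j, OF S e] by simp
qed

lemma transition_inverse:
  assumes c: "c \<in> charts X" "d \<in> charts X" "p \<in> fst c" "p \<in> fst d"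
    and cd: "transition c d differentiable (at (snd c p))" "transition d c differentiable (at (snd d p))"
  shows "dderiv (dderiv v (transition c d) (snd c p)) (transition d c) (snd d p) = v"
proof -
  have "dderiv (dderiv v (transition c d) (snd c p)) (transition d c) (transition c d (snd c p)) =
      dderiv v (\<lambda>x. x) (snd c p)"
    by (rule dderiv_chart_change[OF c(1,3) charts_openin[OF c(2)] c(4) cd(1)])
       (use cd c in \<open>simp_all add: transition_chart\<close>)
  then show ?thesis by (simp add: transition_chart[OF c(1,3)] dderiv_bounded_linear[OF bounded_linear_ident])
qed

lemma transition_self:
  assumes "c \<in> charts X" "p \<in> fst c"
  shows "dderiv v (transition c c) (snd c p) = v"
    and "transition c c differentiable (at (snd c p))"
  using dderiv_chart_change(1)[where k = "\<lambda>x. x" and l = "\<lambda>x. x" and j = "transition c c" and v = v,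
      OF assms charts_openin[OF assms(1)] assms(2)]
    dderiv_chart_change(2)[where k = "\<lambda>x. x" and l = "\<lambda>x. x" and j = "transition c c",
      OF assms charts_openin[OF assms(1)] assms(2)] transition_chart[OF assms(1)]
  by (simp_all add: dderiv_bounded_linear[OF bounded_linear_ident])

text \<open>Components of one tangent vector in two charts are related by an invertible linear map, so being
  nonzero does not depend on the chart.\<close>

lemma tangent_in_slit_iff:
  assumes A: "A \<subseteq> charts X" and comp: "\<And>a b. a \<in> A \<Longrightarrow> b \<in> A \<Longrightarrow> compatible a b"
    and a: "a \<in> A" "p \<in> fst a"
  shows "tangent A a p v \<in> slit_tangent_bundle A \<longleftrightarrow> v \<noteq> 0"
proof
  assume "tangent A a p v \<in> slit_tangent_bundle A"
  then obtain a' v' where eq: "tangent A a p v = tangent A a' p v'" and a': "a' \<in> A" "p \<in> fst a'" "v' \<noteq> 0"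
    unfolding slit_tangent_bundle_def by (auto simp: tangent_def)
  have ac: "a \<in> charts X" "a' \<in> charts X" using A a a' by auto
  have "(a, v) \<in> snd (tangent A a p v)"
    using a transition_self[OF ac(1) a(2)] by (simp add: tangent_def)
  then have v: "v = dderiv v' (transition a' a) (snd a' p)"
    unfolding eq by (simp add: tangent_def)
  have "dderiv v (transition a a') (snd a p) = v'"
    unfolding v by (rule transition_inverse[OF ac(2,1) a'(2) a(2)])
      (rule compatible_differentiable[OF comp] a a')+
  moreover have "transition a a' differentiable (at (snd a p))"
    by (rule compatible_differentiable[OF comp]) (rule a a')+
  ultimately show "v \<noteq> 0" using dderiv_zero_dir a'(3) by blast
next
  assume "v \<noteq> 0"
  then show "tangent A a p v \<in> slit_tangent_bundle A"
    using a unfolding slit_tangent_bundle_def by blast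
qed

text \<open>The components of the image of a tangent vector may be computed in any pair of charts. The
  differential is defined as a union over all charts of the source, so the result has to be
  independent of the chart \<open>d\<close> there and to transform correctly with the chart \<open>a'\<close> of the target.\<close>

lemma differential_tangent:
  fixes C :: "('a, 'n::finite) chart set" and A :: "('b, 'k::finite) chart set" and h :: "'a \<Rightarrow> 'b"
  assumes C: "C \<subseteq> charts X" "c \<in> C" "p \<in> fst c" and A: "A \<subseteq> charts Y" "a \<in> A" "h p \<in> fst a"
    and h: "continuous_map X Y h"
    and dc: "\<And>d. d \<in> C \<Longrightarrow> p \<in> fst d \<Longrightarrow> transition c d differentiable (at (snd c p))"
    and da: "\<And>a'. a' \<in> A \<Longrightarrow> h p \<in> fst a' \<Longrightarrow> transition a a' differentiable (at (snd a (h p)))"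
    and dh: "\<And>d a'. d \<in> C \<Longrightarrow> p \<in> fst d \<Longrightarrow> a' \<in> A \<Longrightarrow> h p \<in> fst a' \<Longrightarrow>
      (snd a' \<circ> h \<circ> chart_inv d) differentiable (at (snd d p))"
  shows "differential A h (tangent C c p v) =
    tangent A a (h p) (dderiv v (snd a \<circ> h \<circ> chart_inv c) (snd c p))"
proof -
  let ?j = "\<lambda>d. snd d \<circ> h \<circ> chart_inv c"
  have cC: "c \<in> charts X" using C by auto
  have aA: "a \<in> charts Y" using A by auto
  have 1: "dderiv (dderiv v (transition c d) (snd c p)) (snd a' \<circ> h \<circ> chart_inv d) (snd d p) = dderiv v (?j a') (snd c p)"
    if "d \<in> C" "p \<in> fst d" "a' \<in> A" "h p \<in> fst a'" for d a'
  proof -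
    have dX: "d \<in> charts X" using that C by auto
    have "dderiv (dderiv v (transition c d) (snd c p)) (snd a' \<circ> h \<circ> chart_inv d) (transition c d (snd c p)) =
        dderiv v (?j a') (snd c p)"
      by (rule dderiv_chart_change(1)[OF cC C(3) charts_openin[OF dX] that(2) dc[OF that(1,2)]])
         (use dh[OF that] in \<open>simp_all add: transition_chart[OF cC] C(3) chart_inv_chart[OF cC] chart_inv_chart[OF dX]\<close>)
    then show ?thesis by (simp add: transition_chart[OF cC C(3)])
  qed
  have 2: "dderiv (dderiv v (?j a) (snd c p)) (transition a a') (snd a (h p)) = dderiv v (?j a') (snd c p)"
    if "a' \<in> A" "h p \<in> fst a'" for a'
  proof -
    let ?U = "{q \<in> topspace X. h q \<in> fst a}"
    have U: "openin X ?U" "p \<in> ?U"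
      using openin_continuous_map_preimage[OF h charts_openin[OF aA]] A(3) C(3)
        openin_subset[OF charts_openin[OF cC]] by auto
    have "dderiv (dderiv v (?j a) (snd c p)) (transition a a') (?j a (snd c p)) = dderiv v (?j a') (snd c p)"
      by (rule dderiv_chart_change(1)[OF cC C(3) U dh[OF C(2,3) A(2,3)]])
         (use da[OF that] in \<open>simp_all add: chart_inv_chart[OF cC] C(3) transition_chart[OF aA]\<close>)
    then show ?thesis by (simp add: chart_inv_chart[OF cC C(3)])
  qed
  have E: "(\<exists>(d, u)\<in>snd (tangent C c p v). w = dderiv u (snd a' \<circ> h \<circ> chart_inv d) (snd d p)) \<longleftrightarrow>
      w = dderiv (dderiv v (?j a) (snd c p)) (transition a a') (snd a (h p))"
    if a': "a' \<in> A" "h p \<in> fst a'" for w a'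
  proof -
    let ?w = "dderiv v (?j a') (snd c p)"
    have in_T: "(c, dderiv v (transition c c) (snd c p)) \<in> snd (tangent C c p v)"
      using C by (simp add: tangent_def)
    have eq: "dderiv u (snd a' \<circ> h \<circ> chart_inv d) (snd d p) = ?w"
      if "(d, u) \<in> snd (tangent C c p v)" for d u
      using that 1[OF _ _ a'] by (auto simp: tangent_def)
    show ?thesis
      unfolding 2[OF a']
    proof
      assume "w = ?w"
      then show "\<exists>(d, u)\<in>snd (tangent C c p v). w = dderiv u (snd a' \<circ> h \<circ> chart_inv d) (snd d p)"
        using eq[OF in_T] by (intro bexI[OF _ in_T]) simp
    qed (use eq in auto)
  qed
  have "d \<in> A \<and> h p \<in> fst d \<and>
        (\<exists>(c', u)\<in>snd (tangent C c p v). w = dderiv u (snd d \<circ> h \<circ> chart_inv c') (snd c' p)) \<longleftrightarrow>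
      d \<in> A \<and> h p \<in> fst d \<and> w = dderiv (dderiv v (?j a) (snd c p)) (transition a d) (snd a (h p))" for d w
    using E by (intro conj_cong refl)
  moreover have "fst (tangent C c p v) = p" by (simp add: tangent_def)
  ultimately show ?thesis
    unfolding differential_def tangent_def[of A] by (simp only:)
qed

section \<open>Product charts\<close>

definition vec_join :: "(real ^ 'm::finite) \<times> (real ^ 'n::finite) \<Rightarrow> real ^ ('m + 'n)"
  where "vec_join u = (\<chi> k. case k of Inl i \<Rightarrow> fst u $ i | Inr j \<Rightarrow> snd u $ j)"

definition vec_split :: "real ^ ('m + 'n) \<Rightarrow> (real ^ 'm::finite) \<times> (real ^ 'n::finite)"
  where "vec_split w = (\<chi> i. w $ Inl i, \<chi> j. w $ Inr j)"

lemma vec_split_join [simp]: "vec_split (vec_join u) = u"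
  by (simp add: vec_split_def vec_join_def vec_eq_iff prod_eq_iff)

lemma vec_join_split [simp]: "vec_join (vec_split w) = w"
  by (simp add: vec_split_def vec_join_def vec_eq_iff split: sum.split)

lemma bounded_linear_vec_join: "bounded_linear vec_join"
proof -
  have "linear (vec_join :: (real ^ 'm::finite) \<times> (real ^ 'n::finite) \<Rightarrow> _)"
    by (rule linearI) (simp_all add: vec_join_def vec_eq_iff split: sum.split)
  then show ?thesis by (simp add: linear_conv_bounded_linear)
qed

lemma bounded_linear_vec_split: "bounded_linear vec_split"
proof -
  have "linear (vec_split :: real ^ ('m::finite + 'n::finite) \<Rightarrow> _)"
    by (rule linearI) (simp_all add: vec_split_def vec_eq_iff)
  then show ?thesis by (simp add: linear_conv_bounded_linear)
qed

lemma fst_product_chart [simp]: "fst (product_chart a b) = fst a \<times> fst b"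
  by (simp add: product_chart_def)

lemma snd_product_chart [simp]: "snd (product_chart a b) p = vec_join (snd a (fst p), snd b (snd p))"
  by (cases p) (simp only: product_chart_def vec_join_def snd_conv fst_conv case_prod_conv)

lemma vec_join_image: "vec_join ` S = vec_split -` S"
  by (auto intro: image_eqI[where x = "vec_split _"])

lemma product_chart_image:
  assumes "U \<subseteq> fst a" "V \<subseteq> fst b"
  shows "snd (product_chart a b) ` (U \<times> V) = vec_split -` (snd a ` U \<times> snd b ` V)"
proof -
  have "snd (product_chart a b) ` (U \<times> V) = vec_join ` (snd a ` U \<times> snd b ` V)"
    by force
  then show ?thesis by (simp add: vec_join_image)
qed

lemma open_vec_split_vimage: "open S \<Longrightarrow> open (vec_split -` S)"
  by (rule open_vimage) (simp_all add: linear_continuous_on bounded_linear_vec_split)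

lemma product_chart_in_charts:
  assumes a: "a \<in> charts X" and b: "b \<in> charts Y"
  shows "product_chart a b \<in> charts (prod_topology X Y)"
proof -
  let ?U = "fst a" and ?V = "fst b"
  let ?S = "snd a ` ?U \<times> snd b ` ?V"
  let ?c = "product_chart a b"
  obtain a' where a': "homeomorphic_maps (subtopology X ?U) (top_of_set (snd a ` ?U)) (snd a) a'"
    using charts_homeomorphic[OF a] homeomorphic_map_maps by blast
  obtain b' where b': "homeomorphic_maps (subtopology Y ?V) (top_of_set (snd b ` ?V)) (snd b) b'"
    using charts_homeomorphic[OF b] homeomorphic_map_maps by blast
  have "homeomorphic_maps (prod_topology (subtopology X ?U) (subtopology Y ?V))
      (prod_topology (top_of_set (snd a ` ?U)) (top_of_set (snd b ` ?V)))
      (\<lambda>(x, y). (snd a x, snd b y)) (\<lambda>(x, y). (a' x, b' y))"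
    unfolding homeomorphic_maps_prod using a' b' by blast
  then have 1: "homeomorphic_map (subtopology (prod_topology X Y) (?U \<times> ?V)) (top_of_set ?S)
      (\<lambda>(x, y). (snd a x, snd b y))"
    using homeomorphic_map_maps by (fastforce simp: subtopology_Times)
  have "homeomorphic_maps (top_of_set ?S) (top_of_set (vec_join ` ?S)) vec_join vec_split"
    by (auto simp: homeomorphic_maps_def linear_continuous_on bounded_linear_vec_join bounded_linear_vec_split)
  then have 2: "homeomorphic_map (top_of_set ?S) (top_of_set (vec_join ` ?S)) vec_join"
    using homeomorphic_map_maps by blast
  have eq: "vec_join \<circ> (\<lambda>(x, y). (snd a x, snd b y)) = snd ?c"
    by auto
  have im: "snd ?c ` fst ?c = vec_join ` ?S"
    using product_chart_image[of ?U a ?V b] by (simp add: vec_join_image)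
  have "homeomorphic_map (subtopology (prod_topology X Y) (fst ?c)) (top_of_set (snd ?c ` fst ?c)) (snd ?c)"
    using homeomorphic_map_compose[OF 1 2] unfolding eq im by simp
  moreover have "open (snd ?c ` fst ?c)"
    unfolding im vec_join_image
    by (intro open_vec_split_vimage open_Times charts_open_image[OF a] charts_open_image[OF b])
  moreover have "openin (prod_topology X Y) (fst ?c)"
    using charts_openin[OF a] charts_openin[OF b] by (simp add: openin_prod_Times_iff)
  ultimately show ?thesis by (cases ?c) (auto simp: charts_def)
qed

lemma smooth_transition_product:
  assumes a: "a \<in> charts X" "a' \<in> charts X" and b: "b \<in> charts Y" "b' \<in> charts Y"
    and comp: "compatible a a'" "compatible b b'"
  shows "smooth_on (transition (product_chart a b) (product_chart a' b'))
    (snd (product_chart a b) ` (fst (product_chart a b) \<inter> fst (product_chart a' b')))"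
proof -
  let ?P = "product_chart a b" and ?P' = "product_chart a' b'"
  let ?U = "snd a ` (fst a \<inter> fst a')" and ?V = "snd b ` (fst b \<inter> fst b')"
  let ?S = "vec_split -` (?U \<times> ?V)"
  have S: "snd ?P ` (fst ?P \<inter> fst ?P') = ?S"
    using product_chart_image[of "fst a \<inter> fst a'" a "fst b \<inter> fst b'" b] by (simp add: Times_Int_Times)
  have oU: "open ?U" "open ?V" using charts_open_image_Int a b charts_openin by blast+
  have o: "open ?S" by (intro open_vec_split_vimage open_Times oU)
  have sm: "smooth_on (transition a a') ?U" "smooth_on (transition b b') ?V"
    using comp by (auto simp: compatible_def)
  have l: "smooth_on (\<lambda>w. fst (vec_split w)) ?S" "smooth_on (\<lambda>w. snd (vec_split w)) ?S"
    by (intro smooth_on_linear bounded_linear_compose[OF bounded_linear_fst bounded_linear_vec_split]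
        bounded_linear_compose[OF bounded_linear_snd bounded_linear_vec_split])+
  have "smooth_on (\<lambda>w. transition a a' (fst (vec_split w))) ?S"
    by (rule smooth_on_compose[OF o _ l(1) sm(1)]) auto
  moreover have "smooth_on (\<lambda>w. transition b b' (snd (vec_split w))) ?S"
    by (rule smooth_on_compose[OF o _ l(2) sm(2)]) auto
  ultimately have "smooth_on (\<lambda>w. vec_join (transition a a' (fst (vec_split w)), transition b b' (snd (vec_split w)))) ?S"
    by (intro smooth_on_linear_comp[OF bounded_linear_vec_join o] smooth_on_Pair o)
  then show ?thesis
    unfolding S
  proof (rule smooth_on_cong[OF o, THEN iffD2, rotated])
    fix w assume "w \<in> ?S"
    then obtain p q where p: "p \<in> fst a" "p \<in> fst a'" and q: "q \<in> fst b" "q \<in> fst b'"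
      and w: "vec_split w = (snd a p, snd b q)" by auto
    have w': "w = snd ?P (p, q)" unfolding snd_product_chart fst_conv snd_conv w[symmetric] by simp
    have "transition ?P ?P' w = snd ?P' (p, q)"
      unfolding w' by (rule transition_chart[OF product_chart_in_charts[OF a(1) b(1)]]) (use p q in simp)
    then show "transition ?P ?P' w =
        vec_join (transition a a' (fst (vec_split w)), transition b b' (snd (vec_split w)))"
      by (simp add: w transition_chart[OF a(1) p(1)] transition_chart[OF b(1) q(1)])
  qed
qed

section \<open>The product manifold\<close>

text \<open>The coordinate expressions of the two projections of the product, used as the maps \<open>\<sigma>\<^sub>1\<close> and \<open>\<sigma>\<^sub>2\<close>
  of a Minkowskian pullback.\<close>

definition left_coords :: "('a \<times> 'b, 'k::finite) chart \<Rightarrow> ('a, 'm::finite) chart \<Rightarrow> real ^ 'k \<Rightarrow> real ^ 'm"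
  where "left_coords c a = snd a \<circ> fst \<circ> chart_inv c"

definition right_coords :: "('a \<times> 'b, 'k::finite) chart \<Rightarrow> ('b, 'n::finite) chart \<Rightarrow> real ^ 'k \<Rightarrow> real ^ 'n"
  where "right_coords c b = snd b \<circ> snd \<circ> chart_inv c"

definition common_dom :: "('a \<times> 'b, 'k::finite) chart \<Rightarrow> ('a, 'm::finite) chart \<Rightarrow> ('b, 'n::finite) chart \<Rightarrow> (real ^ 'k) set"
  where "common_dom c a b = snd c ` (fst c \<inter> (fst a \<times> fst b))"

locale manifold_pair =
  fixes X :: "'a topology" and A :: "('a, 'm::finite) chart set"
    and Y :: "'b topology" and B :: "('b, 'n::finite) chart set"
  assumes X: "smooth_manifold X A" and Y: "smooth_manifold Y B"
begin

abbreviation "C \<equiv> product_structure X A Y B"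

lemma A_charts: "a \<in> A \<Longrightarrow> a \<in> charts X" and B_charts: "b \<in> B \<Longrightarrow> b \<in> charts Y"
  and A_compatible: "a \<in> A \<Longrightarrow> a' \<in> A \<Longrightarrow> compatible a a'"
  and B_compatible: "b \<in> B \<Longrightarrow> b' \<in> B \<Longrightarrow> compatible b b'"
  using X Y by (auto simp: smooth_manifold_def)

lemma A_cover: "p \<in> topspace X \<Longrightarrow> \<exists>a\<in>A. p \<in> fst a"
  and B_cover: "q \<in> topspace Y \<Longrightarrow> \<exists>b\<in>B. q \<in> fst b"
  using X Y unfolding smooth_manifold_def by blast+

lemma compatible_product_charts:
  assumes "a \<in> A" "a' \<in> A" "b \<in> B" "b' \<in> B"
  shows "compatible (product_chart a b) (product_chart a' b')"
proof -
  have "smooth_on (transition (product_chart a b) (product_chart a' b'))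
      (snd (product_chart a b) ` (fst (product_chart a b) \<inter> fst (product_chart a' b')))"
    if "a \<in> A" "a' \<in> A" "b \<in> B" "b' \<in> B" for a a' b b'
    by (rule smooth_transition_product[OF A_charts A_charts B_charts B_charts A_compatible B_compatible])
      (rule that)+
  from this[OF assms] this[OF assms(2,1,4,3)] show ?thesis
    unfolding compatible_def by (simp only: Int_commute)
qed

lemma product_chart_in_structure:
  assumes "a \<in> A" "b \<in> B"
  shows "product_chart a b \<in> C"
  using assms product_chart_in_charts[OF A_charts B_charts] compatible_product_charts
  by (simp add: product_structure_def)

lemma C_charts: "c \<in> C \<Longrightarrow> c \<in> charts (prod_topology X Y)"
  and C_compatible: "c \<in> C \<Longrightarrow> a \<in> A \<Longrightarrow> b \<in> B \<Longrightarrow> compatible c (product_chart a b)"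
  by (auto simp: product_structure_def)

lemma C_subset_charts: "C \<subseteq> charts (prod_topology X Y)"
  by (auto simp: product_structure_def)

lemma C_cover:
  assumes "c \<in> C" "p \<in> fst c"
  obtains a b where "a \<in> A" "fst p \<in> fst a" "b \<in> B" "snd p \<in> fst b"
proof -
  have "p \<in> topspace (prod_topology X Y)"
    using openin_subset[OF charts_openin[OF C_charts[OF assms(1)]]] assms(2) by auto
  then have "fst p \<in> topspace X" "snd p \<in> topspace Y" by auto
  from A_cover[OF this(1)] B_cover[OF this(2)] show thesis using that by blast
qed

context
  fixes c a b
  assumes c: "c \<in> C" and a: "a \<in> A" and b: "b \<in> B"
begin

abbreviation "V \<equiv> common_dom c a b"
abbreviation "to_left \<equiv> left_coords c a"
abbreviation "to_right \<equiv> right_coords c b"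

lemma open_dom: "open V"
  using charts_open_image_Int[OF C_charts[OF c]
      charts_openin[OF C_charts[OF product_chart_in_structure[OF a b]]]]
  by (simp add: common_dom_def)

lemma transition_to_product:
  assumes "x \<in> V"
  shows "transition c (product_chart a b) x = vec_join (to_left x, to_right x)"
  using assms by (simp add: transition_def left_coords_def right_coords_def)

lemma to_left_right:
  assumes "x \<in> V"
  shows "fst (vec_split (transition c (product_chart a b) x)) = to_left x"
    and "snd (vec_split (transition c (product_chart a b) x)) = to_right x"
  unfolding transition_to_product[OF assms] by simp_all

lemma smooth_to_product: "smooth_on (transition c (product_chart a b)) V"
  using C_compatible[OF c a b] by (simp add: compatible_def common_dom_def)

lemma smooth_to_left: "smooth_on to_left V" and smooth_to_right: "smooth_on to_right V"
proof -
  note l = smooth_on_linear_comp[OF bounded_linear_compose[OF bounded_linear_fst bounded_linear_vec_split]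
      open_dom smooth_to_product]
  show "smooth_on to_left V"
    by (rule smooth_on_cong[OF open_dom, THEN iffD2, rotated, OF l]) (rule to_left_right(1)[symmetric])
  note r = smooth_on_linear_comp[OF bounded_linear_compose[OF bounded_linear_snd bounded_linear_vec_split]
      open_dom smooth_to_product]
  show "smooth_on to_right V"
    by (rule smooth_on_cong[OF open_dom, THEN iffD2, rotated, OF r]) (rule to_left_right(2)[symmetric])
qed

lemma dderiv_to_product:
  assumes x: "x \<in> V"
  shows "dderiv y (transition c (product_chart a b)) x = vec_join (dderiv y to_left x, dderiv y to_right x)"
proof -
  have d: "to_left differentiable (at x)" "to_right differentiable (at x)"
    using smooth_on_imp_differentiable smooth_to_left smooth_to_right x by blast+
  have "dderiv y (transition c (product_chart a b)) x = dderiv y (\<lambda>x. vec_join (to_left x, to_right x)) x"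
    by (rule dderiv_cong_open[OF open_dom x transition_to_product])
  also have "\<dots> = vec_join (dderiv y (\<lambda>x. (to_left x, to_right x)) x)"
    by (rule dderiv_linear_comp[OF bounded_linear_vec_join])
       (use has_derivative_Pair[OF dderiv_has_derivative[OF d(1)] dderiv_has_derivative[OF d(2)]]
         in \<open>auto simp: differentiable_def\<close>)
  finally show ?thesis unfolding dderiv_Pair[OF d] .
qed

text \<open>The two differentials are the blocks of the differential of the transition to the product chart, which
  is invertible.\<close>

lemma splitting_bijective:
  assumes x: "x \<in> V"
  shows "\<exists>y. dderiv y to_left x = u \<and> dderiv y to_right x = v"
    and "dderiv y to_left x = 0 \<Longrightarrow> dderiv y to_right x = 0 \<Longrightarrow> y = 0"
proof -
  let ?P = "product_chart a b"
  have ch: "c \<in> charts (prod_topology X Y)" "?P \<in> charts (prod_topology X Y)"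
    using C_charts c product_chart_in_structure[OF a b] by auto
  obtain p where p: "p \<in> fst c" "p \<in> fst ?P" "x = snd c p" using x by (auto simp: common_dom_def)
  have comp: "compatible c ?P" by (rule C_compatible[OF c a b])
  then have comp': "compatible ?P c" by (rule compatible_sym)
  note d = compatible_differentiable[OF comp p(1,2)] compatible_differentiable[OF comp' p(2,1)]
  let ?y = "dderiv (vec_join (u, v)) (transition ?P c) (snd ?P p)"
  have "dderiv ?y (transition c ?P) x = vec_join (u, v)"
    unfolding p(3) by (rule transition_inverse[OF ch(2,1) p(2,1) d(2,1)])
  then have "vec_split (vec_join (dderiv ?y to_left x, dderiv ?y to_right x)) = vec_split (vec_join (u, v))"
    unfolding dderiv_to_product[OF x] by simp
  then show "\<exists>y. dderiv y to_left x = u \<and> dderiv y to_right x = v"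
    unfolding vec_split_join by blast
  assume "dderiv y to_left x = 0" "dderiv y to_right x = 0"
  then have "dderiv y (transition c ?P) x = 0"
    unfolding dderiv_to_product[OF x] by (simp add: vec_join_def vec_eq_iff split: sum.split)
  then have "y = dderiv 0 (transition ?P c) (snd ?P p)"
    using transition_inverse[OF ch p(1,2) d, of y] p(3) by simp
  then show "y = 0" using dderiv_zero_dir[OF d(2)] by simp
qed

end

text \<open>Two members of the product structure are compatible with every product chart by definition; the
  transition between them factors through a product chart around the given point.\<close>

lemma C_transition_differentiable:
  assumes c: "c \<in> C" "p \<in> fst c" and d: "d \<in> C" "p \<in> fst d"
  shows "transition c d differentiable (at (snd c p))"
proof -
  obtain a b where ab: "a \<in> A" "fst p \<in> fst a" "b \<in> B" "snd p \<in> fst b" using C_cover[OF c] .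
  let ?P = "product_chart a b"
  have P: "?P \<in> charts (prod_topology X Y)" "p \<in> fst ?P"
    using C_charts product_chart_in_structure ab by (auto simp: mem_Times_iff)
  have cP: "transition c ?P differentiable (at (snd c p))"
    by (rule compatible_differentiable[OF C_compatible[OF c(1) ab(1,3)] c(2) P(2)])
  have Pd: "transition ?P d differentiable (at (transition c ?P (snd c p)))"
    using compatible_differentiable[OF compatible_sym[OF C_compatible[OF d(1) ab(1,3)]] P(2) d(2)]
    by (simp only: transition_chart[OF C_charts[OF c(1)] c(2)])
  show ?thesis
    by (rule dderiv_chart_change(2)[OF C_charts[OF c(1)] c(2) charts_openin[OF P(1)] P(2) cP Pd])
      (simp only: transition_chart[OF C_charts[OF c(1)]] transition_chart[OF P(1)])
qed

lemma in_dom: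
  assumes "p \<in> fst c" "fst p \<in> fst a" "snd p \<in> fst b"
  shows "snd c p \<in> common_dom c a b"
  using assms by (auto simp: common_dom_def mem_Times_iff)

lemma differential_projections:
  assumes c: "c \<in> C" "p \<in> fst c" and a: "a \<in> A" "fst p \<in> fst a" and b: "b \<in> B" "snd p \<in> fst b"
  shows "differential A fst (tangent C c p v) = tangent A a (fst p) (dderiv v (left_coords c a) (snd c p))"
    and "differential B snd (tangent C c p v) = tangent B b (snd p) (dderiv v (right_coords c b) (snd c p))"
proof -
  have l: "(snd a' \<circ> fst \<circ> chart_inv d) differentiable (at (snd d p))"
    if "d \<in> C" "p \<in> fst d" "a' \<in> A" "fst p \<in> fst a'" for d a'
    using smooth_on_imp_differentiable[OF smooth_to_left[OF that(1,3) b(1)] in_dom[OF that(2,4) b(2)]]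
    by (simp add: left_coords_def)
  have r: "(snd b' \<circ> snd \<circ> chart_inv d) differentiable (at (snd d p))"
    if "d \<in> C" "p \<in> fst d" "b' \<in> B" "snd p \<in> fst b'" for d b'
    using smooth_on_imp_differentiable[OF smooth_to_right[OF that(1) a(1) that(3)] in_dom[OF that(2) a(2) that(4)]]
    by (simp add: right_coords_def)
  show "differential A fst (tangent C c p v) = tangent A a (fst p) (dderiv v (left_coords c a) (snd c p))"
    unfolding left_coords_def
    by (rule differential_tangent[OF C_subset_charts c _ a continuous_map_fst])
       (use A_charts C_transition_differentiable[OF c] compatible_differentiable[OF A_compatible[OF a(1)] a(2)] l in auto)
  show "differential B snd (tangent C c p v) = tangent B b (snd p) (dderiv v (right_coords c b) (snd c p))"
    unfolding right_coords_def
    by (rule differential_tangent[OF C_subset_charts c _ b continuous_map_snd])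
       (use B_charts C_transition_differentiable[OF c] compatible_differentiable[OF B_compatible[OF b(1)] b(2)] r in auto)
qed

text \<open>Regularity of a vector, in terms of the data that \<open>minkowskian_pullback\<close> works with.\<close>

lemma product_regular_iff:
  assumes c: "c \<in> C" "p \<in> fst c" and a: "a \<in> A" "fst p \<in> fst a" and b: "b \<in> B" "snd p \<in> fst b"
  shows "tangent C c p v \<in> product_regular_vectors X A Y B \<longleftrightarrow>
    dderiv v (left_coords c a) (snd c p) \<noteq> 0 \<and> dderiv v (right_coords c b) (snd c p) \<noteq> 0"
proof -
  have "tangent C c p v \<in> tangent_bundle C" using c unfolding tangent_bundle_def by blast
  moreover have "A \<subseteq> charts X" "B \<subseteq> charts Y" using A_charts B_charts by auto
  ultimately show ?thesis
    unfolding product_regular_vectors_def mem_Collect_eq differential_projections[OF assms]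
    using tangent_in_slit_iff[OF _ A_compatible a] tangent_in_slit_iff[OF _ B_compatible b] by blast
qed

end

section \<open>Finsler metrics as regular Lagrangians\<close>

lemma finsler_regular_lagrangian:
  fixes F :: "('a, 'n::finite) tvec \<Rightarrow> real"
  assumes M: "finsler_manifold X A F" and c: "c \<in> A"
  shows "regular_lagrangian (energy A F c) ((snd c ` fst c) \<times> (UNIV - {0}))"
    and "z \<in> (snd c ` fst c) \<times> (UNIV - {0}) \<Longrightarrow> energy A F c z > 0"
proof -
  let ?E = "energy A F c" and ?W = "(snd c ` fst c) \<times> (UNIV - {0 :: real ^ 'n})"
  have ch: "c \<in> charts X" using M c by (auto simp: finsler_manifold_def smooth_manifold_def)
  have F: "finsler_metric A F" using M by (simp add: finsler_manifold_def)
  have E: "?E (snd c p, y) = (F (tangent A c p y))\<^sup>2" if "p \<in> fst c" for p y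
    by (simp add: energy_def chart_inv_chart[OF ch that])
  have hom: "F (tangent A c p (l *\<^sub>R v)) = \<bar>l\<bar> * F (tangent A c p v)" if "p \<in> fst c" for p l v
    using F c that by (simp add: finsler_metric_def)
  have pd: "w \<bullet> (hess ?E z *v w) > 0" if "z \<in> ?W" "w \<noteq> 0" for z w
    using F c that unfolding finsler_metric_def by force
  interpret smooth_lagrangian ?E ?W
  proof
    show "open ?W" by (intro open_Times charts_open_image[OF ch] open_delete open_UNIV)
    show "smooth_on ?E ?W" using F c by (simp add: finsler_metric_def)
  qed
  show "regular_lagrangian ?E ?W"
  proof
    fix x y :: "real ^ 'n" and l :: real
    assume z: "(x, y) \<in> ?W" and l: "l > 0"
    then show "(x, l *\<^sub>R y) \<in> ?W" by auto
    obtain p where "p \<in> fst c" "x = snd c p" using z by auto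
    then show "?E (x, l *\<^sub>R y) = l\<^sup>2 * ?E (x, y)" by (simp add: E hom power_mult_distrib)
  next
    fix z :: "(real ^ 'n) \<times> (real ^ 'n)" and w :: "real ^ 'n"
    assume z: "z \<in> ?W" and 0: "\<And>u. dderiv (0, u) (dderiv (0, w) ?E) z = 0"
    have "hess ?E z *v w = 0" using hess_mult[OF z, of w] 0 by (simp add: vec_eq_iff)
    then show "w = 0" using pd[OF z, of w] by force
  qed
  show "?E z > 0" if z: "z \<in> ?W"
  proof -
    obtain p y where p: "p \<in> fst c" "y \<noteq> 0" "z = (snd c p, y)" using z by auto
    then have "tangent A c p y \<in> slit_tangent_bundle A" using c unfolding slit_tangent_bundle_def by blast
    then have "F (tangent A c p y) > 0" using F by (simp add: finsler_metric_def)
    then show ?thesis by (simp add: p(3) E[OF p(1)])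
  qed
qed

section \<open>The Landsberg condition on the product manifold\<close>

text \<open>In the coordinates of \<open>c\<close>, \<open>a\<close> and \<open>b\<close> the product metric is a Minkowskian pullback. Comparing a single
  vector with its two components makes this usable for both implications of the theorem.\<close>

lemma landsberg_at_vector_iff:
  fixes A :: "('a, 'm::finite) chart set" and B :: "('b, 'n::finite) chart set"
  assumes M: "finsler_manifold X A F\<^sub>1" and N: "finsler_manifold Y B F\<^sub>2" and pf: "product_function f"
    and c: "c \<in> product_structure X A Y B" "p \<in> fst c"
    and a: "a \<in> A" "fst p \<in> fst a" and b: "b \<in> B" "snd p \<in> fst b"
    and v: "dderiv v (left_coords c a) (snd c p) \<noteq> 0"
      "dderiv v (right_coords c b) (snd c p) \<noteq> 0"
  shows "(\<forall>\<beta> \<gamma> \<eta>. landsberg_curvature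
        (energy (product_structure X A Y B) (minkowskian_product A F\<^sub>1 B F\<^sub>2 f) c) \<beta> \<gamma> \<eta> (snd c p, v) = 0) \<longleftrightarrow>
    (\<forall>\<beta> \<gamma> \<eta>. landsberg_curvature (energy A F\<^sub>1 a) \<beta> \<gamma> \<eta>
        (snd a (fst p), dderiv v (left_coords c a) (snd c p)) = 0) \<and>
    (\<forall>\<beta> \<gamma> \<eta>. landsberg_curvature (energy B F\<^sub>2 b) \<beta> \<gamma> \<eta>
        (snd b (snd p), dderiv v (right_coords c b) (snd c p)) = 0)"
proof -
  interpret manifold_pair X A Y B
    using M N by unfold_locales (simp_all add: finsler_manifold_def)
  let ?V = "common_dom c a b" and ?\<sigma> = "left_coords c a" and ?\<tau> = "right_coords c b"
  let ?K = "energy A F\<^sub>1 a" and ?H = "energy B F\<^sub>2 b"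
  let ?G = "energy C (minkowskian_product A F\<^sub>1 B F\<^sub>2 f) c"
  let ?W\<^sub>1 = "(snd a ` fst a) \<times> (UNIV - {0})" and ?W\<^sub>2 = "(snd b ` fst b) \<times> (UNIV - {0})"
  note K = finsler_regular_lagrangian[OF M a(1)] and H = finsler_regular_lagrangian[OF N b(1)]
  have coords: "?\<sigma> (snd c q) = snd a (fst q)" "?\<tau> (snd c q) = snd b (snd q)" if "q \<in> fst c" for q
    using chart_inv_chart[OF C_charts[OF c(1)] that] by (simp_all add: left_coords_def right_coords_def)
  have energy: "?G (x, y) = f (?K (tangent_map ?\<sigma> (x, y)), ?H (tangent_map ?\<tau> (x, y)))"
    if xV: "x \<in> ?V" for x y
  proof -
    obtain q where q: "q \<in> fst c" "fst q \<in> fst a" "snd q \<in> fst b" "x = snd c q"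
    proof -
      obtain q where "q \<in> fst c \<inter> (fst a \<times> fst b)" "x = snd c q"
        using xV unfolding common_dom_def by blast
      then show thesis using that[of q] by (simp add: mem_Times_iff)
    qed
    have "?K (tangent_map ?\<sigma> (x, y)) = (F\<^sub>1 (tangent A a (fst q) (dderiv y ?\<sigma> x)))\<^sup>2"
      "?H (tangent_map ?\<tau> (x, y)) = (F\<^sub>2 (tangent B b (snd q) (dderiv y ?\<tau> x)))\<^sup>2"
      by (simp_all add: energy_def tangent_map_def q(4) coords[OF q(1)]
          chart_inv_chart[OF A_charts[OF a(1)] q(2)] chart_inv_chart[OF B_charts[OF b(1)] q(3)])
    moreover have "f (s\<^sup>2, t\<^sup>2) \<ge> 0" for s t
      using pf by (simp add: product_function_def)
    ultimately show ?thesis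
      using differential_projections[OF c(1) q(1) a(1) q(2) b(1) q(3), of y]
      by (simp add: energy_def minkowskian_product_def q(4) chart_inv_chart[OF C_charts[OF c(1)] q(1)])
  qed
  interpret K: regular_lagrangian ?K ?W\<^sub>1 by (rule K)
  interpret H: regular_lagrangian ?H ?W\<^sub>2 by (rule H)
  interpret K: lagrangian_pullback ?K ?W\<^sub>1 ?V ?\<sigma>
    by unfold_locales (rule open_dom[OF c(1) a(1) b(1)], rule smooth_to_left[OF c(1) a(1) b(1)])
  interpret H: lagrangian_pullback ?H ?W\<^sub>2 ?V ?\<tau>
    by unfold_locales (rule open_dom[OF c(1) a(1) b(1)], rule smooth_to_right[OF c(1) a(1) b(1)])
  interpret minkowskian_pullback ?K ?W\<^sub>1 ?H ?W\<^sub>2 ?V ?\<sigma> ?\<tau> f ?G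
  proof
    show "product_function f" by (rule pf)
    show "?K z > 0" if "z \<in> ?W\<^sub>1" for z using K(2)[OF that] .
    show "?H z > 0" if "z \<in> ?W\<^sub>2" for z using H(2)[OF that] .
    show "\<exists>y. dderiv y ?\<sigma> x = u \<and> dderiv y ?\<tau> x = w" if "x \<in> ?V" for x u w
      by (rule splitting_bijective(1)[OF c(1) a(1) b(1) that])
    show "y = 0" if "x \<in> ?V" "dderiv y ?\<sigma> x = 0" "dderiv y ?\<tau> x = 0" for x y
      by (rule splitting_bijective(2)[OF c(1) a(1) b(1) that])
    show "?G z = f (?K (tangent_map ?\<sigma> z), ?H (tangent_map ?\<tau> z))" if "z \<in> K.dom_pullback" for z
      using energy[of "fst z" "snd z"] that by (simp add: K.dom_pullback_def)
  qed
  have x: "snd c p \<in> ?V" using in_dom[OF c(2) a(2) b(2)] .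
  have "(snd c p, v) \<in> W"
    using x v a b coords[OF c(2)] by (simp add: K.dom_pullback_def H.dom_pullback_def tangent_map_def)
  from landsberg_product_iff[OF this] show ?thesis
    by (simp add: tangent_map_def coords[OF c(2)])
qed

theorem theorem4p10:
  fixes M\<^sub>1 :: "'a topology" and A\<^sub>1 :: "('a, 'm::finite) chart set"
    and F\<^sub>1 :: "('a, 'm) tvec \<Rightarrow> real"
    and M\<^sub>2 :: "'b topology" and A\<^sub>2 :: "('b, 'n::finite) chart set"
    and F\<^sub>2 :: "('b, 'n) tvec \<Rightarrow> real"
    and f :: "real \<times> real \<Rightarrow> real"
  assumes "finsler_manifold M\<^sub>1 A\<^sub>1 F\<^sub>1"
    and "finsler_manifold M\<^sub>2 A\<^sub>2 F\<^sub>2"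
    and "product_function f"
  shows "landsberg_product M\<^sub>1 A\<^sub>1 F\<^sub>1 M\<^sub>2 A\<^sub>2 F\<^sub>2 f \<longleftrightarrow>
    landsberg_manifold A\<^sub>1 F\<^sub>1 \<and> landsberg_manifold A\<^sub>2 F\<^sub>2"
proof -
  interpret manifold_pair M\<^sub>1 A\<^sub>1 M\<^sub>2 A\<^sub>2
    using assms by unfold_locales (simp_all add: finsler_manifold_def)
  have A: "A\<^sub>1 \<subseteq> charts M\<^sub>1" "A\<^sub>2 \<subseteq> charts M\<^sub>2" using A_charts B_charts by auto
  note slit1 = tangent_in_slit_iff[OF A(1) A_compatible]
  note slit2 = tangent_in_slit_iff[OF A(2) B_compatible]
  note iff = landsberg_at_vector_iff[OF assms]
  let ?L1 = "\<lambda>a x v. \<forall>\<beta> \<gamma> \<eta>. landsberg_curvature (energy A\<^sub>1 F\<^sub>1 a) \<beta> \<gamma> \<eta> (x, v) = 0"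
  let ?L2 = "\<lambda>b x v. \<forall>\<beta> \<gamma> \<eta>. landsberg_curvature (energy A\<^sub>2 F\<^sub>2 b) \<beta> \<gamma> \<eta> (x, v) = 0"
  have L1: "landsberg_manifold A\<^sub>1 F\<^sub>1 \<longleftrightarrow> (\<forall>a\<in>A\<^sub>1. \<forall>p\<in>fst a. \<forall>v. v \<noteq> 0 \<longrightarrow> ?L1 a (snd a p) v)"
    using slit1 unfolding landsberg_manifold_def landsberg_on_def by auto
  have L2: "landsberg_manifold A\<^sub>2 F\<^sub>2 \<longleftrightarrow> (\<forall>b\<in>A\<^sub>2. \<forall>q\<in>fst b. \<forall>v. v \<noteq> 0 \<longrightarrow> ?L2 b (snd b q) v)"
    using slit2 unfolding landsberg_manifold_def landsberg_on_def by auto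
  show ?thesis
  proof
    assume L: "landsberg_product M\<^sub>1 A\<^sub>1 F\<^sub>1 M\<^sub>2 A\<^sub>2 F\<^sub>2 f"
    \<comment> \<open>Any two nonzero vectors of the factors are the components of one regular vector of the product, so
      each factor can be tested with an arbitrary nonzero vector in the other.\<close>
    have both: "?L1 a (snd a p) u \<and> ?L2 b (snd b q) w"
      if a: "a \<in> A\<^sub>1" "p \<in> fst a" "u \<noteq> 0" and b: "b \<in> A\<^sub>2" "q \<in> fst b" "w \<noteq> 0" for a p u b q w
    proof -
      let ?c = "product_chart a b"
      have c: "?c \<in> C" "(p, q) \<in> fst ?c" "fst (p, q) \<in> fst a" "snd (p, q) \<in> fst b"
        using product_chart_in_structure a b by auto
      let ?x = "snd ?c (p, q)"
      obtain y where y: "dderiv y (left_coords ?c a) ?x = u" "dderiv y (right_coords ?c b) ?x = w"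
        using splitting_bijective(1)[OF c(1) a(1) b(1) in_dom[OF c(2,3,4)]] by blast
      have "tangent C ?c (p, q) y \<in> product_regular_vectors M\<^sub>1 A\<^sub>1 M\<^sub>2 A\<^sub>2"
        using product_regular_iff[OF c(1,2) a(1) c(3) b(1) c(4), of y] y a(3) b(3) by blast
      then have "\<forall>\<beta> \<gamma> \<eta>. landsberg_curvature
          (energy C (minkowskian_product A\<^sub>1 F\<^sub>1 A\<^sub>2 F\<^sub>2 f) ?c) \<beta> \<gamma> \<eta> (?x, y) = 0"
        using L c(1,2) unfolding landsberg_product_def landsberg_on_def by blast
      then show ?thesis
        using iff[OF c(1,2) a(1) c(3) b(1) c(4), of y] y a(3) b(3) by (simp only: fst_conv snd_conv) blast
    qed
    \<comment> \<open>A nonzero vector to pair with, in whichever factor is not being tested.\<close>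
    have ne: "axis undefined 1 \<noteq> (0 :: real ^ 'k)" by (simp add: axis_eq_0_iff)
    obtain p\<^sub>0 q\<^sub>0 where "p\<^sub>0 \<in> topspace M\<^sub>1" "q\<^sub>0 \<in> topspace M\<^sub>2"
      using X Y unfolding smooth_manifold_def by blast
    then obtain a\<^sub>0 b\<^sub>0 where "a\<^sub>0 \<in> A\<^sub>1" "p\<^sub>0 \<in> fst a\<^sub>0" "b\<^sub>0 \<in> A\<^sub>2" "q\<^sub>0 \<in> fst b\<^sub>0"
      using A_cover B_cover by blast
    then show "landsberg_manifold A\<^sub>1 F\<^sub>1 \<and> landsberg_manifold A\<^sub>2 F\<^sub>2"
      unfolding L1 L2 using both ne by meson
  next
    assume L: "landsberg_manifold A\<^sub>1 F\<^sub>1 \<and> landsberg_manifold A\<^sub>2 F\<^sub>2"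
    show "landsberg_product M\<^sub>1 A\<^sub>1 F\<^sub>1 M\<^sub>2 A\<^sub>2 F\<^sub>2 f"
      unfolding landsberg_product_def landsberg_on_def
    proof (intro ballI allI impI)
      fix c p v \<beta> \<gamma> \<eta>
      assume c: "c \<in> C" "p \<in> fst c" and reg: "tangent C c p v \<in> product_regular_vectors M\<^sub>1 A\<^sub>1 M\<^sub>2 A\<^sub>2"
      obtain a b where a: "a \<in> A\<^sub>1" "fst p \<in> fst a" and b: "b \<in> A\<^sub>2" "snd p \<in> fst b"
        using C_cover[OF c] .
      have v: "dderiv v (left_coords c a) (snd c p) \<noteq> 0" "dderiv v (right_coords c b) (snd c p) \<noteq> 0"
        using product_regular_iff[OF c a b] reg by blast+
      have "?L1 a (snd a (fst p)) (dderiv v (left_coords c a) (snd c p))"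
        "?L2 b (snd b (snd p)) (dderiv v (right_coords c b) (snd c p))"
        using L a b v unfolding L1 L2 by blast+
      then show "landsberg_curvature (energy C (minkowskian_product A\<^sub>1 F\<^sub>1 A\<^sub>2 F\<^sub>2 f) c) \<beta> \<gamma> \<eta> (snd c p, v) = 0"
        using iff[OF c a b v] by blast
    qed
  qed
qed

end
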